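(* For every compact Hausdorff space $X$, the shapes of $\exp X$ and of $OS_f(X)$ coincide: $Sh(\exp X)=Sh(OS_f(X))$.
   Context: For a compact Hausdorff space $X$, $C(X)$ is the algebra of continuous functions $\varphi\colon X\to\mathbb{R}$ with pointwise operations and order; $c_X$ is the constant function with value $c\in\mathbb{R}$. $OS(X)$ is the set of all functionals $\mu\colon C(X)\to\mathbb{R}$ that are: weakly additive ($\mu(\varphi+c_X)=\mu(\varphi)+c$ for all $c\in\mathbb{R}$), order-preserving ($\varphi\le\psi$ implies $\mu(\varphi)\le\mu(\psi)$), normed ($\mu(1_X)=1$), positively homogeneous ($\mu(t\varphi)=t\mu(\varphi)$ for $t\ge 0$), and semiadditive ($\mu(\varphi+\psi)\le\mu(\varphi)+\mu(\psi)$). $OS(X)$ carries the topology of pointwise convergence on $C(X)$. $P(X)\subset OS(X)$ is the subspace of probability measures (linear, non-negative, normed functionals). $\delta_x$ is the Dirac measure at $x$. For nonempty $A\subset P(X)$ put $\nu_A(\varphi)=\sup\{\mu(\varphi):\mu\in A\}$; $cc(P(X))$ is the set of nonempty closed convex subsets of $P(X)$, and $\operatorname{ext}A$ is the set of extreme points of $A\in cc(P(X))$. $P_f(X)$ is the set of finitely supported probability measures $\mu=\sum_{i=1}^n\alpha_i\delta_{x_i}$ (with $x_1,\dots,x_n$ distinct, all $\alpha_i>0$, $\sum_i\alpha_i=1$, so $n=|\operatorname{supp}\mu|$) for which there is $i_0\in\{1,\dots,n\}$ with $\alpha_{i_0}\ge 1-\frac{1}{n+1}$. Then $OS_f(X)=\{\nu_A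 : A\in cc(P(X)),\ \operatorname{ext}A\subset P_f(X)\}\subset OS(X)$, with the subspace topology. $\exp X$ is the hyperspace of all nonempty closed subsets of $X$ with the Vietoris topology. Shape (Borsuk): let $Y,Z$ be compact (closed) subsets of metrizable absolute retracts $M,N$. A fundamental sequence $\mathbf f=\{f_k,Y,Z\}_{M,N}$ from $Y$ to $Z$ is a sequence of maps $f_k\colon M\to N$ such that for each neighborhood $V$ of $Z$ in $N$ there is a neighborhood $U$ of $Y$ in $M$ with $f_k|_U\simeq f_{k+1}|_U$ in $V$ for all but finitely many $k$. Two fundamental sequences $\{f_k\},\{f_k'\}$ from $Y$ to $Z$ are identified if for each neighborhood $V$ of $Z$ there is a neighborhood $U$ of $Y$ with $f_k|_U\simeq f'_k|_U$ in $V$ for all but finitely many $k$. $Y$ and $Z$ are fundamentally equivalent if there are fundamental sequences $\mathbf f\colon Y\to Z$ and $\mathbf g\colon Z\to Y$ with $\mathbf g\mathbf f=\mathrm{id}_{Y,M}$ and $\mathbf f\mathbf g=\mathrm{id}_{Z,N}$ (in this identification). The shape $Sh(Y)$ is the fundamental equivalence class of $Y$. For compact Hausdorff spaces that are not metrizable, $Sh$ is understood in the sense of standard shape theory of compact Hausdorff spaces (isomorphism class in the shape category), which agrees with Borsuk's notion for compact metrizable spaces. *)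

theory Defs
  imports "HOL-Analysis.Analysis"
begin

text \<open>Function spaces are represented by extensional functions, so that two elements
  are equal as soon as they agree on the intended domain: elements of \<open>C(X)\<close> are
  \<open>undefined\<close> off \<open>topspace X\<close>, functionals are \<open>undefined\<close> off \<open>C(X)\<close>.\<close>

definition cfun :: "'a topology \<Rightarrow> ('a \<Rightarrow> real) set" where
  "cfun X = {\<phi> \<in> extensional (topspace X). continuous_map X euclideanreal \<phi>}"

definition cf_const :: "'a topology \<Rightarrow> real \<Rightarrow> 'a \<Rightarrow> real" where
  "cf_const X c = (\<lambda>x\<in>topspace X. c)"

definition cf_add :: "'a topology \<Rightarrow> ('a \<Rightarrow> real) \<Rightarrow> ('a \<Rightarrow> real) \<Rightarrow> 'a \<Rightarrow> real" where
  "cf_add X \<phi> \<psi> = (\<lambda>x\<in>topspace X. \<phi> x + \<psi> x)"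

definition cf_scale :: "'a topology \<Rightarrow> real \<Rightarrow> ('a \<Rightarrow> real) \<Rightarrow> 'a \<Rightarrow> real" where
  "cf_scale X t \<phi> = (\<lambda>x\<in>topspace X. t * \<phi> x)"

definition cf_le :: "'a topology \<Rightarrow> ('a \<Rightarrow> real) \<Rightarrow> ('a \<Rightarrow> real) \<Rightarrow> bool" where
  "cf_le X \<phi> \<psi> \<longleftrightarrow> (\<forall>x\<in>topspace X. \<phi> x \<le> \<psi> x)"

type_synonym 'a functional = "('a \<Rightarrow> real) \<Rightarrow> real"

definition OS :: "'a topology \<Rightarrow> 'a functional set" where
  "OS X = {\<mu> \<in> extensional (cfun X).
     (\<forall>\<phi>\<in>cfun X. \<forall>c. \<mu> (cf_add X \<phi> (cf_const X c)) = \<mu> \<phi> + c) \<and>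
     (\<forall>\<phi>\<in>cfun X. \<forall>\<psi>\<in>cfun X. cf_le X \<phi> \<psi> \<longrightarrow> \<mu> \<phi> \<le> \<mu> \<psi>) \<and>
     \<mu> (cf_const X 1) = 1 \<and>
     (\<forall>\<phi>\<in>cfun X. \<forall>t\<ge>0. \<mu> (cf_scale X t \<phi>) = t * \<mu> \<phi>) \<and>
     (\<forall>\<phi>\<in>cfun X. \<forall>\<psi>\<in>cfun X. \<mu> (cf_add X \<phi> \<psi>) \<le> \<mu> \<phi> + \<mu> \<psi>)}"

definition OS_space :: "'a topology \<Rightarrow> 'a functional topology" where
  "OS_space X = subtopology (product_topology (\<lambda>_. euclideanreal) (cfun X)) (OS X)"

definition prob_functionals :: "'a topology \<Rightarrow> 'a functional set" where
  "prob_functionals X = {\<mu> \<in> extensional (cfun X).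
     (\<forall>\<phi>\<in>cfun X. \<forall>\<psi>\<in>cfun X. \<mu> (cf_add X \<phi> \<psi>) = \<mu> \<phi> + \<mu> \<psi>) \<and>
     (\<forall>\<phi>\<in>cfun X. \<forall>t. \<mu> (cf_scale X t \<phi>) = t * \<mu> \<phi>) \<and>
     (\<forall>\<phi>\<in>cfun X. cf_le X (cf_const X 0) \<phi> \<longrightarrow> 0 \<le> \<mu> \<phi>) \<and>
     \<mu> (cf_const X 1) = 1}"

definition prob_functionals_space :: "'a topology \<Rightarrow> 'a functional topology" where
  "prob_functionals_space X = subtopology (OS_space X) (prob_functionals X)"

definition dirac :: "'a topology \<Rightarrow> 'a \<Rightarrow> 'a functional" where
  "dirac X x = (\<lambda>\<phi>\<in>cfun X. \<phi> x)"

text \<open>Convexity and extreme points are spelled out because the function type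
  \<open>'a functional\<close> is not an instance of \<open>real_vector\<close>.\<close>

definition mix :: "'a topology \<Rightarrow> real \<Rightarrow> 'a functional \<Rightarrow> 'a functional \<Rightarrow> 'a functional" where
  "mix X t \<mu> \<nu> = (\<lambda>\<phi>\<in>cfun X. (1 - t) * \<mu> \<phi> + t * \<nu> \<phi>)"

definition cc_prob :: "'a topology \<Rightarrow> 'a functional set set" where
  "cc_prob X = {A. A \<noteq> {} \<and> closedin (prob_functionals_space X) A \<and>
     (\<forall>\<mu>\<in>A. \<forall>\<nu>\<in>A. \<forall>t\<in>{0..1}. mix X t \<mu> \<nu> \<in> A)}"

definition ext_points :: "'a topology \<Rightarrow> 'a functional set \<Rightarrow> 'a functional set" where
  "ext_points X A =
     {\<mu> \<in> A. \<not> (\<exists>\<mu>1\<in>A. \<exists>\<mu>2\<in>A. \<mu>1 \<noteq> \<mu>2 \<and> (\<exists>t\<in>{0<..<1}. \<mu> = mix X t \<mu>1 \<mu>2))}"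

definition nu :: "'a topology \<Rightarrow> 'a functional set \<Rightarrow> 'a functional" where
  "nu X A = (\<lambda>\<phi>\<in>cfun X. SUP \<mu>\<in>A. \<mu> \<phi>)"

text \<open>The finite set \<open>S\<close> is the support, and \<open>\<alpha>\<close> gives the masses of its points.\<close>

definition P_f :: "'a topology \<Rightarrow> 'a functional set" where
  "P_f X = {(\<lambda>\<phi>\<in>cfun X. \<Sum>x\<in>S. \<alpha> x * dirac X x \<phi>) | S \<alpha>.
     finite S \<and> S \<subseteq> topspace X \<and> (\<forall>x\<in>S. \<alpha> x > 0) \<and> sum \<alpha> S = 1 \<and>
     (\<exists>x0\<in>S. \<alpha> x0 \<ge> 1 - 1 / (real (card S) + 1))}"

definition OS_f :: "'a topology \<Rightarrow> 'a functional set" where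
  "OS_f X = {nu X A | A. A \<in> cc_prob X \<and> ext_points X A \<subseteq> P_f X}"

definition OS_f_space :: "'a topology \<Rightarrow> 'a functional topology" where
  "OS_f_space X = subtopology (OS_space X) (OS_f X)"

definition exp_sets :: "'a topology \<Rightarrow> 'a set set" where
  "exp_sets X = {F. closedin X F \<and> F \<noteq> {}}"

definition exp_space :: "'a topology \<Rightarrow> 'a set topology" where
  "exp_space X = topology_generated_by
     ((\<lambda>U. {F \<in> exp_sets X. F \<subseteq> U}) ` {U. openin X U} \<union>
      (\<lambda>U. {F \<in> exp_sets X. F \<inter> U \<noteq> {}}) ` {U. openin X U})"

text \<open>The shape category of compact Hausdorff spaces, following Mardesic's description
  (Shapes for topological spaces, 1973): a shape morphism from \<open>X\<close> to \<open>Y\<close> assigns to every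
  homotopy class of maps \<open>Y \<rightarrow> P\<close> into an ANR a homotopy class of maps \<open>X \<rightarrow> P\<close>, naturally
  in \<open>P\<close>.  Since compact Hausdorff spaces have expansions consisting of compact ANRs,
  it suffices to let \<open>P\<close> range over compact metrizable ANRs, as in the ANR-systems of
  Mardesic and Segal.  Every compact metrizable space embeds into the countable product of
  real lines, so the type \<^typ>\<open>nat \<Rightarrow> real\<close> contains all of them up to homeomorphism.
  At this type the library's \<^const>\<open>ANR\<close> quantifies over closed embeddings into subspaces of
  \<open>(nat \<Rightarrow> real) \<times> real\<close>, that is, into arbitrary separable metrizable spaces; for compact
  sets this agrees with being an ANR for metrizable spaces.  These definitions give the
  standard notion of shape only for compact Hausdorff \<open>X\<close> and \<open>Y\<close>.\<close>

definition compact_ANRs :: "(nat \<Rightarrow> real) set set" where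
  "compact_ANRs = {P. compact P \<and> ANR P}"

definition hclass :: "'a topology \<Rightarrow> (nat \<Rightarrow> real) set \<Rightarrow> ('a \<Rightarrow> nat \<Rightarrow> real) \<Rightarrow> ('a \<Rightarrow> nat \<Rightarrow> real) set" where
  "hclass X P f = {g. homotopic_with (\<lambda>_. True) X (top_of_set P) f g}"

definition hclasses :: "'a topology \<Rightarrow> (nat \<Rightarrow> real) set \<Rightarrow> ('a \<Rightarrow> nat \<Rightarrow> real) set set" where
  "hclasses X P = hclass X P ` {f. continuous_map X (top_of_set P) f}"

type_synonym ('a, 'b) shape_map =
  "(nat \<Rightarrow> real) set \<Rightarrow> ('b \<Rightarrow> nat \<Rightarrow> real) set \<Rightarrow> ('a \<Rightarrow> nat \<Rightarrow> real) set"

definition shape_morphisms :: "'a topology \<Rightarrow> 'b topology \<Rightarrow> ('a, 'b) shape_map set" where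
  "shape_morphisms X Y =
     {\<alpha> \<in> (\<Pi>\<^sub>E P\<in>compact_ANRs. hclasses Y P \<rightarrow>\<^sub>E hclasses X P).
        \<forall>P\<in>compact_ANRs. \<forall>Q\<in>compact_ANRs. \<forall>u f g.
          continuous_map (top_of_set P) (top_of_set Q) u \<longrightarrow>
          continuous_map Y (top_of_set P) f \<longrightarrow>
          g \<in> \<alpha> P (hclass Y P f) \<longrightarrow>
          \<alpha> Q (hclass Y Q (u \<circ> f)) = hclass X Q (u \<circ> g)}"

definition shape_id :: "'a topology \<Rightarrow> ('a, 'a) shape_map" where
  "shape_id X = (\<lambda>P\<in>compact_ANRs. \<lambda>c\<in>hclasses X P. c)"

definition shape_comp ::
    "'c topology \<Rightarrow> ('b, 'c) shape_map \<Rightarrow> ('a, 'b) shape_map \<Rightarrow> ('a, 'c) shape_map" where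
  "shape_comp Z \<beta> \<alpha> = (\<lambda>P\<in>compact_ANRs. \<lambda>c\<in>hclasses Z P. \<alpha> P (\<beta> P c))"

text \<open>\<open>Sh(X) = Sh(Y)\<close>, as a relation because the carrier types of the two spaces may differ.\<close>

definition same_shape :: "'a topology \<Rightarrow> 'b topology \<Rightarrow> bool" where
  "same_shape X Y \<longleftrightarrow>
     (\<exists>\<alpha>\<in>shape_morphisms X Y. \<exists>\<beta>\<in>shape_morphisms Y X.
        shape_comp X \<beta> \<alpha> = shape_id X \<and> shape_comp Y \<alpha> \<beta> = shape_id Y)"

end

theory Submission
  imports Defs
begin

text \<open>
  A functional \<open>\<nu> \<in> OS_f X\<close> is the supremum of the measures \<open>k \<in> P_f X\<close> that lie below it: the
  supremum over a compact convex set is attained at an extreme point (\<open>Krein_Milman_attained\<close>).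
  Conversely every nonempty set of measures from \<open>P_f X\<close> has its supremum in \<open>OS_f X\<close>, because
  \<open>P_f X\<close> is compact (\<open>compactin_P_f\<close>) and therefore contains the extreme points of the closed
  convex hull of each of its subsets (\<open>Milman\<close>).  Together they make \<open>OS_f X\<close> compact.

  Every \<open>k \<in> P_f X\<close> has an atom of mass at least \<open>2/3\<close>.  Let \<open>center X \<nu>\<close> be the closure of the set
  of these atoms, for all \<open>k\<close> below \<open>\<nu>\<close>.  The values of \<open>\<nu>\<close> detect it.  Let \<open>\<phi>\<close> have values in
  \<open>[0,1]\<close>.  If \<open>\<phi>\<close> is 1 at one of these atoms, then \<open>\<nu> \<phi> \<ge> 2/3\<close>; if \<open>\<phi>\<close> vanishes on the center,
  then \<open>\<nu> \<phi> \<le> 1/3\<close>.  Because of the gap the center depends continuously on \<open>\<nu>\<close>.  A closed set \<open>F\<close>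
  is the center of the functional \<open>\<phi> \<mapsto> max \<phi>(F)\<close>, which is \<open>spread X 0 F\<close>.  So \<open>exp X\<close> is a retract
  of \<open>OS_f X\<close>, and for equality of shapes it remains to prove that \<open>g \<circ> spread X 0 \<circ> center X\<close> is
  homotopic to \<open>g\<close> for every map \<open>g\<close> from \<open>OS_f X\<close> to a compact ANR.

  Such a map extends to a neighbourhood of \<open>OS_f X\<close> in a cube of functionals
  (\<open>compact_ANR_neighbourhood_extension\<close>).  By compactness a functional belongs to this neighbourhood
  if it agrees up to some \<open>\<epsilon> > 0\<close> with a member of \<open>OS_f X\<close> on finitely many test functions.  A
  homotopy may leave \<open>OS_f X\<close> by that much, and this freedom is essential.  The obvious homotopy
  moves every \<open>k\<close> to its main atom, but it does not act on functionals: \<open>k\<close> can be a mixture of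
  measures below \<open>\<nu>\<close> whose main atoms differ from that of \<open>k\<close>, and the result depends on whether
  \<open>k\<close> is used to represent \<open>\<nu>\<close>.

  The homotopy that works only enlarges functionals.  Take a fine finite net of points \<open>y\<close> with
  bump functions \<open>\<psi> y\<close>.  To the measures \<open>k\<close> below \<open>\<nu>\<close> add the normalized measures
  \<open>k + t (k (\<psi> y) - 1/2)\<^sup>+ \<delta>\<^sub>y\<close>.  The weight of \<open>\<delta>\<^sub>y\<close> is a convex function of \<open>k\<close>, so the supremum
  \<open>grow X Y \<psi> t \<nu>\<close> depends on \<open>\<nu>\<close> alone.  It can even be computed from finitely many values of \<open>\<nu>\<close>
  (\<open>less_grow_iff\<close>, \<open>grow_less_iff\<close>), hence it is continuous in \<open>t\<close> and \<open>\<nu>\<close>.  The weight is positive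
  only if \<open>y\<close> is close to the main atom of \<open>k\<close>, and a shift of mass to the main atom does not lead
  out of \<open>P_f X\<close>, so the functional stays close to \<open>OS_f X\<close>.  For large \<open>t\<close> it almost dominates
  \<open>spread X 0 (center X \<nu>)\<close>.

  From there, join with \<open>spread X t (center X \<nu>)\<close>, the supremum of the measures
  \<open>(1 - t/3) \<delta>\<^sub>y + (t/3) \<delta>\<^sub>z\<close> with \<open>y\<close> in the center and \<open>z\<close> arbitrary.  At \<open>t = 1\<close> this dominates
  every \<open>k\<close> below \<open>\<nu>\<close>, because all the mass that \<open>k\<close> has beyond \<open>2/3\<close> of its main atom is at most
  \<open>1/3\<close>.  So the join is almost \<open>spread X 1 (center X \<nu>)\<close>, and letting \<open>t\<close> return to 0 inside
  \<open>OS_f X\<close> ends at \<open>spread X 0 (center X \<nu>)\<close> (\<open>homotopic_to_spread_center\<close>).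
\<close>

section \<open>Shape and maps into compact ANRs\<close>

lemma hclass_eqI:
  assumes "homotopic_with (\<lambda>_. True) X (top_of_set P) f g"
  shows "hclass X P f = hclass X P g"
  unfolding hclass_def using assms homotopic_with_trans homotopic_with_symD by blast

lemma hclass_self:
  assumes "continuous_map X (top_of_set P) f"
  shows "f \<in> hclass X P f"
  using assms by (simp add: hclass_def)

text \<open>  \<open>SOME\<close> picks a representative of the class \<open>c\<close>; homotopic representatives stay homotopic after
  composition with \<open>m\<close>, so the choice does not matter.\<close>

definition induced_shape_map ::
    "'a topology \<Rightarrow> 'b topology \<Rightarrow> ('a \<Rightarrow> 'b) \<Rightarrow> ('a, 'b) shape_map" where
  "induced_shape_map X Y m =
     (\<lambda>P\<in>compact_ANRs. \<lambda>c\<in>hclasses Y P. hclass X P ((SOME f. f \<in> c) \<circ> m))"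

lemma induced_shape_map_hclass:
  assumes m: "continuous_map X Y m" and P: "P \<in> compact_ANRs"
    and f: "continuous_map Y (top_of_set P) f"
  shows "induced_shape_map X Y m P (hclass Y P f) = hclass X P (f \<circ> m)"
proof -
  define g where "g = (SOME g. g \<in> hclass Y P f)"
  have "g \<in> hclass Y P f"
    unfolding g_def using someI[of "\<lambda>g. g \<in> hclass Y P f" f] hclass_self[OF f] by simp
  then have "homotopic_with (\<lambda>_. True) Y (top_of_set P) f g"
    by (simp add: hclass_def)
  then have "hclass X P (f \<circ> m) = hclass X P (g \<circ> m)"
    by (intro hclass_eqI homotopic_with_compose_continuous_map_right[OF _ m]) auto
  moreover have "hclass Y P f \<in> hclasses Y P"
    using f by (simp add: hclasses_def)
  ultimately show ?thesis
    using P by (simp add: induced_shape_map_def g_def)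
qed

lemma induced_shape_map_in:
  assumes m: "continuous_map X Y m"
  shows "induced_shape_map X Y m \<in> shape_morphisms X Y"
proof -
  have fm: "continuous_map X (top_of_set P) (f \<circ> m)"
    if "continuous_map Y (top_of_set P) f" for P f
    using continuous_map_compose[OF m that] .
  have "induced_shape_map X Y m \<in> (\<Pi>\<^sub>E P\<in>compact_ANRs. hclasses Y P \<rightarrow>\<^sub>E hclasses X P)"
  proof (rule PiE_I)
    fix P :: "(nat \<Rightarrow> real) set"
    assume P: "P \<in> compact_ANRs"
    show "induced_shape_map X Y m P \<in> hclasses Y P \<rightarrow>\<^sub>E hclasses X P"
    proof (rule PiE_I)
      fix c assume "c \<in> hclasses Y P"
      then obtain f where f: "continuous_map Y (top_of_set P) f" "c = hclass Y P f"
        by (auto simp: hclasses_def)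
      then show "induced_shape_map X Y m P c \<in> hclasses X P"
        using induced_shape_map_hclass[OF m P f(1)] fm[OF f(1)] by (simp add: hclasses_def)
    qed (use P in \<open>simp add: induced_shape_map_def\<close>)
  qed (simp add: induced_shape_map_def)
  moreover have "induced_shape_map X Y m Q (hclass Y Q (u \<circ> f)) = hclass X Q (u \<circ> g)"
    if P: "P \<in> compact_ANRs" and Q: "Q \<in> compact_ANRs"
      and u: "continuous_map (top_of_set P) (top_of_set Q) u"
      and f: "continuous_map Y (top_of_set P) f"
      and g: "g \<in> induced_shape_map X Y m P (hclass Y P f)" for P Q u f g
  proof -
    have "homotopic_with (\<lambda>_. True) X (top_of_set P) (f \<circ> m) g"
      using g induced_shape_map_hclass[OF m P f] by (simp add: hclass_def)
    then have "homotopic_with (\<lambda>_. True) X (top_of_set Q) (u \<circ> (f \<circ> m)) (u \<circ> g)"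
      by (rule homotopic_with_compose_continuous_map_left[OF _ u]) simp
    from hclass_eqI[OF this] show ?thesis
      using induced_shape_map_hclass[OF m Q continuous_map_compose[OF f u]]
      by (simp add: comp_assoc)
  qed
  ultimately show ?thesis
    unfolding shape_morphisms_def by (intro CollectI conjI ballI allI impI) assumption+
qed

text \<open>  Shape sees a space only through homotopy classes of maps into compact ANRs.  So \<open>s\<close> and \<open>r\<close> are
  inverse to each other in the shape category as soon as both composites become homotopic to the
  identity after every such map, with a homotopy that may depend on the map.\<close>

lemma same_shape_if_ANR_homotopic:
  assumes s: "continuous_map X Y s" and r: "continuous_map Y X r"
    and rs: "\<And>P g. \<lbrakk>P \<in> compact_ANRs; continuous_map X (top_of_set P) g\<rbrakk> \<Longrightarrow>
        homotopic_with (\<lambda>_. True) X (top_of_set P) (g \<circ> r \<circ> s) g"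
    and sr: "\<And>P g. \<lbrakk>P \<in> compact_ANRs; continuous_map Y (top_of_set P) g\<rbrakk> \<Longrightarrow>
        homotopic_with (\<lambda>_. True) Y (top_of_set P) (g \<circ> s \<circ> r) g"
  shows "same_shape X Y"
proof -
  have id: "shape_comp Z (induced_shape_map W Z p) (induced_shape_map Z W q) = shape_id Z"
    if p: "continuous_map W Z p" and q: "continuous_map Z W q"
      and h: "\<And>P g. \<lbrakk>P \<in> compact_ANRs; continuous_map Z (top_of_set P) g\<rbrakk> \<Longrightarrow>
        homotopic_with (\<lambda>_. True) Z (top_of_set P) (g \<circ> p \<circ> q) g"
    for Z :: "'x topology" and W :: "'y topology" and p q
  proof -
    have "induced_shape_map Z W q P (induced_shape_map W Z p P c) = c"
      if P: "P \<in> compact_ANRs" and c: "c \<in> hclasses Z P" for P c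
    proof -
      obtain f where f: "continuous_map Z (top_of_set P) f" "c = hclass Z P f"
        using c by (auto simp: hclasses_def)
      show ?thesis
        using induced_shape_map_hclass[OF p P f(1)]
          induced_shape_map_hclass[OF q P continuous_map_compose[OF p f(1)]]
          hclass_eqI[OF h[OF P f(1)]] f(2) by simp
    qed
    then show ?thesis
      unfolding shape_comp_def shape_id_def by (intro restrict_ext) auto
  qed
  show ?thesis
    unfolding same_shape_def
    using induced_shape_map_in[OF s] induced_shape_map_in[OF r] id[OF r s rs] id[OF s r sr]
    by blast
qed

text \<open>  The coordinates of \<open>f\<close> extend to \<open>Y\<close> by Tietze's theorem.  The set \<open>P \<times> {0}\<close> is a retract of an
  open set \<open>T\<close>, and on the preimage of \<open>T\<close> the extension can be pushed back into \<open>P\<close>.\<close>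

lemma compact_ANR_neighbourhood_extension:
  fixes P :: "(nat \<Rightarrow> real) set"
  assumes Y: "normal_space Y" and C: "closedin Y C"
    and P: "P \<in> compact_ANRs" and f: "continuous_map (subtopology Y C) (top_of_set P) f"
  obtains W f' where "openin Y W" "C \<subseteq> W" "continuous_map (subtopology Y W) (top_of_set P) f'"
    "\<And>x. x \<in> C \<Longrightarrow> f' x = f x"
proof -
  have fi: "continuous_map (subtopology Y C) euclideanreal (\<lambda>x. f x i)" for i
  proof -
    have "continuous_map (subtopology Y C) (product_topology (\<lambda>_. euclideanreal) (UNIV::nat set)) f"
      unfolding euclidean_product_topology using f continuous_map_in_subtopology by blast
    then show ?thesis
      by (simp add: continuous_map_componentwise_UNIV)
  qed
  have "\<exists>g. continuous_map Y euclideanreal g \<and> (\<forall>x\<in>C. g x = f x i)" for i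
  proof -
    obtain g where "continuous_map Y euclideanreal g" "\<And>x. x \<in> C \<Longrightarrow> g x = f x i"
      by (rule Tietze_extension_realinterval[OF Y C is_interval_univ UNIV_not_empty fi[of i] subset_UNIV])
        (rule that)
    then show ?thesis by blast
  qed
  then obtain g where g: "\<And>i. continuous_map Y euclideanreal (g i)" "\<And>i x. x \<in> C \<Longrightarrow> g i x = f x i"
    by metis
  \<comment> \<open>The second coordinate is there because \<open>ANR\<close> is defined by embeddings into a product with the reals.\<close>
  define G where "G = (\<lambda>x. (\<lambda>i. g i x, 0::real))"
  have "continuous_map Y (product_topology (\<lambda>_. euclideanreal) (UNIV::nat set)) (\<lambda>x i. g i x)"
    by (simp add: continuous_map_componentwise_UNIV g)
  then have "continuous_map Y (prod_topology euclidean euclideanreal) G"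
    unfolding euclidean_product_topology G_def by (intro continuous_map_pairedI) auto
  then have contG: "continuous_map Y euclidean G"
    by simp
  have hom: "P homeomorphic (P \<times> {0::real})"
    unfolding homeomorphic_def homeomorphism_def
    by (intro exI[of _ "\<lambda>x. (x, 0)"] exI[of _ fst])
      (auto intro: continuous_on_fst continuous_on_id continuous_on_Pair continuous_on_const)
  have "compact P"
    using P by (simp add: compact_ANRs_def)
  then have "closed (P \<times> {0::real})"
    by (intro compact_imp_closed compact_Times) auto
  then have "closedin (top_of_set UNIV) (P \<times> {0::real})"
    by simp
  moreover have "ANR P"
    using P by (simp add: compact_ANRs_def)
  ultimately obtain T where "openin (top_of_set UNIV) T" and T2: "(P \<times> {0::real}) retract_of T"
    using hom unfolding ANR_def by blast
  then have T: "open T" "(P \<times> {0::real}) retract_of T"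
    using T2 by simp_all
  then obtain r where r: "continuous_on T r" "r ` T \<subseteq> P \<times> {0}" "\<And>x. x \<in> P \<times> {0} \<Longrightarrow> r x = x"
      and PT: "P \<times> {0} \<subseteq> T"
    by (auto simp: retract_of_def retraction_def)
  define W where "W = {x \<in> topspace Y. G x \<in> T}"
  have fP: "f x \<in> P" if "x \<in> C" for x
  proof -
    have "x \<in> topspace (subtopology Y C)"
      using that closedin_subset[OF C] by auto
    then show ?thesis
      using f continuous_map_image_subset_topspace by fastforce
  qed
  have GC: "G x = (f x, 0)" if "x \<in> C" for x
    using g(2)[OF that] by (simp add: G_def)
  show thesis
  proof
    show "openin Y W"
      unfolding W_def using openin_continuous_map_preimage[OF contG] T(1) by simp
    show "C \<subseteq> W"
      using GC fP PT closedin_subset[OF C] by (auto simp: W_def)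
    have "continuous_map (subtopology Y W) (top_of_set T) G"
      by (intro continuous_map_into_subtopology continuous_map_from_subtopology contG)
        (auto simp: W_def)
    moreover have "continuous_map (top_of_set T) (top_of_set P) (fst \<circ> r)"
      using r(1,2) by (auto simp: o_def intro!: continuous_on_fst)
    ultimately show "continuous_map (subtopology Y W) (top_of_set P) ((fst \<circ> r) \<circ> G)"
      by (rule continuous_map_compose)
    show "((fst \<circ> r) \<circ> G) x = f x" if "x \<in> C" for x
      using GC[OF that] fP[OF that] r(3) by simp
  qed
qed

section \<open>The Hahn-Banach theorem for spaces of functions\<close>

definition sublinear_on :: "('k \<Rightarrow> real) set \<Rightarrow> (('k \<Rightarrow> real) \<Rightarrow> real) \<Rightarrow> bool" where
  "sublinear_on V p \<longleftrightarrow>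
     (\<forall>u\<in>V. \<forall>v\<in>V. p (\<lambda>k. u k + v k) \<le> p u + p v) \<and>
     (\<forall>u\<in>V. \<forall>c\<ge>0. p (\<lambda>k. c * u k) = c * p u)"

lemma sublinear_onI:
  assumes scale: "\<And>u c. u \<in> V \<Longrightarrow> (\<lambda>k. c * u k) \<in> V"
    and add: "\<And>u v. \<lbrakk>u \<in> V; v \<in> V\<rbrakk> \<Longrightarrow> p (\<lambda>k. u k + v k) \<le> p u + p v"
    and le: "\<And>u c. \<lbrakk>u \<in> V; 0 < c\<rbrakk> \<Longrightarrow> p (\<lambda>k. c * u k) \<le> c * p u"
    and zero: "\<And>u. u \<in> V \<Longrightarrow> p (\<lambda>k. 0) = 0"
  shows "sublinear_on V p"
  unfolding sublinear_on_def
proof (intro conjI ballI allI impI)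
  fix u and c :: real assume u: "u \<in> V" and c: "0 \<le> c"
  show "p (\<lambda>k. c * u k) = c * p u"
  proof (cases "c = 0")
    case True then show ?thesis using zero[OF u] by simp
  next
    case False
    then have c0: "0 < c" using c by simp
    have "p (\<lambda>k. (1 / c) * (c * u k)) \<le> (1 / c) * p (\<lambda>k. c * u k)"
      by (rule le[OF scale[OF u]]) (use c0 in simp)
    moreover have "(\<lambda>k. (1 / c) * (c * u k)) = u" using c0 by auto
    ultimately show ?thesis using le[OF u c0] c0 by (simp add: field_simps)
  qed
qed (rule add)

text \<open>  A minimal sublinear functional \<open>m\<close> below \<open>q\<close> is linear.  Zorn's lemma provides it, since pointwise
  infima of chains stay sublinear.\<close>

lemma Hahn_Banach_functions:
  fixes V :: "('k \<Rightarrow> real) set"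
  assumes add: "\<And>u v. \<lbrakk>u \<in> V; v \<in> V\<rbrakk> \<Longrightarrow> (\<lambda>k. u k + v k) \<in> V"
    and scale: "\<And>u c. u \<in> V \<Longrightarrow> (\<lambda>k. c * u k) \<in> V"
    and q: "sublinear_on V q"
  obtains \<Lambda> where "\<And>u. u \<in> V \<Longrightarrow> \<Lambda> u \<le> q u"
    "\<And>u v. \<lbrakk>u \<in> V; v \<in> V\<rbrakk> \<Longrightarrow> \<Lambda> (\<lambda>k. u k + v k) = \<Lambda> u + \<Lambda> v"
    "\<And>u c. u \<in> V \<Longrightarrow> \<Lambda> (\<lambda>k. c * u k) = c * \<Lambda> u"
proof -
  define S where "S = {p \<in> extensional V. sublinear_on V p \<and> (\<forall>u\<in>V. p u \<le> q u)}"
  define R where "R = (\<lambda>p p' :: ('k \<Rightarrow> real) \<Rightarrow> real. \<forall>u\<in>V. p' u \<le> p u)"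
  have neg: "(\<lambda>k. - u k) \<in> V" if "u \<in> V" for u
    using scale[OF that, of "-1"] by simp
  have sub_add: "p (\<lambda>k. u k + v k) \<le> p u + p v" if "sublinear_on V p" "u \<in> V" "v \<in> V" for p u v
    using that by (simp add: sublinear_on_def)
  have sub_scale: "p (\<lambda>k. c * u k) = c * p u" if "sublinear_on V p" "u \<in> V" "c \<ge> 0" for p u c
    using that by (simp add: sublinear_on_def)
  have sub0: "p (\<lambda>k. 0) = 0" if "sublinear_on V p" "u \<in> V" for p u
    using sub_scale[OF that, of 0] by simp
  have sub_neg: "- p (\<lambda>k. - u k) \<le> p u" if "sublinear_on V p" "u \<in> V" for p u
    using sub_add[OF that neg[OF that(2)]] sub0[OF that] by simp
  have qS: "restrict q V \<in> S"
  proof -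
    have "sublinear_on V (restrict q V)"
      using q add scale by (simp add: sublinear_on_def)
    then show ?thesis by (simp add: S_def)
  qed
  have po: "partial_order_on S (relation_of R S)"
  proof (rule partial_order_on_relation_ofI)
    show "R a a" if "a \<in> S" for a by (simp add: R_def)
    show "R a c" if "R a b" "R b c" for a b c using that unfolding R_def by (meson order_trans)
    show "a = b" if "a \<in> S" "b \<in> S" "R a b" "R b a" for a b
    proof (rule extensionalityI)
      show "a \<in> extensional V" "b \<in> extensional V" using that by (auto simp: S_def)
      show "a x = b x" if "x \<in> V" for x
        using \<open>R a b\<close> \<open>R b a\<close> that by (auto simp: R_def intro: antisym)
    qed
  qed
  have lower: "- q (\<lambda>k. - u k) \<le> p u" if "p \<in> S" "u \<in> V" for p u
  proof -
    have "p (\<lambda>k. - u k) \<le> q (\<lambda>k. - u k)" using that neg by (simp add: S_def)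
    then show ?thesis using sub_neg[of p u] that by (simp add: S_def)
  qed
  have "\<exists>m\<in>S. \<forall>a\<in>S. R m a \<longrightarrow> a = m"
  proof (rule predicate_Zorn[OF po])
    fix C assume C: "C \<in> Chains (relation_of R S)"
    show "\<exists>u\<in>S. \<forall>a\<in>C. R a u"
    proof (cases "C = {}")
      case True then show ?thesis using qS by blast
    next
      case False
      have CS: "C \<subseteq> S" using C by (auto simp: Chains_def relation_of_def)
      have tot: "R a b \<or> R b a" if "a \<in> C" "b \<in> C" for a b
        using C that by (auto simp: Chains_def relation_of_def)
      define m where "m = (\<lambda>u\<in>V. INF p\<in>C. p u)"
      have bdd: "bdd_below ((\<lambda>p. p u) ` C)" if "u \<in> V" for u
        using lower that CS by (intro bdd_belowI[of _ "- q (\<lambda>k. - u k)"]) auto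
      have mle: "m u \<le> p u" if "p \<in> C" "u \<in> V" for p u
        unfolding m_def using cINF_lower[OF bdd[OF that(2)] that(1)] that(2) by simp
      have mge: "c \<le> m u" if "u \<in> V" "\<And>p. p \<in> C \<Longrightarrow> c \<le> p u" for c u
        using that False by (simp add: m_def cINF_greatest)
      have "sublinear_on V m"
      proof (rule sublinear_onI[OF scale])
        fix u v assume u: "u \<in> V" and v: "v \<in> V"
        have "m (\<lambda>k. u k + v k) - m v \<le> m u"
        proof (rule mge[OF u])
          fix p assume p: "p \<in> C"
          have "m (\<lambda>k. u k + v k) - p u \<le> m v"
          proof (rule mge[OF v])
            fix p' assume p': "p' \<in> C"
            \<comment> \<open>In a chain one of the two functionals lies below the other, so a single \<open>p''\<close> bounds both.\<close>
            obtain p'' where p'': "p'' \<in> C" "R p p''" "R p' p''"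
              using tot[OF p p'] p p' by (auto simp: R_def)
            have "m (\<lambda>k. u k + v k) \<le> p'' u + p'' v"
              using mle[OF p''(1) add[OF u v]] sub_add[of p'' u v] u v p''(1) CS
              by (fastforce simp: S_def)
            also have "\<dots> \<le> p u + p' v"
              using p'' u v by (auto simp: R_def intro: add_mono)
            finally show "m (\<lambda>k. u k + v k) - p u \<le> p' v" by simp
          qed
          then show "m (\<lambda>k. u k + v k) - m v \<le> p u" by simp
        qed
        then show "m (\<lambda>k. u k + v k) \<le> m u + m v" by simp
      next
        fix u and c :: real assume u: "u \<in> V" and c: "0 < c"
        have "m (\<lambda>k. c * u k) / c \<le> m u"
        proof (rule mge[OF u])
          fix p assume p: "p \<in> C"
          then have "p (\<lambda>k. c * u k) = c * p u"
            using sub_scale u c CS by (auto simp: S_def)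
          then show "m (\<lambda>k. c * u k) / c \<le> p u"
            using mle[OF p scale[OF u, of c]] c by (simp add: field_simps)
        qed
        then show "m (\<lambda>k. c * u k) \<le> c * m u" using c by (simp add: field_simps)
      next
        fix u assume u: "u \<in> V"
        have "p (\<lambda>k. 0) = 0" if "p \<in> C" for p
          using that CS sub0[OF _ u] by (auto simp: S_def)
        then have "(INF p\<in>C. p (\<lambda>k. 0)) = (INF p\<in>C. 0)"
          by (intro arg_cong[of _ _ Inf] image_cong) auto
        then show "m (\<lambda>k. 0) = 0"
          using scale[OF u, of 0] \<open>C \<noteq> {}\<close> by (simp add: m_def)
      qed
      moreover have "m u \<le> q u" if "u \<in> V" for u
      proof -
        obtain p where "p \<in> C" using False by blast
        then show ?thesis using mle[of p u] that CS by (fastforce simp: S_def)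
      qed
      ultimately have "m \<in> S" by (simp add: S_def m_def)
      then show ?thesis using mle by (auto simp: R_def)
    qed
  qed
  then obtain m where m: "m \<in> S" and min: "\<And>a. a \<in> S \<Longrightarrow> R m a \<Longrightarrow> a = m" by blast
  have sm: "sublinear_on V m" using m by (simp add: S_def)
  \<comment> \<open>The functional \<open>a\<close> below is again sublinear and lies below \<open>m\<close>, and it is linear in the direction of
    \<open>v\<close>.  Minimality forces \<open>a = m\<close>.\<close>
  have odd: "m (\<lambda>k. - v k) = - m v" if v: "v \<in> V" for v
  proof -
    define a where "a = (\<lambda>u\<in>V. INF t\<in>{0..}. m (\<lambda>k. u k + t * v k) - t * m v)"
    have uv: "(\<lambda>k. u k + t * v k) \<in> V" if "u \<in> V" for u t using that v add scale by simp
    have low: "- m (\<lambda>k. - u k) \<le> m (\<lambda>k. u k + t * v k) - t * m v" if "u \<in> V" "t \<ge> 0" for u t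
      using sub_add[OF sm uv[OF that(1), of t] neg[OF that(1)]] sub_scale[OF sm v that(2)] by simp
    have bdd: "bdd_below ((\<lambda>t. m (\<lambda>k. u k + t * v k) - t * m v) ` {0..})" if "u \<in> V" for u
      using low[OF that] by (intro bdd_belowI[of _ "- m (\<lambda>k. - u k)"]) auto
    have ale: "a u \<le> m (\<lambda>k. u k + t * v k) - t * m v" if "u \<in> V" "t \<ge> 0" for u t
      unfolding a_def using that cINF_lower[OF bdd[OF that(1)], of t] by simp
    have age: "c \<le> a u" if "u \<in> V" "\<And>t. t \<ge> 0 \<Longrightarrow> c \<le> m (\<lambda>k. u k + t * v k) - t * m v" for c u
      unfolding a_def using that by (auto intro!: cINF_greatest)
    have am: "a u \<le> m u" if "u \<in> V" for u using ale[OF that, of 0] by simp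
    have "sublinear_on V a"
    proof (rule sublinear_onI[OF scale])
      fix u w assume u: "u \<in> V" and w: "w \<in> V"
      have "a (\<lambda>k. u k + w k) - a w \<le> a u"
      proof (rule age[OF u])
        fix t :: real assume t: "0 \<le> t"
        have "a (\<lambda>k. u k + w k) - (m (\<lambda>k. u k + t * v k) - t * m v) \<le> a w"
        proof (rule age[OF w])
          fix t' :: real assume t': "0 \<le> t'"
          have "a (\<lambda>k. u k + w k) \<le> m (\<lambda>k. (u k + w k) + (t + t') * v k) - (t + t') * m v"
            using ale[OF add[OF u w], of "t + t'"] t t' by simp
          also have "(\<lambda>k. (u k + w k) + (t + t') * v k)
              = (\<lambda>k. (u k + t * v k) + (w k + t' * v k))"
            by (auto simp: algebra_simps)
          finally show "a (\<lambda>k. u k + w k) - (m (\<lambda>k. u k + t * v k) - t * m v)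
              \<le> m (\<lambda>k. w k + t' * v k) - t' * m v"
            using sub_add[OF sm uv[OF u, of t] uv[OF w, of t']] by (simp add: algebra_simps)
        qed
        then show "a (\<lambda>k. u k + w k) - a w \<le> m (\<lambda>k. u k + t * v k) - t * m v" by simp
      qed
      then show "a (\<lambda>k. u k + w k) \<le> a u + a w" by simp
    next
      fix u and c :: real assume u: "u \<in> V" and c: "0 < c"
      have "a (\<lambda>k. c * u k) / c \<le> a u"
      proof (rule age[OF u])
        fix t :: real assume t: "0 \<le> t"
        have "m (\<lambda>k. c * u k + (c * t) * v k) = c * m (\<lambda>k. u k + t * v k)"
          using sub_scale[OF sm uv[OF u, of t], of c] c by (simp add: algebra_simps)
        then have "a (\<lambda>k. c * u k) \<le> c * m (\<lambda>k. u k + t * v k) - (c * t) * m v"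
          using ale[OF scale[OF u], of "c * t" c] t c by simp
        then show "a (\<lambda>k. c * u k) / c \<le> m (\<lambda>k. u k + t * v k) - t * m v"
          using c by (simp add: field_simps)
      qed
      then show "a (\<lambda>k. c * u k) \<le> c * a u" using c by (simp add: field_simps)
    next
      fix u assume u: "u \<in> V"
      have z: "(\<lambda>k. 0) \<in> V" using scale[OF u, of 0] by simp
      have "0 \<le> a (\<lambda>k. 0)"
        by (rule age[OF z]) (simp add: sub_scale[OF sm v])
      moreover have "a (\<lambda>k. 0) \<le> 0" using am[OF z] sub0[OF sm u] by simp
      ultimately show "a (\<lambda>k. 0) = 0" by simp
    qed
    moreover have "a u \<le> q u" if "u \<in> V" for u
      using am[OF that] m that by (fastforce simp: S_def)
    ultimately have "a \<in> S" by (simp add: S_def a_def)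
    then have "a = m" using min am by (simp add: R_def)
    then have "m (\<lambda>k. - v k) \<le> - m v"
      using ale[OF neg[OF v], of 1] sub0[OF sm v] by simp
    then show ?thesis using sub_neg[OF sm v] by simp
  qed
  have madd: "m (\<lambda>k. u k + v k) = m u + m v" if u: "u \<in> V" and v: "v \<in> V" for u v
    using sub_add[OF sm u v] sub_add[OF sm add[OF u v] neg[OF v]] odd[OF v] by simp
  have mscale: "m (\<lambda>k. c * u k) = c * m u" if u: "u \<in> V" for u c
  proof (cases "c \<ge> 0")
    case True then show ?thesis using sub_scale[OF sm u] by simp
  next
    case False
    then have "m (\<lambda>k. - ((- c) * u k)) = - ((- c) * m u)"
      using odd[OF scale[OF u, of "- c"]] sub_scale[OF sm u, of "- c"] by simp
    then show ?thesis by simp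
  qed
  show thesis
    using that[of m] madd mscale m by (simp add: S_def)
qed

section \<open>Functionals on the continuous functions\<close>

abbreviation fspace :: "'a topology \<Rightarrow> 'a functional topology" where
  "fspace X \<equiv> product_topology (\<lambda>_. euclideanreal) (cfun X)"

lemma topspace_fspace [simp]: "topspace (fspace X) = extensional (cfun X)"
  by (auto simp: PiE_def)

lemma cfunI: "continuous_map X euclideanreal f \<Longrightarrow> (\<lambda>x\<in>topspace X. f x) \<in> cfun X"
  unfolding cfun_def by (auto intro: continuous_map_eq)

lemma cfun_continuous: "\<phi> \<in> cfun X \<Longrightarrow> continuous_map X euclideanreal \<phi>"
  by (simp add: cfun_def)

lemma lincomb_cfun:
  "\<lbrakk>\<phi> \<in> cfun X; \<psi> \<in> cfun X\<rbrakk> \<Longrightarrow> (\<lambda>x\<in>topspace X. a * \<phi> x + b * \<psi> x) \<in> cfun X"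
  by (intro cfunI continuous_map_add continuous_map_real_mult continuous_map_canonical_const
      cfun_continuous) auto

lemma cf_const_cfun: "cf_const X c \<in> cfun X"
  unfolding cf_const_def by (intro cfunI) auto

lemma cf_add_cfun: "\<lbrakk>\<phi> \<in> cfun X; \<psi> \<in> cfun X\<rbrakk> \<Longrightarrow> cf_add X \<phi> \<psi> \<in> cfun X"
  using lincomb_cfun[of \<phi> X \<psi> 1 1] by (simp add: cf_add_def)

lemma cf_scale_cfun: "\<phi> \<in> cfun X \<Longrightarrow> cf_scale X c \<phi> \<in> cfun X"
  using lincomb_cfun[of \<phi> X \<phi> c 0] by (simp add: cf_scale_def)

lemma affine_cfun: "\<phi> \<in> cfun X \<Longrightarrow> (\<lambda>x\<in>topspace X. a * \<phi> x + b) \<in> cfun X"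
  using lincomb_cfun[OF _ cf_const_cfun, of \<phi> X a b 1]
  by (simp add: cf_const_def cong: restrict_cong)

lemma continuous_map_eval: "\<phi> \<in> cfun X \<Longrightarrow> continuous_map (fspace X) euclideanreal (\<lambda>\<mu>. \<mu> \<phi>)"
  by (rule continuous_map_product_projection)

lemma continuous_map_into_fspace:
  "continuous_map Y (fspace X) h \<longleftrightarrow>
     h ` topspace Y \<subseteq> extensional (cfun X) \<and>
     (\<forall>\<phi>\<in>cfun X. continuous_map Y euclideanreal (\<lambda>y. h y \<phi>))"
  by (rule continuous_map_componentwise)

lemma Hausdorff_fspace: "Hausdorff_space (fspace X)"
  by (simp add: Hausdorff_space_product_topology)

lemma functional_eqI:
  "\<lbrakk>\<mu> \<in> extensional (cfun X); \<nu> \<in> extensional (cfun X); \<And>\<phi>. \<phi> \<in> cfun X \<Longrightarrow> \<mu> \<phi> = \<nu> \<phi>\<rbrakk> \<Longrightarrow> \<mu> = \<nu>"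
  by (rule extensionalityI)

lemma prob_extensional: "\<mu> \<in> prob_functionals X \<Longrightarrow> \<mu> \<in> extensional (cfun X)"
  by (simp add: prob_functionals_def)

lemma prob_lincomb:
  assumes "\<mu> \<in> prob_functionals X" "\<phi> \<in> cfun X" "\<psi> \<in> cfun X"
  shows "\<mu> (\<lambda>x\<in>topspace X. a * \<phi> x + b * \<psi> x) = a * \<mu> \<phi> + b * \<mu> \<psi>"
proof -
  have "(\<lambda>x\<in>topspace X. a * \<phi> x + b * \<psi> x) = cf_add X (cf_scale X a \<phi>) (cf_scale X b \<psi>)"
    by (auto simp: cf_add_def cf_scale_def)
  moreover have "\<mu> (cf_add X (cf_scale X a \<phi>) (cf_scale X b \<psi>))
      = \<mu> (cf_scale X a \<phi>) + \<mu> (cf_scale X b \<psi>)"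
    using assms(1) cf_scale_cfun[OF assms(2)] cf_scale_cfun[OF assms(3)]
    unfolding prob_functionals_def by blast
  moreover have "\<mu> (cf_scale X a \<phi>) = a * \<mu> \<phi>" "\<mu> (cf_scale X b \<psi>) = b * \<mu> \<psi>"
    using assms unfolding prob_functionals_def by blast+
  ultimately show ?thesis by simp
qed

lemma prob_const: "\<mu> \<in> prob_functionals X \<Longrightarrow> \<mu> (cf_const X c) = c"
proof -
  assume \<mu>: "\<mu> \<in> prob_functionals X"
  have "cf_const X c = cf_scale X c (cf_const X 1)"
    by (auto simp: cf_const_def cf_scale_def)
  then show ?thesis
    using \<mu> cf_const_cfun[of X 1] by (simp add: prob_functionals_def)
qed

lemma prob_affine:
  assumes "\<mu> \<in> prob_functionals X" "\<phi> \<in> cfun X"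
  shows "\<mu> (\<lambda>x\<in>topspace X. a * \<phi> x + b) = a * \<mu> \<phi> + b"
proof -
  have "(\<lambda>x\<in>topspace X. a * \<phi> x + b) = (\<lambda>x\<in>topspace X. a * \<phi> x + b * cf_const X 1 x)"
    by (auto simp: cf_const_def)
  then show ?thesis
    using prob_lincomb[OF assms cf_const_cfun, of a b 1] prob_const[OF assms(1)] by simp
qed

lemma prob_mono:
  assumes \<mu>: "\<mu> \<in> prob_functionals X" and "\<phi> \<in> cfun X" "\<psi> \<in> cfun X"
    and le: "\<And>x. x \<in> topspace X \<Longrightarrow> \<phi> x \<le> \<psi> x"
  shows "\<mu> \<phi> \<le> \<mu> \<psi>"
proof -
  let ?d = "\<lambda>x\<in>topspace X. 1 * \<psi> x + (-1) * \<phi> x"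
  have "0 \<le> \<mu> ?d"
    using \<mu> lincomb_cfun[OF assms(3,2), of 1 "-1"] le
    unfolding prob_functionals_def cf_le_def cf_const_def by simp
  then show ?thesis
    using prob_lincomb[OF assms(1,3,2), of 1 "-1"] by simp
qed

lemma prob_le_const:
  assumes "\<mu> \<in> prob_functionals X" "\<phi> \<in> cfun X" "\<And>x. x \<in> topspace X \<Longrightarrow> \<phi> x \<le> c"
  shows "\<mu> \<phi> \<le> c"
  using prob_mono[OF assms(1,2) cf_const_cfun, of c] prob_const[OF assms(1)] assms(3)
  by (simp add: cf_const_def)

lemma prob_ge_const:
  assumes "\<mu> \<in> prob_functionals X" "\<phi> \<in> cfun X" "\<And>x. x \<in> topspace X \<Longrightarrow> c \<le> \<phi> x"
  shows "c \<le> \<mu> \<phi>"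
  using prob_mono[OF assms(1) cf_const_cfun assms(2), of c] prob_const[OF assms(1)] assms(3)
  by (simp add: cf_const_def)

lemma prob_functionalsI:
  assumes "\<mu> \<in> extensional (cfun X)"
    and "\<And>\<phi> \<psi> a b. \<lbrakk>\<phi> \<in> cfun X; \<psi> \<in> cfun X\<rbrakk> \<Longrightarrow>
      \<mu> (\<lambda>x\<in>topspace X. a * \<phi> x + b * \<psi> x) = a * \<mu> \<phi> + b * \<mu> \<psi>"
    and "\<And>\<phi>. \<lbrakk>\<phi> \<in> cfun X; \<And>x. x \<in> topspace X \<Longrightarrow> 0 \<le> \<phi> x\<rbrakk> \<Longrightarrow> 0 \<le> \<mu> \<phi>"
    and "\<mu> (cf_const X 1) = 1"
  shows "\<mu> \<in> prob_functionals X"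
  unfolding prob_functionals_def
proof (intro CollectI conjI ballI allI impI)
  fix \<phi> \<psi> assume "\<phi> \<in> cfun X" "\<psi> \<in> cfun X"
  then show "\<mu> (cf_add X \<phi> \<psi>) = \<mu> \<phi> + \<mu> \<psi>"
    using assms(2)[of \<phi> \<psi> 1 1] by (simp add: cf_add_def)
next
  fix \<phi> and t :: real assume "\<phi> \<in> cfun X"
  then show "\<mu> (cf_scale X t \<phi>) = t * \<mu> \<phi>"
    using assms(2)[of \<phi> \<phi> t 0] by (simp add: cf_scale_def)
qed (use assms in \<open>auto simp: cf_le_def cf_const_def\<close>)

lemma dirac_prob:
  assumes "x \<in> topspace X"
  shows "dirac X x \<in> prob_functionals X"
  by (rule prob_functionalsI)
    (use assms in \<open>auto simp: dirac_def lincomb_cfun cf_const_cfun\<close>, simp add: cf_const_def)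

lemma dirac_apply: "\<phi> \<in> cfun X \<Longrightarrow> dirac X x \<phi> = \<phi> x"
  by (simp add: dirac_def)

lemma mix_apply: "\<phi> \<in> cfun X \<Longrightarrow> mix X t \<mu> \<nu> \<phi> = (1 - t) * \<mu> \<phi> + t * \<nu> \<phi>"
  by (simp add: mix_def)

lemma mix_prob:
  assumes \<mu>: "\<mu> \<in> prob_functionals X" and \<nu>: "\<nu> \<in> prob_functionals X" and t: "0 \<le> t" "t \<le> 1"
  shows "mix X t \<mu> \<nu> \<in> prob_functionals X"
proof (rule prob_functionalsI)
  fix \<phi> assume "\<phi> \<in> cfun X" "\<And>x. x \<in> topspace X \<Longrightarrow> 0 \<le> \<phi> x"
  then show "0 \<le> mix X t \<mu> \<nu> \<phi>"
    using prob_ge_const[OF \<mu>, of \<phi> 0] prob_ge_const[OF \<nu>, of \<phi> 0] t by (simp add: mix_def)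
next
  fix \<phi> \<psi> :: "'a \<Rightarrow> real" and a b assume "\<phi> \<in> cfun X" "\<psi> \<in> cfun X"
  then show "mix X t \<mu> \<nu> (\<lambda>x\<in>topspace X. a * \<phi> x + b * \<psi> x) = a * mix X t \<mu> \<nu> \<phi> + b * mix X t \<mu> \<nu> \<psi>"
    using lincomb_cfun[of \<phi> X \<psi> a b] prob_lincomb[OF \<mu>, of \<phi> \<psi> a b] prob_lincomb[OF \<nu>, of \<phi> \<psi> a b]
    by (simp add: mix_apply) (simp add: algebra_simps)
next
  show "mix X t \<mu> \<nu> (cf_const X 1) = 1"
    using prob_const[OF \<mu>] prob_const[OF \<nu>] cf_const_cfun[of X 1] by (simp add: mix_apply)
qed (simp add: mix_def)

lemma closedin_Collect_conj:
  assumes "closedin Y {x \<in> topspace Y. P x}" "closedin Y {x \<in> topspace Y. Q x}"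
  shows "closedin Y {x \<in> topspace Y. P x \<and> Q x}"
proof -
  have "{x \<in> topspace Y. P x \<and> Q x} = {x \<in> topspace Y. P x} \<inter> {x \<in> topspace Y. Q x}" by blast
  then show ?thesis using closedin_Int[OF assms] by metis
qed

lemma closedin_Collect_ball:
  assumes "\<And>i. i \<in> I \<Longrightarrow> closedin Y {x \<in> topspace Y. P i x}"
  shows "closedin Y {x \<in> topspace Y. \<forall>i\<in>I. P i x}"
proof (cases "I = {}")
  case False
  then have "{x \<in> topspace Y. \<forall>i\<in>I. P i x} = (\<Inter>i\<in>I. {x \<in> topspace Y. P i x})" by blast
  then show ?thesis using assms False by (simp add: closedin_INT)
qed simp

locale compact_Hausdorff =
  fixes X :: "'a topology"
  assumes compact: "compact_space X" and Hausdorff: "Hausdorff_space X"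
begin

lemma normal: "normal_space X"
  using compact Hausdorff by (simp add: compact_Hausdorff_or_regular_imp_normal_space)

lemma cfun_bounded:
  assumes "\<phi> \<in> cfun X"
  obtains M where "M > 0" "\<And>x. x \<in> topspace X \<Longrightarrow> \<bar>\<phi> x\<bar> \<le> M"
proof -
  have "compactin X (topspace X)"
    using compact by (simp add: compact_space_def)
  from image_compactin[OF this cfun_continuous[OF assms]] have "bounded (\<phi> ` topspace X)"
    by (simp add: compact_imp_bounded)
  then show thesis
    using that unfolding bounded_pos by auto
qed

text \<open>  Any positive bound serves; the least one would be 0 or undefined in degenerate cases.\<close>

definition sup_norm :: "('a \<Rightarrow> real) \<Rightarrow> real" where
  "sup_norm \<phi> = (SOME M. M > 0 \<and> (\<forall>x\<in>topspace X. \<bar>\<phi> x\<bar> \<le> M))"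

lemma sup_norm:
  assumes "\<phi> \<in> cfun X"
  shows "sup_norm \<phi> > 0" "\<And>x. x \<in> topspace X \<Longrightarrow> \<bar>\<phi> x\<bar> \<le> sup_norm \<phi>"
proof -
  have "\<exists>M. M > 0 \<and> (\<forall>x\<in>topspace X. \<bar>\<phi> x\<bar> \<le> M)"
    using cfun_bounded[OF assms] by metis
  from someI_ex[OF this] show "sup_norm \<phi> > 0" "\<And>x. x \<in> topspace X \<Longrightarrow> \<bar>\<phi> x\<bar> \<le> sup_norm \<phi>"
    by (simp_all add: sup_norm_def)
qed

lemma prob_abs_le:
  assumes "\<mu> \<in> prob_functionals X" "\<phi> \<in> cfun X"
  shows "\<bar>\<mu> \<phi>\<bar> \<le> sup_norm \<phi>"
proof -
  have "\<phi> x \<le> sup_norm \<phi>" "- sup_norm \<phi> \<le> \<phi> x" if "x \<in> topspace X" for x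
    using sup_norm(2)[OF assms(2) that] by linarith+
  from prob_le_const[OF assms this(1)] prob_ge_const[OF assms this(2)]
  have "\<mu> \<phi> \<le> sup_norm \<phi>" "- sup_norm \<phi> \<le> \<mu> \<phi>"
    by auto
  then show ?thesis by simp
qed

lemma prob_le_sup_norm: "\<lbrakk>\<mu> \<in> prob_functionals X; \<phi> \<in> cfun X\<rbrakk> \<Longrightarrow> \<mu> \<phi> \<le> sup_norm \<phi>"
  using prob_abs_le[of \<mu> \<phi>] by (simp add: abs_le_iff)

text \<open>  A compact cube that contains all suprema of probability measures.  It is the ambient space in
  which maps are extended, being compact and convex.\<close>

definition box :: "'a functional set" where
  "box = (\<Pi>\<^sub>E \<phi>\<in>cfun X. {- sup_norm \<phi>..sup_norm \<phi>})"

lemma box_I: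
  assumes "\<mu> \<in> extensional (cfun X)" "\<And>\<phi>. \<phi> \<in> cfun X \<Longrightarrow> \<bar>\<mu> \<phi>\<bar> \<le> sup_norm \<phi>"
  shows "\<mu> \<in> box"
proof -
  have "\<mu> \<phi> \<in> {- sup_norm \<phi>..sup_norm \<phi>}" if "\<phi> \<in> cfun X" for \<phi>
    using abs_le_D1[OF assms(2)[OF that]] abs_le_D2[OF assms(2)[OF that]] by simp
  then show ?thesis
    using assms(1) by (simp add: box_def PiE_iff)
qed

lemma compactin_box: "compactin (fspace X) box"
  by (simp add: box_def compactin_PiE)

lemma prob_subset_box: "prob_functionals X \<subseteq> box"
proof
  fix \<mu> assume \<mu>: "\<mu> \<in> prob_functionals X"
  show "\<mu> \<in> box"
    using prob_abs_le[OF \<mu>] prob_extensional[OF \<mu>] by (intro box_I)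
qed

lemma closedin_prob: "closedin (fspace X) (prob_functionals X)"
proof -
  have H: "Hausdorff_space euclideanreal" by simp
  have "prob_functionals X = {\<mu> \<in> topspace (fspace X).
     (\<forall>\<phi>\<in>cfun X. \<forall>\<psi>\<in>cfun X. \<mu> (cf_add X \<phi> \<psi>) = \<mu> \<phi> + \<mu> \<psi>) \<and>
     (\<forall>\<phi>\<in>cfun X. \<forall>t\<in>UNIV. \<mu> (cf_scale X t \<phi>) = t * \<mu> \<phi>) \<and>
     (\<forall>\<phi>\<in>{\<phi> \<in> cfun X. cf_le X (cf_const X 0) \<phi>}. \<mu> \<phi> \<in> {0..}) \<and>
     \<mu> (cf_const X 1) = 1}"
    unfolding prob_functionals_def topspace_fspace by (intro Collect_cong) (auto simp: cf_le_def)
  also have "closedin (fspace X) \<dots>"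
    by (intro closedin_Collect_conj closedin_Collect_ball closedin_continuous_maps_eq[OF H]
        closedin_continuous_map_preimage[of _ euclideanreal] continuous_map_add continuous_map_real_mult
        continuous_map_canonical_const continuous_map_eval
        cf_add_cfun cf_scale_cfun cf_const_cfun) auto
  finally show ?thesis .
qed

lemma compactin_prob: "compactin (fspace X) (prob_functionals X)"
  using closed_compactin[OF compactin_box prob_subset_box closedin_prob] .

lemma bdd_above_prob: "\<lbrakk>K \<subseteq> prob_functionals X; \<phi> \<in> cfun X\<rbrakk> \<Longrightarrow> bdd_above ((\<lambda>\<mu>. \<mu> \<phi>) ` K)"
  by (rule bdd_aboveI2[where M="sup_norm \<phi>"], rule prob_le_sup_norm) auto

lemma nu_upper:
  "\<lbrakk>K \<subseteq> prob_functionals X; \<phi> \<in> cfun X; \<mu> \<in> K\<rbrakk> \<Longrightarrow> \<mu> \<phi> \<le> nu X K \<phi>"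
  using cSUP_upper[OF _ bdd_above_prob] by (simp add: nu_def)

lemma nu_least:
  "\<lbrakk>K \<noteq> {}; \<phi> \<in> cfun X; \<And>\<mu>. \<mu> \<in> K \<Longrightarrow> \<mu> \<phi> \<le> c\<rbrakk> \<Longrightarrow> nu X K \<phi> \<le> c"
  unfolding nu_def by (simp add: cSUP_least)

lemma less_nu_iff:
  "\<lbrakk>K \<subseteq> prob_functionals X; K \<noteq> {}; \<phi> \<in> cfun X\<rbrakk> \<Longrightarrow> c < nu X K \<phi> \<longleftrightarrow> (\<exists>\<mu>\<in>K. c < \<mu> \<phi>)"
  using less_cSUP_iff[OF _ bdd_above_prob] by (simp add: nu_def)

lemma nu_extensional: "nu X K \<in> extensional (cfun X)"
  by (simp add: nu_def)

lemma nu_box: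
  assumes "K \<subseteq> prob_functionals X" "K \<noteq> {}"
  shows "nu X K \<in> box"
proof -
  obtain \<mu> where \<mu>: "\<mu> \<in> K" using assms by blast
  have "\<bar>nu X K \<phi>\<bar> \<le> sup_norm \<phi>" if "\<phi> \<in> cfun X" for \<phi>
  proof -
    have "nu X K \<phi> \<le> sup_norm \<phi>"
      using assms(1) by (rule_tac nu_least[OF assms(2) that], rule_tac prob_le_sup_norm[OF _ that]) (use assms(1) in auto)
    moreover have "- sup_norm \<phi> \<le> nu X K \<phi>"
      using nu_upper[OF assms(1) that \<mu>] prob_abs_le[of \<mu> \<phi>] that \<mu> assms(1) by fastforce
    ultimately show ?thesis by simp
  qed
  then show ?thesis
    by (intro box_I nu_extensional)
qed

lemma nu_OS:
  assumes K: "K \<subseteq> prob_functionals X" "K \<noteq> {}"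
  shows "nu X K \<in> OS X"
proof -
  have up: "\<mu> \<phi> \<le> nu X K \<phi>" if "\<mu> \<in> K" "\<phi> \<in> cfun X" for \<mu> \<phi>
    using nu_upper[OF K(1)] that by blast
  have aff: "nu X K (\<lambda>x\<in>topspace X. a * \<phi> x + b) = a * nu X K \<phi> + b"
    if \<phi>: "\<phi> \<in> cfun X" and a: "0 \<le> a" for \<phi> a b
  proof (rule antisym)
    have c: "(\<lambda>x\<in>topspace X. a * \<phi> x + b) \<in> cfun X"
      by (rule affine_cfun[OF \<phi>])
    have eq: "\<mu> (\<lambda>x\<in>topspace X. a * \<phi> x + b) = a * \<mu> \<phi> + b" if "\<mu> \<in> K" for \<mu>
      using prob_affine[OF _ \<phi>] that K(1) by blast
    show "nu X K (\<lambda>x\<in>topspace X. a * \<phi> x + b) \<le> a * nu X K \<phi> + b"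
      by (rule nu_least[OF K(2) c]) (simp add: eq up \<phi> a mult_left_mono)
    show "a * nu X K \<phi> + b \<le> nu X K (\<lambda>x\<in>topspace X. a * \<phi> x + b)"
    proof (cases "a = 0")
      case True
      obtain \<mu> where "\<mu> \<in> K" using K(2) by blast
      then show ?thesis using up[OF _ c, of \<mu>] eq[of \<mu>] True by simp
    next
      case False
      then have a0: "a > 0" using a by simp
      have "nu X K \<phi> \<le> (nu X K (\<lambda>x\<in>topspace X. a * \<phi> x + b) - b) / a"
      proof (rule nu_least[OF K(2) \<phi>])
        fix \<mu> assume "\<mu> \<in> K"
        then show "\<mu> \<phi> \<le> (nu X K (\<lambda>x\<in>topspace X. a * \<phi> x + b) - b) / a"
          using up[OF _ c, of \<mu>] eq[of \<mu>] a0 by (simp add: field_simps)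
      qed
      then show ?thesis using a0 by (simp add: field_simps)
    qed
  qed
  show ?thesis
    unfolding OS_def
  proof (intro CollectI conjI ballI allI impI)
    fix \<phi> and c :: real assume \<phi>: "\<phi> \<in> cfun X"
    have "cf_add X \<phi> (cf_const X c) = (\<lambda>x\<in>topspace X. 1 * \<phi> x + c)"
      by (auto simp: cf_add_def cf_const_def)
    then show "nu X K (cf_add X \<phi> (cf_const X c)) = nu X K \<phi> + c"
      using aff[OF \<phi>, of 1 c] by simp
  next
    fix \<phi> \<psi> assume \<phi>: "\<phi> \<in> cfun X" and \<psi>: "\<psi> \<in> cfun X" and le: "cf_le X \<phi> \<psi>"
    show "nu X K \<phi> \<le> nu X K \<psi>"
    proof (rule nu_least[OF K(2) \<phi>])
      fix \<mu> assume "\<mu> \<in> K"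
      then show "\<mu> \<phi> \<le> nu X K \<psi>"
        using prob_mono[OF _ \<phi> \<psi>, of \<mu>] up[OF _ \<psi>, of \<mu>] le K(1) by (fastforce simp: cf_le_def)
    qed
  next
    obtain \<mu> where "\<mu> \<in> K" using K(2) by blast
    moreover have "\<mu> (cf_const X 1) = 1" if "\<mu> \<in> K" for \<mu> using prob_const K that by blast
    ultimately show "nu X K (cf_const X 1) = 1"
      using nu_least[OF K(2) cf_const_cfun, of 1 1] up[OF _ cf_const_cfun, of \<mu> 1] by force
  next
    fix \<phi> and t :: real assume \<phi>: "\<phi> \<in> cfun X" and t: "0 \<le> t"
    then show "nu X K (cf_scale X t \<phi>) = t * nu X K \<phi>"
      using aff[OF \<phi> t, of 0] by (simp add: cf_scale_def)
  next
    fix \<phi> \<psi> assume \<phi>: "\<phi> \<in> cfun X" and \<psi>: "\<psi> \<in> cfun X"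
    show "nu X K (cf_add X \<phi> \<psi>) \<le> nu X K \<phi> + nu X K \<psi>"
    proof (rule nu_least[OF K(2) cf_add_cfun[OF \<phi> \<psi>]])
      fix \<mu> assume \<mu>: "\<mu> \<in> K"
      then have "\<mu> (cf_add X \<phi> \<psi>) = \<mu> \<phi> + \<mu> \<psi>"
        using K(1) \<phi> \<psi> unfolding prob_functionals_def by blast
      then show "\<mu> (cf_add X \<phi> \<psi>) \<le> nu X K \<phi> + nu X K \<psi>"
        using up[OF \<mu> \<phi>] up[OF \<mu> \<psi>] by simp
    qed
  qed (simp add: nu_def)
qed

lemma nu_singleton: "\<mu> \<in> prob_functionals X \<Longrightarrow> nu X {\<mu>} = \<mu>"
  by (rule functional_eqI[OF nu_extensional prob_extensional]) (auto simp: nu_def)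

lemma prob_subset_OS: "prob_functionals X \<subseteq> OS X"
  using nu_OS[of "{_}"] nu_singleton by (metis empty_not_insert empty_subsetI insert_subset subsetI)

lemma prob_functionals_space_eq:
  "prob_functionals_space X = subtopology (fspace X) (prob_functionals X)"
  using prob_subset_OS
  by (simp add: prob_functionals_space_def OS_space_def subtopology_subtopology inf_absorb2)

lemma cc_prob_subset: "A \<in> cc_prob X \<Longrightarrow> A \<subseteq> prob_functionals X"
  unfolding cc_prob_def prob_functionals_space_eq using closedin_subset by fastforce

lemma cc_prob_compactin: "A \<in> cc_prob X \<Longrightarrow> compactin (fspace X) A"
  unfolding cc_prob_def prob_functionals_space_eq
  using closedin_compact_space[OF compact_space_subtopology[OF compactin_prob]]
  by (auto simp: compactin_subtopology)

end

text \<open>  An existential quantifier over a compact space preserves closedness, because the projection along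
  a compact factor is a closed map.\<close>

lemma closedin_compact_projection:
  assumes "compact_space Z" and "closedin (prod_topology Z Y) {p \<in> topspace Z \<times> topspace Y. P (fst p) (snd p)}"
  shows "closedin Y {y \<in> topspace Y. \<exists>z\<in>topspace Z. P z y}"
proof -
  have "closed_map (prod_topology Z Y) Y snd"
    using assms(1) by (simp add: closed_map_snd)
  then have "closedin Y (snd ` {p \<in> topspace Z \<times> topspace Y. P (fst p) (snd p)})"
    using assms(2) by (simp add: closed_map_def)
  moreover have "snd ` {p \<in> topspace Z \<times> topspace Y. P (fst p) (snd p)}
      = {y \<in> topspace Y. \<exists>z\<in>topspace Z. P z y}"
    by force
  ultimately show ?thesis by simp
qed

context compact_Hausdorff
begin

section \<open>Extreme points\<close>

definition face :: "'a functional set \<Rightarrow> 'a functional set \<Rightarrow> bool" where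
  "face A B \<longleftrightarrow> B \<subseteq> A \<and> B \<noteq> {} \<and> closedin (fspace X) B \<and>
     (\<forall>\<mu>1\<in>A. \<forall>\<mu>2\<in>A. \<forall>t\<in>{0<..<1}. mix X t \<mu>1 \<mu>2 \<in> B \<longrightarrow> \<mu>1 \<in> B \<and> \<mu>2 \<in> B)"

text \<open>  A proper mixture attains the maximum of \<open>\<phi>\<close> only if both of its components do.\<close>

lemma face_maximizers:
  assumes A: "compactin (fspace X) A" and B: "face A B" and \<phi>: "\<phi> \<in> cfun X"
  shows "face A {\<mu> \<in> B. \<forall>\<nu>\<in>B. \<nu> \<phi> \<le> \<mu> \<phi>}"
proof -
  have cB: "compactin (fspace X) B"
    using B closed_compactin[OF A] by (simp add: face_def)
  have "compact ((\<lambda>\<mu>. \<mu> \<phi>) ` B)" "(\<lambda>\<mu>. \<mu> \<phi>) ` B \<noteq> {}"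
    using image_compactin[OF cB continuous_map_eval[OF \<phi>]] B by (auto simp: face_def)
  then obtain \<mu>0 where \<mu>0: "\<mu>0 \<in> B" "\<And>\<nu>. \<nu> \<in> B \<Longrightarrow> \<nu> \<phi> \<le> \<mu>0 \<phi>"
    using compact_attains_sup[of "(\<lambda>\<mu>. \<mu> \<phi>) ` B"] by auto
  have eq: "{\<mu> \<in> B. \<forall>\<nu>\<in>B. \<nu> \<phi> \<le> \<mu> \<phi>} = {\<mu> \<in> B. \<mu> \<phi> \<in> {\<mu>0 \<phi>..}}"
    using \<mu>0 by (auto intro: order_trans)
  have "closedin (fspace X) {\<mu> \<in> B. \<mu> \<phi> \<in> {\<mu>0 \<phi>..}}"
    using B by (intro closedin_continuous_map_preimage_gen[OF continuous_map_eval[OF \<phi>]])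
      (simp_all add: face_def)
  moreover have "\<mu>1 \<phi> \<ge> \<mu>0 \<phi> \<and> \<mu>2 \<phi> \<ge> \<mu>0 \<phi>"
    if "\<mu>1 \<in> B" "\<mu>2 \<in> B" "t \<in> {0<..<1}" "mix X t \<mu>1 \<mu>2 \<phi> \<ge> \<mu>0 \<phi>" for \<mu>1 \<mu>2 t
  proof -
    have t: "0 < t" "t < 1" using that by auto
    have le: "\<mu>1 \<phi> \<le> \<mu>0 \<phi>" "\<mu>2 \<phi> \<le> \<mu>0 \<phi>" using \<mu>0 that by auto
    have "(1 - t) * (\<mu>0 \<phi> - \<mu>1 \<phi>) + t * (\<mu>0 \<phi> - \<mu>2 \<phi>) \<le> 0"
      using that(4) by (simp add: mix_apply[OF \<phi>] algebra_simps)
    moreover have "0 \<le> (1 - t) * (\<mu>0 \<phi> - \<mu>1 \<phi>)" "0 \<le> t * (\<mu>0 \<phi> - \<mu>2 \<phi>)"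
      using le t by simp_all
    ultimately have "(1 - t) * (\<mu>0 \<phi> - \<mu>1 \<phi>) \<le> 0" "t * (\<mu>0 \<phi> - \<mu>2 \<phi>) \<le> 0" by linarith+
    then show ?thesis using t by (simp add: mult_le_0_iff)
  qed
  moreover have "\<mu>1 \<in> B \<and> \<mu>2 \<in> B" if "\<mu>1 \<in> A" "\<mu>2 \<in> A" "t \<in> {0<..<1}" "mix X t \<mu>1 \<mu>2 \<in> B" for \<mu>1 \<mu>2 t
    using B that unfolding face_def by blast
  moreover have "{\<mu> \<in> B. \<mu> \<phi> \<in> {\<mu>0 \<phi>..}} \<subseteq> A" "\<mu>0 \<in> {\<mu> \<in> B. \<mu> \<phi> \<in> {\<mu>0 \<phi>..}}"
    using B \<mu>0(1) by (auto simp: face_def)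
  ultimately show ?thesis
    unfolding eq face_def mem_Collect_eq atLeast_iff by blast
qed

text \<open>  A minimal closed face inside the set of maximizers of \<open>\<phi>\<close> is a single point: otherwise some
  \<open>\<psi>\<close> is not constant on it, and the maximizers of \<open>\<psi>\<close> form a smaller face.\<close>

theorem Krein_Milman_attained:
  assumes A: "compactin (fspace X) A" "A \<noteq> {}" and \<phi>: "\<phi> \<in> cfun X"
  obtains e where "e \<in> ext_points X A" "\<And>\<mu>. \<mu> \<in> A \<Longrightarrow> \<mu> \<phi> \<le> e \<phi>"
proof -
  define B0 where "B0 = {\<mu> \<in> A. \<forall>\<nu>\<in>A. \<nu> \<phi> \<le> \<mu> \<phi>}"
  have clA: "closedin (fspace X) A"
    using compactin_imp_closedin[OF Hausdorff_fspace A(1)] .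
  have "face A A" using A clA by (simp add: face_def)
  then have B0: "face A B0" unfolding B0_def by (rule face_maximizers[OF A(1) _ \<phi>])
  define S where "S = {B. face A B \<and> B \<subseteq> B0}"
  have "\<exists>m\<in>S. \<forall>a\<in>S. a \<subseteq> m \<longrightarrow> a = m"
  proof (rule predicate_Zorn)
    show "partial_order_on S (relation_of (\<lambda>a b. b \<subseteq> a) S)"
      by (rule partial_order_on_relation_ofI) auto
    fix C assume "C \<in> Chains (relation_of (\<lambda>a b. b \<subseteq> a) S)"
    then have CS: "C \<subseteq> S" and tot: "\<And>a b. \<lbrakk>a \<in> C; b \<in> C\<rbrakk> \<Longrightarrow> a \<subseteq> b \<or> b \<subseteq> a"
      by (auto simp: Chains_def relation_of_def)
    show "\<exists>u\<in>S. \<forall>a\<in>C. u \<subseteq> a"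
    proof (cases "C = {}")
      case True then show ?thesis using B0 by (auto simp: S_def)
    next
      case False
      have "A \<inter> \<Inter>\<F> \<noteq> {}" if fin: "finite \<F>" and sub: "\<F> \<subseteq> C" for \<F>
      proof (cases "\<F> = {}")
        case True then show ?thesis using A by simp
      next
        case False
        obtain m where m: "m \<in> \<F>" "\<And>b. b \<in> \<F> \<Longrightarrow> b \<subseteq> m \<Longrightarrow> m = b"
          using finite_has_minimal[OF fin False] by blast
        have "m \<subseteq> b" if "b \<in> \<F>" for b using tot[of m b] m that sub by auto
        moreover have "m \<noteq> {}" "m \<subseteq> A" using m(1) sub CS by (auto simp: S_def face_def)
        ultimately show ?thesis by blast
      qed
      moreover have "\<forall>B\<in>C. closedin (fspace X) B" using CS by (auto simp: S_def face_def)
      ultimately have "A \<inter> \<Inter>C \<noteq> {}"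
        using A(1) unfolding compactin_fip by blast
      moreover have "closedin (fspace X) (\<Inter>C)"
        using CS False by (intro closedin_Inter) (auto simp: S_def face_def)
      ultimately have "face A (\<Inter>C)"
        using CS False unfolding face_def S_def by blast
      then have "\<Inter>C \<in> S" using CS False by (auto simp: S_def)
      then show ?thesis by blast
    qed
  qed
  then obtain B where B: "face A B" "B \<subseteq> B0" and min: "\<And>a. a \<in> S \<Longrightarrow> a \<subseteq> B \<Longrightarrow> a = B"
    by (auto simp: S_def)
  have ext: "A \<subseteq> extensional (cfun X)"
    using compactin_subset_topspace[OF A(1)] unfolding topspace_fspace .
  obtain e where e: "e \<in> B" using B(1) by (auto simp: face_def)
  have single: "\<mu> = e" if \<mu>: "\<mu> \<in> B" for \<mu>
  proof (rule functional_eqI)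
    show "\<mu> \<in> extensional (cfun X)" "e \<in> extensional (cfun X)"
      using \<mu> e B ext by (auto simp: face_def)
    fix \<psi> assume \<psi>: "\<psi> \<in> cfun X"
    have "{\<mu> \<in> B. \<forall>\<nu>\<in>B. \<nu> \<psi> \<le> \<mu> \<psi>} = B"
      by (rule min) (use face_maximizers[OF A(1) B(1) \<psi>] B(2) in \<open>auto simp: S_def\<close>)
    then show "\<mu> \<psi> = e \<psi>" using \<mu> e by (blast intro: antisym)
  qed
  have "\<mu>1 = \<mu>2" if "\<mu>1 \<in> A" "\<mu>2 \<in> A" "t \<in> {0<..<1}" "e = mix X t \<mu>1 \<mu>2" for \<mu>1 \<mu>2 t
  proof -
    have "mix X t \<mu>1 \<mu>2 \<in> B" using that(4) e by simp
    then have "\<mu>1 \<in> B" "\<mu>2 \<in> B" using B(1) that(1-3) unfolding face_def by blast+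
    then show ?thesis using single[of \<mu>1] single[of \<mu>2] by metis
  qed
  moreover have "e \<in> A" using B(1) e unfolding face_def by blast
  ultimately have "e \<in> ext_points X A"
    unfolding ext_points_def by blast
  moreover have "\<mu> \<phi> \<le> e \<phi>" if "\<mu> \<in> A" for \<mu>
    using B(2) e that by (auto simp: B0_def)
  ultimately show thesis by (rule that)
qed

text \<open>  Scaling a test function makes the gap between two different measures exceed any constant, so that
  the half-spaces used in \<open>Milman\<close> can be indexed by functions alone.\<close>

lemma separating_half_space:
  assumes "k \<in> prob_functionals X" "m \<in> prob_functionals X" "k \<noteq> m"
  obtains \<phi> where "\<phi> \<in> cfun X" "m \<phi> + 1 < k \<phi>"
proof -
  obtain \<phi> where \<phi>: "\<phi> \<in> cfun X" "k \<phi> \<noteq> m \<phi>"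
    using functional_eqI[OF prob_extensional prob_extensional] assms by metis
  define c where "c = 2 / (k \<phi> - m \<phi>)"
  have "c * k \<phi> - c * m \<phi> = 2"
  proof -
    have "k \<phi> - m \<phi> \<noteq> 0" using \<phi>(2) by simp
    then have "c * (k \<phi> - m \<phi>) = 2" unfolding c_def by (rule nonzero_eq_divide_eq[THEN iffD1]) (rule refl)
    then show ?thesis by (simp only: right_diff_distrib)
  qed
  then show thesis
    using that[OF affine_cfun[OF \<phi>(1), of c 0]] prob_affine[OF assms(1) \<phi>(1), of c 0]
      prob_affine[OF assms(2) \<phi>(1), of c 0] by simp
qed

text \<open>  The functional \<open>\<Lambda>\<close> is a mean on the bounded functions on \<open>K\<close> whose barycenter is \<open>m\<close>.  On the
  evaluations \<open>k \<mapsto> k \<phi>\<close> it is prescribed, and the prescription is positive because \<open>m\<close> lies below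
  the supremum of \<open>K\<close>; the Hahn-Banach theorem extends it.\<close>

lemma representing_mean:
  assumes K: "K \<subseteq> prob_functionals X" "K \<noteq> {}" and m: "m \<in> prob_functionals X"
    and le: "\<And>\<phi>. \<phi> \<in> cfun X \<Longrightarrow> m \<phi> \<le> nu X K \<phi>"
  defines "V \<equiv> {g :: 'a functional \<Rightarrow> real. \<exists>M. \<forall>k\<in>K. \<bar>g k\<bar> \<le> M}"
  obtains \<Lambda> where
    "\<And>g h. \<lbrakk>g \<in> V; h \<in> V\<rbrakk> \<Longrightarrow> \<Lambda> (\<lambda>k. g k + h k) = \<Lambda> g + \<Lambda> h"
    "\<And>g c. g \<in> V \<Longrightarrow> \<Lambda> (\<lambda>k. c * g k) = c * \<Lambda> g"
    "\<And>g c. \<lbrakk>g \<in> V; \<And>k. k \<in> K \<Longrightarrow> g k \<le> c\<rbrakk> \<Longrightarrow> \<Lambda> g \<le> c"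
    "\<And>\<phi>. \<phi> \<in> cfun X \<Longrightarrow> \<Lambda> (\<lambda>k. k \<phi>) = m \<phi>"
proof -
  \<comment> \<open>The upper bounds for \<open>\<Lambda> g\<close> that are forced by positivity and the prescribed values; their infimum is
    the sublinear functional to which the Hahn-Banach theorem is applied.\<close>
  define T where "T = (\<lambda>g :: 'a functional \<Rightarrow> real. {c. \<exists>\<phi>\<in>cfun X. \<forall>k\<in>K. g k \<le> k \<phi> - m \<phi> + c})"
  have addV: "(\<lambda>k. g k + h k) \<in> V" if g: "g \<in> V" and h: "h \<in> V" for g h
  proof -
    obtain M N where "\<forall>k\<in>K. \<bar>g k\<bar> \<le> M" "\<forall>k\<in>K. \<bar>h k\<bar> \<le> N"
      using g h by (auto simp: V_def)
    then have "\<forall>k\<in>K. \<bar>g k + h k\<bar> \<le> M + N" by (auto intro: order_trans[OF abs_triangle_ineq] add_mono)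
    then show ?thesis unfolding V_def by blast
  qed
  have scaleV: "(\<lambda>k. c * g k) \<in> V" if g: "g \<in> V" for g c
  proof -
    obtain M where "\<forall>k\<in>K. \<bar>g k\<bar> \<le> M" using g by (auto simp: V_def)
    then have "\<forall>k\<in>K. \<bar>c * g k\<bar> \<le> \<bar>c\<bar> * M" by (simp add: abs_mult mult_left_mono)
    then show ?thesis unfolding V_def by blast
  qed
  have T_const: "c \<in> T g" if "\<And>k. k \<in> K \<Longrightarrow> g k \<le> c" for g c
  proof -
    have "g k \<le> k (cf_const X 0) - m (cf_const X 0) + c" if "k \<in> K" for k
      using prob_const[of k X 0] prob_const[OF m, of 0] K(1) \<open>k \<in> K\<close> \<open>\<And>k. k \<in> K \<Longrightarrow> g k \<le> c\<close>[OF \<open>k \<in> K\<close>]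
      by auto
    then show ?thesis
      unfolding T_def by (intro CollectI bexI[OF _ cf_const_cfun[of X 0]]) blast
  qed
  have Tne: "T g \<noteq> {}" if "g \<in> V" for g
  proof -
    obtain M where "\<forall>k\<in>K. \<bar>g k\<bar> \<le> M" using \<open>g \<in> V\<close> by (auto simp: V_def)
    then have "M \<in> T g" by (intro T_const) (auto simp: abs_le_iff)
    then show ?thesis by blast
  qed
  have Tlow: "- M \<le> c" if c: "c \<in> T g" and M: "\<forall>k\<in>K. \<bar>g k\<bar> \<le> M" for g c M
  proof -
    obtain \<phi> where \<phi>: "\<phi> \<in> cfun X" "\<forall>k\<in>K. g k \<le> k \<phi> - m \<phi> + c"
      using c by (auto simp: T_def)
    define \<psi> where "\<psi> = (\<lambda>x\<in>topspace X. (-1) * \<phi> x + 0)"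
    have \<psi>: "\<psi> \<in> cfun X" unfolding \<psi>_def by (rule affine_cfun[OF \<phi>(1)])
    have neg: "k \<psi> = - k \<phi>" if "k \<in> prob_functionals X" for k
      unfolding \<psi>_def using prob_affine[OF that \<phi>(1), of "-1" 0] by simp
    have "- M - c \<le> k \<phi> - m \<phi>" if "k \<in> K" for k
      using \<phi>(2) M that by (smt (verit))
    then have "k \<psi> \<le> - m \<phi> + M + c" if "k \<in> K" for k
      using neg[of k] that K(1) by fastforce
    then have "nu X K \<psi> \<le> - m \<phi> + M + c"
      by (rule nu_least[OF K(2) \<psi>])
    then show ?thesis using le[OF \<psi>] neg[OF m] by simp
  qed
  have Tbdd: "bdd_below (T g)" if g: "g \<in> V" for g
  proof -
    obtain M where "\<forall>k\<in>K. \<bar>g k\<bar> \<le> M" using g by (auto simp: V_def)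
    then show ?thesis using Tlow by (intro bdd_belowI[of _ "- M"]) auto
  qed
  have Tadd: "c + d \<in> T (\<lambda>k. g k + h k)" if c: "c \<in> T g" and d: "d \<in> T h" for c d g h
  proof -
    obtain \<phi> \<psi> where \<phi>: "\<phi> \<in> cfun X" "\<forall>k\<in>K. g k \<le> k \<phi> - m \<phi> + c"
      and \<psi>: "\<psi> \<in> cfun X" "\<forall>k\<in>K. h k \<le> k \<psi> - m \<psi> + d"
      using c d by (auto simp: T_def)
    let ?s = "\<lambda>x\<in>topspace X. 1 * \<phi> x + 1 * \<psi> x"
    have eq: "k ?s = k \<phi> + k \<psi>" if "k \<in> prob_functionals X" for k
      using prob_lincomb[OF that \<phi>(1) \<psi>(1), of 1 1] by simp
    have "g k + h k \<le> k ?s - m ?s + (c + d)" if k: "k \<in> K" for k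
    proof -
      have "g k \<le> k \<phi> - m \<phi> + c" "h k \<le> k \<psi> - m \<psi> + d"
        using \<phi>(2) \<psi>(2) k by blast+
      then show ?thesis using eq[OF m] eq[OF subsetD[OF K(1) k]] by linarith
    qed
    then have "\<forall>k\<in>K. g k + h k \<le> k ?s - m ?s + (c + d)" by blast
    then show ?thesis
      unfolding T_def by (intro CollectI bexI[OF _ lincomb_cfun[OF \<phi>(1) \<psi>(1), of 1 1]])
  qed
  have Tscale: "a * c \<in> T (\<lambda>k. a * g k)" if c: "c \<in> T g" and a: "a > 0" for a c g
  proof -
    obtain \<phi> where \<phi>: "\<phi> \<in> cfun X" "\<forall>k\<in>K. g k \<le> k \<phi> - m \<phi> + c"
      using c by (auto simp: T_def)
    have eq: "k (\<lambda>x\<in>topspace X. a * \<phi> x + 0) = a * k \<phi>" if "k \<in> prob_functionals X" for k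
      using prob_affine[OF that \<phi>(1), of a 0] by simp
    have "a * g k \<le> k (\<lambda>x\<in>topspace X. a * \<phi> x + 0) - m (\<lambda>x\<in>topspace X. a * \<phi> x + 0) + a * c"
      if "k \<in> K" for k
    proof -
      have "a * g k \<le> a * (k \<phi> - m \<phi> + c)"
        using \<phi>(2) that a by (intro mult_left_mono) auto
      then show ?thesis using eq[of k] eq[OF m] that K(1) by (auto simp: algebra_simps)
    qed
    then show ?thesis
      unfolding T_def by (intro CollectI bexI[OF _ affine_cfun[OF \<phi>(1), of a 0]]) blast
  qed
  define q where "q = (\<lambda>g. Inf (T g))"
  have qle: "q g \<le> c" if "g \<in> V" "c \<in> T g" for g c
    unfolding q_def by (rule cInf_lower[OF that(2) Tbdd[OF that(1)]])
  have qge: "c \<le> q g" if "g \<in> V" "\<And>d. d \<in> T g \<Longrightarrow> c \<le> d" for g c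
    unfolding q_def by (rule cInf_greatest[OF Tne[OF that(1)] that(2)])
  have q_scale: "q (\<lambda>k. a * g k) \<le> a * q g" if g: "g \<in> V" and a: "a > 0" for a g
  proof -
    have "q (\<lambda>k. a * g k) / a \<le> q g"
    proof (rule qge[OF g])
      fix d assume "d \<in> T g"
      from qle[OF scaleV[OF g] Tscale[OF this a]] show "q (\<lambda>k. a * g k) / a \<le> d"
        using a by (simp add: field_simps)
    qed
    then show ?thesis using a by (simp add: field_simps)
  qed
  have "sublinear_on V q"
  proof (rule sublinear_onI[OF scaleV _ q_scale])
    fix g h assume g: "g \<in> V" and h: "h \<in> V"
    have "q (\<lambda>k. g k + h k) - q h \<le> q g"
    proof (rule qge[OF g])
      fix c assume c: "c \<in> T g"
      have "q (\<lambda>k. g k + h k) - c \<le> q h"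
      proof (rule qge[OF h])
        fix d assume "d \<in> T h"
        from qle[OF addV[OF g h] Tadd[OF c this]] show "q (\<lambda>k. g k + h k) - c \<le> d" by simp
      qed
      then show "q (\<lambda>k. g k + h k) - q h \<le> c" by simp
    qed
    then show "q (\<lambda>k. g k + h k) \<le> q g + q h" by simp
  next
    fix g assume g: "g \<in> V"
    have z: "(\<lambda>k. 0) \<in> V" using scaleV[OF g, of 0] by simp
    have "q (\<lambda>k. 0) \<le> 0" by (intro qle[OF z] T_const) simp
    moreover have "0 \<le> q (\<lambda>k. 0)" by (rule qge[OF z]) (use Tlow[of _ _ 0] in simp)
    ultimately show "q (\<lambda>k. 0) = 0" by simp
  qed
  with addV scaleV obtain \<Lambda> where \<Lambda>: "\<And>g. g \<in> V \<Longrightarrow> \<Lambda> g \<le> q g"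
    "\<And>g h. \<lbrakk>g \<in> V; h \<in> V\<rbrakk> \<Longrightarrow> \<Lambda> (\<lambda>k. g k + h k) = \<Lambda> g + \<Lambda> h"
    "\<And>g c. g \<in> V \<Longrightarrow> \<Lambda> (\<lambda>k. c * g k) = c * \<Lambda> g"
    by (rule Hahn_Banach_functions) blast+
  have \<Lambda>le: "\<Lambda> g \<le> c" if "g \<in> V" "c \<in> T g" for g c
    using \<Lambda>(1)[OF that(1)] qle[OF that] by simp
  show thesis
  proof (rule that)
    show "\<Lambda> g \<le> c" if "g \<in> V" "\<And>k. k \<in> K \<Longrightarrow> g k \<le> c" for g c
      by (rule \<Lambda>le[OF that(1) T_const[OF that(2)]])
    fix \<phi> assume \<phi>: "\<phi> \<in> cfun X"
    have \<phi>V: "(\<lambda>k. k \<phi>) \<in> V"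
      unfolding V_def using prob_abs_le[OF _ \<phi>] K(1) by blast
    have "m \<phi> \<in> T (\<lambda>k. k \<phi>)"
      unfolding T_def by (intro CollectI bexI[OF _ \<phi>]) simp
    then have "\<Lambda> (\<lambda>k. k \<phi>) \<le> m \<phi>" by (rule \<Lambda>le[OF \<phi>V])
    moreover have "- m \<phi> \<in> T (\<lambda>k. (-1) * k \<phi>)"
    proof -
      let ?n = "\<lambda>x\<in>topspace X. (-1) * \<phi> x + 0"
      have eq: "k ?n = - k \<phi>" if "k \<in> prob_functionals X" for k
        using prob_affine[OF that \<phi>, of "-1" 0] by simp
      have "\<forall>k\<in>K. (-1) * k \<phi> \<le> k ?n - m ?n + - m \<phi>"
      proof
        fix k assume "k \<in> K"
        then show "(-1) * k \<phi> \<le> k ?n - m ?n + - m \<phi>"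
          using eq[OF m] eq[OF subsetD[OF K(1)], of k] by linarith
      qed
      then show ?thesis
        unfolding T_def by (intro CollectI bexI[OF _ affine_cfun[OF \<phi>, of "-1" 0]])
    qed
    then have "\<Lambda> (\<lambda>k. (-1) * k \<phi>) \<le> - m \<phi>" by (rule \<Lambda>le[OF scaleV[OF \<phi>V]])
    ultimately show "\<Lambda> (\<lambda>k. k \<phi>) = m \<phi>" using \<Lambda>(3)[OF \<phi>V, of "-1"] by simp
  qed (use \<Lambda> in auto)
qed


text \<open>  If the extreme point \<open>m\<close> is not in \<open>S\<close>, finitely many half-spaces \<open>k \<phi> > m \<phi> + 1\<close> cover \<open>S\<close>.  A
  mean with barycenter \<open>m\<close> gives positive weight to one of them.  The mean conditioned on this
  half-space and the complementary one split \<open>m\<close> into a mixture, so by extremality \<open>m\<close> is itself the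
  barycenter of the conditioned mean.  But that one exceeds \<open>m\<close> by 1 at \<open>\<phi>\<close>.\<close>

theorem Milman:
  assumes K: "K \<subseteq> S" "K \<noteq> {}" and S: "S \<subseteq> prob_functionals X" "compactin (fspace X) S"
    and m: "m \<in> ext_points X {m \<in> prob_functionals X. \<forall>\<phi>\<in>cfun X. m \<phi> \<le> nu X K \<phi>}"
      (is "m \<in> ext_points X ?A")
  shows "m \<in> S"
proof (rule ccontr)
  assume "m \<notin> S"
  have mP: "m \<in> prob_functionals X" and mle: "\<And>\<phi>. \<phi> \<in> cfun X \<Longrightarrow> m \<phi> \<le> nu X K \<phi>"
    and mext: "\<And>m1 m2 t. \<lbrakk>m1 \<in> ?A; m2 \<in> ?A; t \<in> {0<..<1}; m = mix X t m1 m2\<rbrakk> \<Longrightarrow> m1 = m2"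
    using m unfolding ext_points_def by blast+
  have KP: "K \<subseteq> prob_functionals X" using K S by blast
  define U where "U = (\<lambda>\<phi>. {k \<in> topspace (fspace X). k \<phi> \<in> {m \<phi> + 1<..}})"
  have openU: "openin (fspace X) (U \<phi>)" if "\<phi> \<in> cfun X" for \<phi>
    unfolding U_def by (rule openin_continuous_map_preimage[OF continuous_map_eval[OF that]]) simp
  have "S \<subseteq> \<Union>(U ` cfun X)"
  proof
    fix k assume k: "k \<in> S"
    then obtain \<phi> where \<phi>: "\<phi> \<in> cfun X" "m \<phi> + 1 < k \<phi>"
      using separating_half_space[of k m] S(1) mP \<open>m \<notin> S\<close> by blast
    have "k \<in> topspace (fspace X)"
      unfolding topspace_fspace using k S(1) prob_extensional by blast
    then have "k \<in> U \<phi>" using \<phi>(2) unfolding U_def by blast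
    then show "k \<in> \<Union>(U ` cfun X)" using \<phi>(1) by blast
  qed
  moreover have "\<forall>W\<in>U ` cfun X. openin (fspace X) W" using openU by blast
  ultimately obtain \<F> where "finite \<F>" "\<F> \<subseteq> U ` cfun X" "S \<subseteq> \<Union>\<F>"
    using S(2) unfolding compactin_def by meson
  then obtain \<Phi> where \<Phi>: "finite \<Phi>" "\<Phi> \<subseteq> cfun X" "S \<subseteq> \<Union>(U ` \<Phi>)"
    by (metis finite_subset_image)
  define V where "V = {g :: 'a functional \<Rightarrow> real. \<exists>M. \<forall>k\<in>K. \<bar>g k\<bar> \<le> M}"
  obtain \<Lambda> where
    add: "\<And>g h. \<lbrakk>g \<in> V; h \<in> V\<rbrakk> \<Longrightarrow> \<Lambda> (\<lambda>k. g k + h k) = \<Lambda> g + \<Lambda> h"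
    and scale: "\<And>g c. g \<in> V \<Longrightarrow> \<Lambda> (\<lambda>k. c * g k) = c * \<Lambda> g"
    and upper: "\<And>g c. \<lbrakk>g \<in> V; \<And>k. k \<in> K \<Longrightarrow> g k \<le> c\<rbrakk> \<Longrightarrow> \<Lambda> g \<le> c"
    and eval: "\<And>\<phi>. \<phi> \<in> cfun X \<Longrightarrow> \<Lambda> (\<lambda>k. k \<phi>) = m \<phi>"
    unfolding V_def by (rule representing_mean[OF KP K(2) mP mle]) (assumption | blast)+
  have VI: "g \<in> V" if "\<And>k. k \<in> K \<Longrightarrow> \<bar>g k\<bar> \<le> M" for g M
    unfolding V_def using that by blast
  have sumV: "(\<lambda>k. a * g k + b * h k) \<in> V" if g: "g \<in> V" and h: "h \<in> V" for a b g h
  proof -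
    obtain M N where "\<And>k. k \<in> K \<Longrightarrow> \<bar>g k\<bar> \<le> M" "\<And>k. k \<in> K \<Longrightarrow> \<bar>h k\<bar> \<le> N"
      using g h unfolding V_def by blast
    then have "\<bar>a * g k + b * h k\<bar> \<le> \<bar>a\<bar> * M + \<bar>b\<bar> * N" if "k \<in> K" for k
      using that by (auto intro!: order_trans[OF abs_triangle_ineq] add_mono mult_left_mono simp: abs_mult)
    then show ?thesis by (rule VI)
  qed
  have scaleV: "(\<lambda>k. a * g k) \<in> V" if "g \<in> V" for a g
    using sumV[OF that that, of a 0] by simp
  have lin: "\<Lambda> (\<lambda>k. a * g k + b * h k) = a * \<Lambda> g + b * \<Lambda> h" if g: "g \<in> V" and h: "h \<in> V" for a b g h
    using add[OF scaleV[OF g, of a] scaleV[OF h, of b]] scale[OF g, of a] scale[OF h, of b] by simp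
  have mono: "\<Lambda> g \<le> \<Lambda> h" if g: "g \<in> V" and h: "h \<in> V" and le: "\<And>k. k \<in> K \<Longrightarrow> g k \<le> h k" for g h
  proof -
    have "\<Lambda> (\<lambda>k. 1 * g k + (-1) * h k) \<le> 0"
      by (rule upper[OF sumV[OF g h]]) (simp add: le)
    then show ?thesis using lin[OF g h, of 1 "-1"] by simp
  qed
  have cong: "\<Lambda> g = \<Lambda> h" if "g \<in> V" "h \<in> V" "\<And>k. k \<in> K \<Longrightarrow> g k = h k" for g h
    using mono[of g h] mono[of h g] that by (simp add: antisym)
  have one: "\<Lambda> (\<lambda>k. 1) = 1"
  proof -
    have "\<Lambda> (\<lambda>k. 1) = \<Lambda> (\<lambda>k. k (cf_const X 1))"
    proof (rule cong)
      show "(\<lambda>k. k (cf_const X 1)) \<in> V"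
        by (rule VI, rule prob_abs_le[OF _ cf_const_cfun]) (use KP in blast)
      show "1 = k (cf_const X 1)" if "k \<in> K" for k using prob_const KP that by fastforce
    qed (auto intro: VI[of _ 1])
    then show ?thesis using eval[OF cf_const_cfun] prob_const[OF mP] by simp
  qed
  define I where "I = (\<lambda>\<phi> k. of_bool (k \<in> U \<phi>) :: real)"
  have IV: "I \<phi> \<in> V" for \<phi> by (rule VI[of _ 1]) (simp add: I_def)
  have "\<exists>\<phi>\<in>\<Phi>. 0 < \<Lambda> (I \<phi>)"
  proof (rule ccontr)
    assume neg: "\<not> (\<exists>\<phi>\<in>\<Phi>. 0 < \<Lambda> (I \<phi>))"
    have "(\<lambda>k. \<Sum>\<phi>\<in>\<Psi>. I \<phi> k) \<in> V \<and> \<Lambda> (\<lambda>k. \<Sum>\<phi>\<in>\<Psi>. I \<phi> k) \<le> 0" if "finite \<Psi>" "\<Psi> \<subseteq> \<Phi>" for \<Psi>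
      using that
    proof (induction \<Psi> rule: finite_induct)
      case empty
      have "(\<lambda>k. 0) \<in> V" by (rule VI[of _ 0]) simp
      then show ?case using upper[of "\<lambda>k. 0" 0] by simp
    next
      case (insert \<phi> \<Psi>)
      then have IH: "(\<lambda>k. \<Sum>\<phi>\<in>\<Psi>. I \<phi> k) \<in> V" "\<Lambda> (\<lambda>k. \<Sum>\<phi>\<in>\<Psi>. I \<phi> k) \<le> 0" "\<Lambda> (I \<phi>) \<le> 0"
        using neg by force+
      have eq: "(\<lambda>k. \<Sum>\<phi>\<in>insert \<phi> \<Psi>. I \<phi> k) = (\<lambda>k. 1 * I \<phi> k + 1 * (\<Sum>\<phi>\<in>\<Psi>. I \<phi> k))"
        using insert.hyps by auto
      show ?case
        unfolding eq using sumV[OF IV IH(1), of 1 \<phi> 1] lin[OF IV IH(1), of 1 \<phi> 1] IH(2,3) by auto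
    qed
    from this[OF \<Phi>(1) order_refl]
    have *: "(\<lambda>k. \<Sum>\<phi>\<in>\<Phi>. I \<phi> k) \<in> V" "\<Lambda> (\<lambda>k. \<Sum>\<phi>\<in>\<Phi>. I \<phi> k) \<le> 0" by auto
    have "1 \<le> (\<Sum>\<phi>\<in>\<Phi>. I \<phi> k)" if k: "k \<in> K" for k
    proof -
      obtain \<phi> where \<phi>: "\<phi> \<in> \<Phi>" "k \<in> U \<phi>" using k K(1) \<Phi>(3) by blast
      then have "I \<phi> k = 1" by (simp add: I_def)
      moreover have "I \<phi> k \<le> (\<Sum>\<phi>\<in>\<Phi>. I \<phi> k)"
        by (rule member_le_sum[OF \<phi>(1) _ \<Phi>(1)]) (simp add: I_def)
      ultimately show ?thesis by simp
    qed
    then have "\<Lambda> (\<lambda>k. 1) \<le> \<Lambda> (\<lambda>k. \<Sum>\<phi>\<in>\<Phi>. I \<phi> k)"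
      by (intro mono * VI[of _ 1]) auto
    then show False using one *(2) by simp
  qed
  then obtain \<phi>0 where \<phi>0: "\<phi>0 \<in> cfun X" and pos: "0 < \<Lambda> (I \<phi>0)" using \<Phi>(2) by blast
  have hV: "(\<lambda>k. h k * k \<phi>) \<in> V" if h: "\<And>k. 0 \<le> h k \<and> h k \<le> 1" and \<phi>: "\<phi> \<in> cfun X" for h \<phi>
  proof (rule VI[of _ "sup_norm \<phi>"])
    fix k assume "k \<in> K"
    then have "\<bar>k \<phi>\<bar> \<le> sup_norm \<phi>" using prob_abs_le[OF _ \<phi>] KP by blast
    then show "\<bar>h k * k \<phi>\<bar> \<le> sup_norm \<phi>"
      using mult_mono[of "h k" 1 "\<bar>k \<phi>\<bar>" "sup_norm \<phi>"] h[of k] by (simp add: abs_mult)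
  qed
  \<comment> \<open>The barycenter of the mean conditioned on the weight \<open>h\<close>.\<close>
  define cond where "cond = (\<lambda>h. \<lambda>\<phi>\<in>cfun X. \<Lambda> (\<lambda>k. h k * k \<phi>) / \<Lambda> h)"
  have cond: "cond h \<in> ?A" if h: "\<And>k. 0 \<le> h k \<and> h k \<le> 1" and hpos: "0 < \<Lambda> h" for h
  proof -
    have hv: "h \<in> V" by (rule VI[of _ 1]) (use h in \<open>simp add: abs_of_nonneg\<close>)
    have P: "cond h \<in> prob_functionals X"
    proof (rule prob_functionalsI)
      show "cond h \<in> extensional (cfun X)" by (simp add: cond_def)
    next
      fix \<phi> \<psi> :: "'a \<Rightarrow> real" and a b assume \<phi>: "\<phi> \<in> cfun X" and \<psi>: "\<psi> \<in> cfun X"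
      let ?s = "\<lambda>x\<in>topspace X. a * \<phi> x + b * \<psi> x"
      have s: "?s \<in> cfun X" by (rule lincomb_cfun[OF \<phi> \<psi>])
      have "\<Lambda> (\<lambda>k. h k * k ?s) = \<Lambda> (\<lambda>k. a * (h k * k \<phi>) + b * (h k * k \<psi>))"
      proof (rule cong[OF hV[OF h s] sumV[OF hV[OF h \<phi>] hV[OF h \<psi>]]])
        fix k assume "k \<in> K"
        then show "h k * k ?s = a * (h k * k \<phi>) + b * (h k * k \<psi>)"
          using prob_lincomb[OF subsetD[OF KP] \<phi> \<psi>, of k a b] by (simp add: algebra_simps)
      qed
      also have "\<dots> = a * \<Lambda> (\<lambda>k. h k * k \<phi>) + b * \<Lambda> (\<lambda>k. h k * k \<psi>)"
        by (rule lin[OF hV[OF h \<phi>] hV[OF h \<psi>]])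
      finally show "cond h ?s = a * cond h \<phi> + b * cond h \<psi>"
        using s \<phi> \<psi> by (simp add: cond_def add_divide_distrib)
    next
      fix \<phi> assume \<phi>: "\<phi> \<in> cfun X" and nn: "\<And>x. x \<in> topspace X \<Longrightarrow> 0 \<le> \<phi> x"
      have "0 * \<Lambda> h \<le> \<Lambda> (\<lambda>k. h k * k \<phi>)"
        unfolding scale[OF hv, symmetric]
      proof (rule mono[OF scaleV[OF hv] hV[OF h \<phi>]])
        fix k assume "k \<in> K"
        then have "0 \<le> k \<phi>" using prob_ge_const[OF subsetD[OF KP] \<phi> nn] by blast
        then show "0 * h k \<le> h k * k \<phi>" using h[of k] by simp
      qed
      then show "0 \<le> cond h \<phi>" using hpos \<phi> by (simp add: cond_def)
    next
      have "\<Lambda> (\<lambda>k. h k * k (cf_const X 1)) = \<Lambda> h"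
        by (rule cong[OF hV[OF h cf_const_cfun] hv]) (use prob_const KP in fastforce)
      then show "cond h (cf_const X 1) = 1"
        using hpos cf_const_cfun[of X 1] by (simp add: cond_def)
    qed
    moreover have "cond h \<phi> \<le> nu X K \<phi>" if \<phi>: "\<phi> \<in> cfun X" for \<phi>
    proof -
      have "\<Lambda> (\<lambda>k. h k * k \<phi>) \<le> \<Lambda> (\<lambda>k. nu X K \<phi> * h k)"
      proof (rule mono[OF hV[OF h \<phi>] scaleV[OF hv]])
        fix k assume "k \<in> K"
        then have "k \<phi> \<le> nu X K \<phi>" by (rule nu_upper[OF KP \<phi>])
        then show "h k * k \<phi> \<le> nu X K \<phi> * h k"
          using mult_left_mono[of "k \<phi>" "nu X K \<phi>" "h k"] h[of k] by (simp add: mult.commute)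
      qed
      then show ?thesis
        unfolding scale[OF hv] using hpos \<phi> by (simp add: cond_def pos_divide_le_eq)
    qed
    ultimately show ?thesis by blast
  qed
  \<comment> \<open>Halving the indicator keeps both conditioning weights strictly between 0 and 1,
    even if \<open>\<Lambda>\<close> is concentrated on the set of the indicator.\<close>
  let ?h = "\<lambda>k. 1 / 2 * I \<phi>0 k" and ?h' = "\<lambda>k. 1 * 1 + (-1) * (1 / 2 * I \<phi>0 k)"
  have h01: "0 \<le> ?h k \<and> ?h k \<le> 1" "0 \<le> ?h' k \<and> ?h' k \<le> 1" for k by (auto simp: I_def)
  have hV1: "(\<lambda>k. ?h k * k \<phi>) \<in> V" and hV2: "(\<lambda>k. ?h' k * k \<phi>) \<in> V" if "\<phi> \<in> cfun X" for \<phi>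
    by (rule hV[OF h01(1) that] hV[OF h01(2) that])+
  have oneV: "(\<lambda>k. 1) \<in> V" by (rule VI[of _ 1]) simp
  have halfV: "?h \<in> V" by (rule scaleV[OF IV])
  have split1: "\<Lambda> ?h' = 1 - \<Lambda> ?h"
    using lin[OF oneV halfV, of 1 "-1"] one by simp
  have split: "m \<phi> = \<Lambda> (\<lambda>k. ?h k * k \<phi>) + \<Lambda> (\<lambda>k. ?h' k * k \<phi>)" if \<phi>: "\<phi> \<in> cfun X" for \<phi>
  proof -
    have "(\<lambda>k. ?h k * k \<phi> + ?h' k * k \<phi>) = (\<lambda>k. k \<phi>)"
      by (rule ext) (simp add: left_diff_distrib)
    then show ?thesis using add[OF hV1[OF \<phi>] hV2[OF \<phi>]] eval[OF \<phi>] by simp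
  qed
  have "\<Lambda> (I \<phi>0) \<le> 1" by (rule upper[OF IV]) (simp add: I_def)
  then have t: "0 < \<Lambda> ?h" "0 < \<Lambda> ?h'" "1 - \<Lambda> ?h \<in> {0<..<1}"
    using pos split1 scale[OF IV, of "1 / 2" \<phi>0] by auto
  have cancel: "a * (b / a) = b" if "0 < a" for a b :: real using that by simp
  have "m = mix X (1 - \<Lambda> ?h) (cond ?h) (cond ?h')"
  proof (rule functional_eqI[OF prob_extensional[OF mP]])
    show "mix X (1 - \<Lambda> ?h) (cond ?h) (cond ?h') \<in> extensional (cfun X)" by (simp add: mix_def)
    fix \<phi> assume \<phi>: "\<phi> \<in> cfun X"
    have "mix X (1 - \<Lambda> ?h) (cond ?h) (cond ?h') \<phi>
        = \<Lambda> ?h * (\<Lambda> (\<lambda>k. ?h k * k \<phi>) / \<Lambda> ?h) + \<Lambda> ?h' * (\<Lambda> (\<lambda>k. ?h' k * k \<phi>) / \<Lambda> ?h')"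
      unfolding split1 using \<phi> by (simp add: mix_apply cond_def split1[simplified])
    also have "\<dots> = m \<phi>" unfolding split[OF \<phi>] cancel[OF t(1)] cancel[OF t(2)] ..
    finally show "m \<phi> = mix X (1 - \<Lambda> ?h) (cond ?h) (cond ?h') \<phi>" ..
  qed
  moreover from mext[OF cond[where h="?h", OF h01(1) t(1)] cond[where h="?h'", OF h01(2) t(2)] t(3) this]
  have "cond ?h = cond ?h'" .
  ultimately have "m = mix X (1 - \<Lambda> ?h) (cond ?h) (cond ?h)" by simp
  then have "m \<phi>0 = cond ?h \<phi>0"
    using mix_apply[OF \<phi>0, of "1 - \<Lambda> ?h" "cond ?h" "cond ?h"] by (simp add: left_diff_distrib)
  then have "m \<phi>0 = \<Lambda> (\<lambda>k. ?h k * k \<phi>0) / \<Lambda> ?h" using \<phi>0 by (simp add: cond_def)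
  moreover have "(m \<phi>0 + 1) * \<Lambda> ?h \<le> \<Lambda> (\<lambda>k. ?h k * k \<phi>0)"
    unfolding scale[OF halfV, symmetric]
    by (rule mono[OF scaleV[OF halfV] hV1[OF \<phi>0]]) (auto simp: I_def U_def)
  ultimately show False using t(1) by (simp add: field_simps)
qed

end

section \<open>Measures with a dominating atom\<close>

text \<open>  Points may repeat and weights may vanish.  In contrast to the supports in the definition of
  \<open>P_f\<close>, this makes the parameter space of such sums with a fixed index set closed.\<close>

definition dirac_sum :: "'a topology \<Rightarrow> 'i set \<Rightarrow> ('i \<Rightarrow> real) \<Rightarrow> ('i \<Rightarrow> 'a) \<Rightarrow> 'a functional" where
  "dirac_sum X I a x = (\<lambda>\<phi>\<in>cfun X. \<Sum>i\<in>I. a i * \<phi> (x i))"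

text \<open>  For a measure \<open>k\<close> this says that the point \<open>x\<close> has mass at least \<open>c\<close>, expressed by the values of
  \<open>k\<close> so that it passes to limits.\<close>

definition mass_ge :: "'a topology \<Rightarrow> real \<Rightarrow> 'a functional \<Rightarrow> 'a \<Rightarrow> bool" where
  "mass_ge X c k x \<longleftrightarrow> x \<in> topspace X \<and>
     (\<forall>\<phi>\<in>cfun X. (\<forall>z\<in>topspace X. 0 \<le> \<phi> z) \<longrightarrow> c * \<phi> x \<le> k \<phi>)"

lemma mass_geD:
  "\<lbrakk>mass_ge X c k x; \<phi> \<in> cfun X; \<And>z. z \<in> topspace X \<Longrightarrow> 0 \<le> \<phi> z\<rbrakk> \<Longrightarrow> c * \<phi> x \<le> k \<phi>"
  by (simp add: mass_ge_def)

lemma mass_ge_antimono: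
  assumes "mass_ge X c k x" "c' \<le> c"
  shows "mass_ge X c' k x"
  unfolding mass_ge_def
proof (intro conjI ballI impI)
  show x: "x \<in> topspace X" using assms(1) by (simp add: mass_ge_def)
  fix \<phi> assume \<phi>: "\<phi> \<in> cfun X" "\<forall>z\<in>topspace X. 0 \<le> \<phi> z"
  then have "c' * \<phi> x \<le> c * \<phi> x" using assms(2) x by (intro mult_right_mono) auto
  also have "\<dots> \<le> k \<phi>" using assms(1) \<phi> by (auto simp: mass_ge_def)
  finally show "c' * \<phi> x \<le> k \<phi>" .
qed

lemma dirac_sum_prob:
  fixes X :: "'a topology"
  assumes "finite I" "x ` I \<subseteq> topspace X" "\<And>i. i \<in> I \<Longrightarrow> 0 \<le> a i" "sum a I = 1"
  shows "dirac_sum X I a x \<in> prob_functionals X"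
proof (rule prob_functionalsI)
  fix \<phi> \<psi> :: "'a \<Rightarrow> real" and b c assume "\<phi> \<in> cfun X" "\<psi> \<in> cfun X"
  moreover have "(\<Sum>i\<in>I. a i * (\<lambda>x\<in>topspace X. b * \<phi> x + c * \<psi> x) (x i))
      = (\<Sum>i\<in>I. b * (a i * \<phi> (x i)) + c * (a i * \<psi> (x i)))"
    using assms(2) by (intro sum.cong) (auto simp: algebra_simps)
  ultimately show "dirac_sum X I a x (\<lambda>x\<in>topspace X. b * \<phi> x + c * \<psi> x)
      = b * dirac_sum X I a x \<phi> + c * dirac_sum X I a x \<psi>"
    using lincomb_cfun[of \<phi> X \<psi> b c] by (simp add: dirac_sum_def sum.distrib sum_distrib_left)
next
  have "(\<Sum>i\<in>I. a i * cf_const X 1 (x i)) = sum a I"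
    using assms(2) by (intro sum.cong) (auto simp: cf_const_def)
  then show "dirac_sum X I a x (cf_const X 1) = 1"
    using assms(4) cf_const_cfun[of X 1] by (simp add: dirac_sum_def)
next
  fix \<phi> assume "\<phi> \<in> cfun X" "\<And>x. x \<in> topspace X \<Longrightarrow> 0 \<le> \<phi> x"
  then show "0 \<le> dirac_sum X I a x \<phi>"
    using assms by (auto simp: dirac_sum_def intro!: sum_nonneg mult_nonneg_nonneg)
qed (simp add: dirac_sum_def)

lemma dirac_sum_mass_ge:
  assumes "finite I" "x ` I \<subseteq> topspace X" "\<And>i. i \<in> I \<Longrightarrow> 0 \<le> a i" "i \<in> I"
  shows "mass_ge X (a i) (dirac_sum X I a x) (x i)"
  unfolding mass_ge_def
proof (intro conjI ballI impI)
  fix \<phi> assume "\<phi> \<in> cfun X" "\<forall>z\<in>topspace X. 0 \<le> \<phi> z"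
  then show "a i * \<phi> (x i) \<le> dirac_sum X I a x \<phi>"
    using assms by (auto simp: dirac_sum_def image_subset_iff
        intro!: member_le_sum[of _ _ "\<lambda>i. a i * \<phi> (x i)"] mult_nonneg_nonneg)
qed (use assms in auto)

lemma P_f_eq:
  "P_f X = {dirac_sum X S \<alpha> id | S \<alpha>. finite S \<and> S \<subseteq> topspace X \<and> (\<forall>x\<in>S. \<alpha> x > 0) \<and> sum \<alpha> S = 1 \<and>
     (\<exists>x0\<in>S. \<alpha> x0 \<ge> 1 - 1 / (real (card S) + 1))}"
proof -
  have "(\<lambda>\<phi>\<in>cfun X. \<Sum>x\<in>S. \<alpha> x * dirac X x \<phi>) = dirac_sum X S \<alpha> id" for S \<alpha>
    by (auto simp: dirac_sum_def dirac_def)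
  then show ?thesis by (simp add: P_f_def)
qed

lemma P_fE:
  assumes "k \<in> P_f X"
  obtains S \<alpha> x where "finite S" "S \<subseteq> topspace X" "\<forall>y\<in>S. \<alpha> y > 0" "sum \<alpha> S = 1"
    "x \<in> S" "\<alpha> x \<ge> 1 - 1 / (real (card S) + 1)" "k = dirac_sum X S \<alpha> id"
  using assms unfolding P_f_eq mem_Collect_eq by (elim exE conjE bexE) (rule that)

text \<open>  Collecting repeated points and dropping zero weights can only lower the number of points and raise
  the weight of the distinguished one, and the bound \<open>1 - 1/(n+1)\<close> becomes weaker as \<open>n\<close> decreases.\<close>

lemma dirac_sum_in_P_f:
  fixes X :: "'a topology"
  assumes I: "finite I" and x: "x ` I \<subseteq> topspace X" and a: "\<And>i. i \<in> I \<Longrightarrow> 0 \<le> a i" "sum a I = 1"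
    and i0: "i0 \<in> I" "a i0 \<ge> 1 - 1 / (real (card I) + 1)"
  shows "dirac_sum X I a x \<in> P_f X"
proof -
  define w where "w = (\<lambda>y. \<Sum>i\<in>{i \<in> I. x i = y}. a i)"
  define S where "S = {y \<in> x ` I. w y > 0}"
  have w0: "0 \<le> w y" for y unfolding w_def by (rule sum_nonneg) (use a in auto)
  have gather: "(\<Sum>i\<in>I. a i * f (x i)) = (\<Sum>y\<in>S. w y * f y)" for f :: "'a \<Rightarrow> real"
  proof -
    have "(\<Sum>i\<in>I. a i * f (x i)) = (\<Sum>y\<in>x ` I. \<Sum>i\<in>{i \<in> I. x i = y}. a i * f (x i))"
      by (rule sum.image_gen[OF I])
    also have "\<dots> = (\<Sum>y\<in>x ` I. w y * f y)"
      unfolding w_def sum_distrib_right by (intro sum.cong) auto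
    also have "\<dots> = (\<Sum>y\<in>S. w y * f y)"
      using I w0 by (intro sum.mono_neutral_right) (auto simp: S_def less_le)
    finally show ?thesis .
  qed
  have card: "card S \<le> card I"
    using card_mono[of "x ` I" S] card_image_le[OF I, of x] I by (auto simp: S_def)
  have "a i0 \<le> w (x i0)"
    unfolding w_def by (rule member_le_sum) (use I i0 a in auto)
  moreover have "1 / (real (card I) + 1) \<le> 1 / (real (card S) + 1)"
    using card by (simp add: frac_le)
  ultimately have big: "w (x i0) \<ge> 1 - 1 / (real (card S) + 1)" "w (x i0) \<ge> 1 - 1 / (real (card I) + 1)"
    using i0(2) by linarith+
  have "card I > 0" using I i0 by (auto simp: card_gt_0_iff)
  then have "1 / (real (card I) + 1) < 1" by simp
  then have "0 < w (x i0)" using big(2) by linarith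
  then have "x i0 \<in> S" using i0(1) unfolding S_def by blast
  moreover have "sum w S = 1" using gather[of "\<lambda>_. 1"] a(2) by simp
  moreover have "dirac_sum X I a x = dirac_sum X S w id"
    unfolding dirac_sum_def using gather by (intro restrict_ext) simp
  moreover have "finite S" "S \<subseteq> topspace X" "\<forall>y\<in>S. w y > 0"
    using I x by (auto simp: S_def)
  ultimately show ?thesis unfolding P_f_eq using big(1) by blast
qed

lemma P_f_subset_prob: "P_f X \<subseteq> prob_functionals X"
proof
  fix k assume "k \<in> P_f X"
  then obtain S \<alpha> x where S: "finite S" "S \<subseteq> topspace X" "\<forall>x\<in>S. \<alpha> x > 0" "sum \<alpha> S = 1"
    and k: "k = dirac_sum X S \<alpha> id"
    by (rule P_fE)
  show "k \<in> prob_functionals X"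
    unfolding k by (rule dirac_sum_prob) (use S in \<open>auto simp: less_imp_le\<close>)
qed

lemma dirac_in_P_f:
  assumes "x \<in> topspace X"
  shows "dirac X x \<in> P_f X"
proof -
  have "dirac X x = dirac_sum X {()} (\<lambda>_. 1) (\<lambda>_. x)" by (auto simp: dirac_def dirac_sum_def)
  then show ?thesis using dirac_sum_in_P_f[of "{()}" "\<lambda>_. x" X "\<lambda>_. 1" "()"] assms by simp
qed

text \<open>  For two points the required weight is \<open>2/3\<close>.\<close>

lemma mix_dirac_in_P_f:
  assumes "x \<in> topspace X" "y \<in> topspace X" "0 \<le> t" "t \<le> 1 / 3"
  shows "mix X t (dirac X x) (dirac X y) \<in> P_f X"
proof -
  have "mix X t (dirac X x) (dirac X y)
      = dirac_sum X UNIV (\<lambda>b. if b then 1 - t else t) (\<lambda>b. if b then x else y)"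
    by (auto simp: mix_def dirac_def dirac_sum_def UNIV_bool)
  moreover have "dirac_sum X UNIV (\<lambda>b. if b then 1 - t else t) (\<lambda>b. if b then x else y) \<in> P_f X"
    by (rule dirac_sum_in_P_f[of _ _ _ _ True]) (use assms in \<open>auto simp: UNIV_bool\<close>)
  ultimately show ?thesis by simp
qed

text \<open>  The bound \<open>1 - 1/(n+1)\<close> is at least \<open>2/3\<close> for \<open>n \<ge> 2\<close>, and for \<open>n = 1\<close> the atom has mass 1.  Moving
  further mass to the atom keeps the number of points and raises the largest weight.\<close>

lemma P_f_main_atom:
  assumes "k \<in> P_f X"
  obtains x where "mass_ge X (2 / 3) k x" "\<And>s. \<lbrakk>0 \<le> s; s \<le> 1\<rbrakk> \<Longrightarrow> mix X s k (dirac X x) \<in> P_f X"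
proof -
  obtain S \<alpha> x where S: "finite S" "S \<subseteq> topspace X" "\<forall>y\<in>S. \<alpha> y > 0" "sum \<alpha> S = 1"
    and x: "x \<in> S" "\<alpha> x \<ge> 1 - 1 / (real (card S) + 1)" and k: "k = dirac_sum X S \<alpha> id"
    using assms by (rule P_fE)
  have pos: "\<And>y. y \<in> S \<Longrightarrow> 0 \<le> \<alpha> y" using S(3) by (simp add: less_imp_le)
  have "2 / 3 \<le> \<alpha> x"
  proof (cases "card S = 1")
    case True
    then have "S = {x}" using x(1) by (auto simp: card_1_singleton_iff)
    then show ?thesis using S(4) by simp
  next
    case False
    moreover have "card S \<noteq> 0" using S(1) x(1) by auto
    ultimately have "2 \<le> card S" by linarith
    then have "1 / (real (card S) + 1) \<le> 1 / 3" by (intro frac_le) auto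
    then show ?thesis using x(2) by linarith
  qed
  moreover have "mass_ge X (\<alpha> x) k x"
    using dirac_sum_mass_ge[of S id X \<alpha> x] S(1,2) pos x(1) k by simp
  ultimately have "mass_ge X (2 / 3) k x" by (metis mass_ge_antimono)
  moreover have "mix X s k (dirac X x) \<in> P_f X" if s: "0 \<le> s" "s \<le> 1" for s
  proof -
    define \<beta> where "\<beta> = (\<lambda>y. (1 - s) * \<alpha> y + s * (if y = x then 1 else 0))"
    have sum: "(\<Sum>y\<in>S. \<beta> y * f y) = (1 - s) * (\<Sum>y\<in>S. \<alpha> y * f y) + s * f x" for f :: "'a \<Rightarrow> real"
    proof -
      have "(\<Sum>y\<in>S. \<beta> y * f y) = (\<Sum>y\<in>S. (1 - s) * (\<alpha> y * f y) + (if y = x then s * f y else 0))"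
        by (intro sum.cong) (auto simp: \<beta>_def algebra_simps)
      also have "\<dots> = (1 - s) * (\<Sum>y\<in>S. \<alpha> y * f y) + s * f x"
        using S(1) x(1) by (simp add: sum.distrib sum_distrib_left)
      finally show ?thesis .
    qed
    have "\<alpha> x \<le> 1" using member_le_sum[OF x(1) _ S(1), of \<alpha>] pos S(4) by auto
    then have "s * \<alpha> x \<le> s * 1" by (intro mult_left_mono s)
    then have "\<alpha> x \<le> \<beta> x" by (simp add: \<beta>_def algebra_simps)
    then have "dirac_sum X S \<beta> id \<in> P_f X"
      using S x pos s sum[of "\<lambda>_. 1"] by (intro dirac_sum_in_P_f[of _ _ _ _ x]) (auto simp: \<beta>_def)
    moreover have "mix X s k (dirac X x) = dirac_sum X S \<beta> id"
      unfolding k mix_def dirac_sum_def dirac_def by (intro restrict_ext) (simp add: sum)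
    ultimately show ?thesis by simp
  qed
  ultimately show thesis by (rule that)
qed

context compact_Hausdorff
begin

text \<open>  Points and weights of a sum with \<open>n\<close> summands; a compact parameter space.\<close>

definition tuple_space :: "nat \<Rightarrow> ((nat \<Rightarrow> 'a) \<times> (nat \<Rightarrow> real)) topology" where
  "tuple_space n = prod_topology (product_topology (\<lambda>_. X) {..<n})
     (product_topology (\<lambda>_. top_of_set {0..1}) {..<n})"

definition P_tuples :: "nat \<Rightarrow> 'a functional set" where
  "P_tuples n = (\<lambda>p. dirac_sum X {..<n} (snd p) (fst p)) `
     {p \<in> topspace (tuple_space n). (\<Sum>i<n. snd p i) = 1 \<and>
       (\<exists>i\<in>{..<n}. snd p i \<in> {1 - 1 / (real n + 1)..})}"

lemma compactin_P_tuples: "compactin (fspace X) (P_tuples n)"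
proof -
  have cX: "compact_space (tuple_space n)"
    using compact by (simp add: tuple_space_def compact_space_prod_topology compact_space_product_topology
        compact_space_subtopology)
  have fst: "continuous_map (tuple_space n) X (\<lambda>p. fst p i)" if "i < n" for i
    using continuous_map_compose[OF continuous_map_fst
        continuous_map_product_projection[of i "{..<n}" "\<lambda>_. X"]] that
    by (simp add: tuple_space_def o_def)
  have snd: "continuous_map (tuple_space n) euclideanreal (\<lambda>p. snd p i)" if "i < n" for i
    using continuous_map_compose[OF continuous_map_snd
        continuous_map_product_projection[of i "{..<n}" "\<lambda>_. top_of_set {0..1::real}"]] that
    unfolding tuple_space_def o_def continuous_map_in_subtopology by blast
  have "continuous_map (tuple_space n) (fspace X) (\<lambda>p. dirac_sum X {..<n} (snd p) (fst p))"
    unfolding continuous_map_into_fspace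
  proof (intro conjI ballI)
    fix \<phi> assume \<phi>: "\<phi> \<in> cfun X"
    have "continuous_map (tuple_space n) euclideanreal (\<lambda>p. \<phi> (fst p i))" if "i < n" for i
      using continuous_map_compose[OF fst[OF that] cfun_continuous[OF \<phi>]] by (simp add: o_def)
    then show "continuous_map (tuple_space n) euclideanreal (\<lambda>p. dirac_sum X {..<n} (snd p) (fst p) \<phi>)"
      using \<phi> snd by (auto simp: dirac_sum_def intro!: continuous_map_sum continuous_map_real_mult)
  qed (auto simp: dirac_sum_def)
  moreover have "closedin (tuple_space n) {p \<in> topspace (tuple_space n). (\<Sum>i<n. snd p i) = 1 \<and>
       (\<exists>i\<in>{..<n}. snd p i \<in> {1 - 1 / (real n + 1)..})}"
  proof (rule closedin_Collect_conj)
    show "closedin (tuple_space n) {p \<in> topspace (tuple_space n). (\<Sum>i<n. snd p i) = 1}"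
      by (rule closedin_continuous_maps_eq[of euclideanreal]) (auto intro!: continuous_map_sum snd)
    have eq: "{p \<in> topspace (tuple_space n). \<exists>i\<in>{..<n}. snd p i \<in> {1 - 1 / (real n + 1)..}}
        = (\<Union>i\<in>{..<n}. {p \<in> topspace (tuple_space n). snd p i \<in> {1 - 1 / (real n + 1)..}})"
      by blast
    show "closedin (tuple_space n) {p \<in> topspace (tuple_space n). \<exists>i\<in>{..<n}. snd p i \<in> {1 - 1 / (real n + 1)..}}"
      unfolding eq
      by (intro closedin_Union finite_imageI finite_lessThan)
        (auto intro!: closedin_continuous_map_preimage[OF snd] simp del: atLeast_iff)
  qed
  ultimately show ?thesis
    unfolding P_tuples_def using closedin_compact_space[OF cX] image_compactin by blast
qed

lemma P_tuples_elim:
  assumes "k \<in> P_tuples n"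
  obtains x a i where "k = dirac_sum X {..<n} a x" "x ` {..<n} \<subseteq> topspace X"
    "\<And>i. i \<in> {..<n} \<Longrightarrow> 0 \<le> a i" "sum a {..<n} = 1" "i \<in> {..<n}" "a i \<ge> 1 - 1 / (real n + 1)"
  using assms that unfolding P_tuples_def tuple_space_def by (fastforce simp: PiE_iff)

lemma P_tuples_subset: "P_tuples n \<subseteq> P_f X"
proof
  fix k assume "k \<in> P_tuples n"
  then show "k \<in> P_f X"
  proof (rule P_tuples_elim)
    fix x a i
    assume k: "k = dirac_sum X {..<n} a x"
      and *: "x ` {..<n} \<subseteq> topspace X" "\<And>i. i \<in> {..<n} \<Longrightarrow> 0 \<le> a i" "sum a {..<n} = 1"
        "i \<in> {..<n}" "a i \<ge> 1 - 1 / (real n + 1)"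
    show "k \<in> P_f X"
      unfolding k using *(5) by (intro dirac_sum_in_P_f[OF finite_lessThan *(1-4)]) auto
  qed
qed

lemma P_f_subset_P_tuples: "P_f X \<subseteq> (\<Union>n. P_tuples n)"
proof
  fix k assume "k \<in> P_f X"
  then obtain S \<alpha> x where S: "finite S" "S \<subseteq> topspace X" "\<forall>y\<in>S. \<alpha> y > 0" "sum \<alpha> S = 1"
    and x: "x \<in> S" "\<alpha> x \<ge> 1 - 1 / (real (card S) + 1)" and k: "k = dirac_sum X S \<alpha> id"
    by (rule P_fE)
  obtain h where h: "bij_betw h {..<card S} S"
    using ex_bij_betw_nat_finite[OF S(1)] by (auto simp: atLeast0LessThan)
  let ?x = "restrict h {..<card S}" and ?a = "restrict (\<alpha> \<circ> h) {..<card S}"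
  have hS: "h i \<in> S" if "i < card S" for i using h that by (auto simp: bij_betw_def)
  have re: "(\<Sum>i<card S. f (h i)) = sum f S" for f :: "'a \<Rightarrow> real"
    using sum.reindex_bij_betw[OF h, of f] .
  have "\<alpha> y \<le> 1" if "y \<in> S" for y
    using member_le_sum[OF that _ S(1), of \<alpha>] S(3,4) by (auto intro: less_imp_le)
  then have "(?x, ?a) \<in> topspace (tuple_space (card S))"
    using S(2,3) hS by (auto simp: tuple_space_def less_imp_le)
  moreover have "(\<Sum>i<card S. ?a i) = 1" using re[of \<alpha>] S(4) by simp
  moreover obtain i where "i < card S" "h i = x"
    using x(1) h unfolding bij_betw_def by (metis imageE lessThan_iff)
  moreover have "dirac_sum X {..<card S} ?a ?x = k"
    unfolding k dirac_sum_def
  proof (intro restrict_ext)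
    fix \<phi>
    show "(\<Sum>i<card S. ?a i * \<phi> (?x i)) = (\<Sum>y\<in>S. \<alpha> y * \<phi> (id y))"
      using re[of "\<lambda>y. \<alpha> y * \<phi> y"] by simp
  qed
  ultimately have "k \<in> P_tuples (card S)"
    unfolding P_tuples_def using x(2) by (intro image_eqI[of _ _ "(?x, ?a)"]) auto
  then show "k \<in> (\<Union>n. P_tuples n)" by blast
qed

lemma closedin_mass_ge:
  "closedin (fspace X) {k \<in> topspace (fspace X). \<exists>x\<in>topspace X. mass_ge X c k x}"
proof (rule closedin_compact_projection[OF compact])
  let ?Z = "prod_topology X (fspace X)"
  let ?P = "{\<phi> \<in> cfun X. \<forall>z\<in>topspace X. 0 \<le> \<phi> z}"
  have "{p \<in> topspace X \<times> topspace (fspace X). mass_ge X c (snd p) (fst p)}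
      = {p \<in> topspace ?Z. \<forall>\<phi>\<in>?P. snd p \<phi> - c * \<phi> (fst p) \<in> {0..}}"
    by (auto simp: mass_ge_def)
  also have "closedin ?Z \<dots>"
  proof (rule closedin_Collect_ball)
    fix \<phi> assume "\<phi> \<in> ?P"
    then have \<phi>: "\<phi> \<in> cfun X" by simp
    have "continuous_map ?Z euclideanreal (\<lambda>p. \<phi> (fst p))"
      using continuous_map_compose[OF continuous_map_fst cfun_continuous[OF \<phi>]] by (simp add: o_def)
    moreover have "continuous_map ?Z euclideanreal (\<lambda>p. snd p \<phi>)"
      using continuous_map_compose[OF continuous_map_snd continuous_map_eval[OF \<phi>]] by (simp add: o_def)
    ultimately have "continuous_map ?Z euclideanreal (\<lambda>p. snd p \<phi> - c * \<phi> (fst p))"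
      by (intro continuous_map_diff continuous_map_real_mult) auto
    then show "closedin ?Z {p \<in> topspace ?Z. snd p \<phi> - c * \<phi> (fst p) \<in> {0..}}"
      by (rule closedin_continuous_map_preimage) simp
  qed
  finally show "closedin ?Z {p \<in> topspace X \<times> topspace (fspace X). mass_ge X c (snd p) (fst p)}" .
qed

lemma Urysohn_cfun:
  assumes "closedin X S" "closedin X T" "S \<inter> T = {}"
  obtains \<phi> where "\<phi> \<in> cfun X" "\<And>x. x \<in> topspace X \<Longrightarrow> 0 \<le> \<phi> x \<and> \<phi> x \<le> 1"
    "\<And>x. x \<in> S \<Longrightarrow> \<phi> x = 0" "\<And>x. x \<in> T \<Longrightarrow> \<phi> x = 1"
proof -
  obtain f where f: "continuous_map X (top_of_set {0..1::real}) f" "f ` S \<subseteq> {0}" "f ` T \<subseteq> {1}"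
    using normal[unfolded normal_space_iff_Urysohn, rule_format, of S T] assms
    unfolding disjnt_def by metis
  have c: "continuous_map X euclideanreal f" and r: "\<And>x. x \<in> topspace X \<Longrightarrow> f x \<in> {0..1}"
    using f(1) by (auto simp: continuous_map_in_subtopology)
  show thesis
  proof (rule that[OF cfunI[OF c]])
    show "restrict f (topspace X) x = 0" if "x \<in> S" for x
      using f(2) closedin_subset[OF assms(1)] that by auto
    show "restrict f (topspace X) x = 1" if "x \<in> T" for x
      using f(3) closedin_subset[OF assms(2)] that by auto
    show "0 \<le> restrict f (topspace X) x \<and> restrict f (topspace X) x \<le> 1" if "x \<in> topspace X" for x
      using r[OF that] that by simp
  qed
qed

lemma closedin_point: "x \<in> topspace X \<Longrightarrow> closedin X {x}"
  using Hausdorff by (simp add: closedin_Hausdorff_sing_eq)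

lemma mass_ge_unique:
  assumes k: "k \<in> prob_functionals X" and x: "mass_ge X (2 / 3) k x" and y: "mass_ge X (2 / 3) k y"
  shows "x = y"
proof (rule ccontr)
  assume "x \<noteq> y"
  have t: "x \<in> topspace X" "y \<in> topspace X" using x y by (simp_all add: mass_ge_def)
  then obtain \<phi> where \<phi>: "\<phi> \<in> cfun X" "\<And>x. x \<in> topspace X \<Longrightarrow> 0 \<le> \<phi> x \<and> \<phi> x \<le> 1" "\<phi> x = 0" "\<phi> y = 1"
    using Urysohn_cfun[OF closedin_point closedin_point, of x y] \<open>x \<noteq> y\<close> by auto
  let ?\<psi> = "\<lambda>x\<in>topspace X. (-1) * \<phi> x + 1"
  have "2 / 3 * ?\<psi> x \<le> k ?\<psi>"
    by (rule mass_geD[OF x affine_cfun[OF \<phi>(1)]]) (use \<phi>(2) in auto)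
  moreover have "2 / 3 * \<phi> y \<le> k \<phi>"
    by (rule mass_geD[OF y \<phi>(1)]) (use \<phi>(2) in auto)
  ultimately show False
    using prob_affine[OF k \<phi>(1), of "-1" 1] \<phi>(3,4) t by simp
qed

text \<open>  The offset 2 matches the bound \<open>1 - 1/(n+1)\<close> for measures with more than \<open>N\<close> points, that is for
  \<open>n \<ge> N + 1\<close>.\<close>

lemma full_mass_eq_dirac:
  assumes k: "k \<in> prob_functionals X" and x: "\<And>n::nat. mass_ge X (1 - 1 / (real n + 2)) k x"
  shows "k = dirac X x"
proof -
  have t: "x \<in> topspace X" using x[of 0] by (simp add: mass_ge_def)
  have ge: "\<phi> x \<le> k \<phi>" if \<phi>: "\<phi> \<in> cfun X" "\<And>z. z \<in> topspace X \<Longrightarrow> 0 \<le> \<phi> z" for \<phi>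
  proof (rule LIMSEQ_le_const2)
    show "(\<lambda>n. (1 - 1 / (real n + 2)) * \<phi> x) \<longlonglongrightarrow> \<phi> x" by real_asymp
    show "\<exists>N. \<forall>n\<ge>N. (1 - 1 / (real n + 2)) * \<phi> x \<le> k \<phi>"
      using mass_geD[OF x \<phi>] by blast
  qed
  show ?thesis
  proof (rule functional_eqI[OF prob_extensional[OF k]])
    fix \<phi> assume \<phi>: "\<phi> \<in> cfun X"
    have b: "\<phi> z \<le> sup_norm \<phi>" "- sup_norm \<phi> \<le> \<phi> z" if "z \<in> topspace X" for z
      using sup_norm(2)[OF \<phi> that] by linarith+
    have "(\<lambda>x\<in>topspace X. 1 * \<phi> x + sup_norm \<phi>) x \<le> k (\<lambda>x\<in>topspace X. 1 * \<phi> x + sup_norm \<phi>)"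
      by (rule ge[OF affine_cfun[OF \<phi>]]) (use b in force)
    moreover have "(\<lambda>x\<in>topspace X. (-1) * \<phi> x + sup_norm \<phi>) x \<le> k (\<lambda>x\<in>topspace X. (-1) * \<phi> x + sup_norm \<phi>)"
      by (rule ge[OF affine_cfun[OF \<phi>]]) (use b in force)
    ultimately have "k \<phi> = \<phi> x"
      unfolding prob_affine[OF k \<phi>] using t by simp
    then show "k \<phi> = dirac X x \<phi>" by (simp add: dirac_apply[OF \<phi>])
  qed (simp add: dirac_def)
qed

text \<open>  The measures with at most \<open>N\<close> points form a compact set.  A measure in the closure of \<open>P_f X\<close> that
  lies in none of the closures of these sets is a limit of measures with arbitrarily many points,
  hence with atoms of mass arbitrarily close to 1, and is therefore a Dirac measure.\<close>

theorem compactin_P_f: "compactin (fspace X) (P_f X)"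
proof -
  have ext: "P_f X \<subseteq> topspace (fspace X)"
    unfolding topspace_fspace using P_f_subset_prob prob_extensional by blast
  have "fspace X closure_of P_f X \<subseteq> P_f X"
  proof
    fix k assume k: "k \<in> fspace X closure_of P_f X"
    have kp: "k \<in> prob_functionals X"
      using k closure_of_minimal[OF P_f_subset_prob closedin_prob] by blast
    show "k \<in> P_f X"
    proof (cases "\<exists>N. k \<in> fspace X closure_of (\<Union>n\<in>{..N}. P_tuples n)")
      case True
      then obtain N where N: "k \<in> fspace X closure_of (\<Union>n\<in>{..N}. P_tuples n)" by blast
      have "closedin (fspace X) (\<Union>n\<in>{..N}. P_tuples n)"
        by (intro closedin_Union) (auto intro: compactin_imp_closedin[OF Hausdorff_fspace compactin_P_tuples])
      then have "k \<in> (\<Union>n\<in>{..N}. P_tuples n)" using N closure_of_closedin by metis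
      then show ?thesis using P_tuples_subset by blast
    next
      case False
      have "\<exists>x. mass_ge X (1 - 1 / (real N + 2)) k x" for N
      proof -
        have "P_f X = (\<Union>n\<in>{..N}. P_tuples n) \<union> (\<Union>n\<in>{N<..}. P_tuples n)"
        proof (intro equalityI subsetI)
          fix k assume "k \<in> P_f X"
          then obtain n where "k \<in> P_tuples n" using P_f_subset_P_tuples by blast
          then show "k \<in> (\<Union>n\<in>{..N}. P_tuples n) \<union> (\<Union>n\<in>{N<..}. P_tuples n)"
            by (cases "n \<le> N") auto
        qed (use P_tuples_subset in blast)
        then have "k \<in> fspace X closure_of (\<Union>n\<in>{N<..}. P_tuples n)"
          using k False by (auto simp: closure_of_Un)
        moreover have "(\<Union>n\<in>{N<..}. P_tuples n)
            \<subseteq> {k \<in> topspace (fspace X). \<exists>x\<in>topspace X. mass_ge X (1 - 1 / (real N + 2)) k x}"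
        proof
          fix k assume "k \<in> (\<Union>n\<in>{N<..}. P_tuples n)"
          then obtain n where n: "N < n" "k \<in> P_tuples n" by blast
          from n(2) obtain x a i where kx: "k = dirac_sum X {..<n} a x" "x ` {..<n} \<subseteq> topspace X"
            "\<And>i. i \<in> {..<n} \<Longrightarrow> 0 \<le> a i" "i \<in> {..<n}" "a i \<ge> 1 - 1 / (real n + 1)"
            by (rule P_tuples_elim) blast
          have "1 / (real n + 1) \<le> 1 / (real N + 2)" using n(1) by (intro frac_le) auto
          then have "1 - 1 / (real N + 2) \<le> a i" using kx(5) by linarith
          with dirac_sum_mass_ge[OF finite_lessThan kx(2-4)]
          have m: "mass_ge X (1 - 1 / (real N + 2)) k (x i)"
            unfolding kx(1) by (rule mass_ge_antimono)
          have "k \<in> topspace (fspace X)" using n(2) P_tuples_subset ext by blast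
          moreover have "x i \<in> topspace X" using kx(2,4) by blast
          ultimately show "k \<in> {k \<in> topspace (fspace X). \<exists>x\<in>topspace X. mass_ge X (1 - 1 / (real N + 2)) k x}"
            using m by blast
        qed
        ultimately show ?thesis
          using closure_of_minimal[OF _ closedin_mass_ge] by blast
      qed
      then obtain x where x: "\<And>N::nat. mass_ge X (1 - 1 / (real N + 2)) k (x N)" by metis
      \<comment> \<open>For \<open>N \<ge> 1\<close> the mass is at least \<open>2/3\<close>, and two different points cannot both have that much.\<close>
      have "x N = x 1" if "1 \<le> N" for N
      proof -
        have "1 / (real N + 2) \<le> 1 / 3" using that by (intro frac_le) auto
        then have "mass_ge X (2 / 3) k (x N)" by (intro mass_ge_antimono[OF x[of N]]) linarith
        moreover have "mass_ge X (2 / 3) k (x 1)" by (intro mass_ge_antimono[OF x[of 1]]) simp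
        ultimately show ?thesis by (rule mass_ge_unique[OF kp])
      qed
      then have "mass_ge X (1 - 1 / (real N + 2)) k (x 1)" for N :: nat
      proof -
        have "x (Suc N) = x 1" by (rule \<open>\<And>N. 1 \<le> N \<Longrightarrow> x N = x 1\<close>) simp
        moreover have "1 - 1 / (real N + 2) \<le> 1 - 1 / (real (Suc N) + 2)" by (simp add: frac_le)
        ultimately show ?thesis using mass_ge_antimono[OF x[of "Suc N"]] by simp
      qed
      then have "k = dirac X (x 1)" by (rule full_mass_eq_dirac[OF kp])
      moreover have "x 1 \<in> topspace X" using x[of 1] by (simp add: mass_ge_def)
      ultimately show ?thesis using dirac_in_P_f by simp
    qed
  qed
  then have "closedin (fspace X) (P_f X)"
    using ext closure_of_subset_eq by blast
  then show ?thesis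
    using closed_compactin[OF compactin_prob P_f_subset_prob] by blast
qed

end

section \<open>The functionals in \<open>OS_f\<close> and their centers\<close>

lemma topspace_exp_space: "topspace (exp_space X) = exp_sets X"
proof -
  have "exp_sets X = {F \<in> exp_sets X. F \<subseteq> topspace X}"
    using closedin_subset by (auto simp: exp_sets_def)
  then show ?thesis
    unfolding exp_space_def topology_generated_by_topspace by blast
qed

lemma openin_exp_contained: "openin X U \<Longrightarrow> openin (exp_space X) {F \<in> exp_sets X. F \<subseteq> U}"
  unfolding exp_space_def by (rule topology_generated_by_Basis) blast

lemma openin_exp_hit: "openin X U \<Longrightarrow> openin (exp_space X) {F \<in> exp_sets X. F \<inter> U \<noteq> {}}"
  unfolding exp_space_def by (rule topology_generated_by_Basis) blast

text \<open>  At most \<open>1/3\<close> of the mass of \<open>k\<close> is left for points where \<open>\<phi>\<close> is as large as \<open>M\<close>.\<close>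

lemma mass_ge_upper:
  assumes k: "k \<in> prob_functionals X" and x: "mass_ge X (2 / 3) k x" and \<phi>: "\<phi> \<in> cfun X"
    and M: "\<And>z. z \<in> topspace X \<Longrightarrow> \<phi> z \<le> M"
  shows "k \<phi> \<le> 2 / 3 * \<phi> x + 1 / 3 * M"
proof -
  have "2 / 3 * (\<lambda>x\<in>topspace X. (-1) * \<phi> x + M) x \<le> k (\<lambda>x\<in>topspace X. (-1) * \<phi> x + M)"
    by (rule mass_geD[OF x affine_cfun[OF \<phi>]]) (use M in force)
  moreover have "x \<in> topspace X" using x by (simp add: mass_ge_def)
  ultimately show ?thesis unfolding prob_affine[OF k \<phi>] by simp
qed

definition below :: "'a topology \<Rightarrow> 'a functional \<Rightarrow> 'a functional set" where
  "below X \<nu> = {k \<in> P_f X. \<forall>\<psi>\<in>cfun X. k \<psi> \<le> \<nu> \<psi>}"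

text \<open>  The main atoms of all \<open>k \<in> P_f X\<close> below \<open>\<nu>\<close>, closed up.\<close>

definition center :: "'a topology \<Rightarrow> 'a functional \<Rightarrow> 'a set" where
  "center X \<nu> = X closure_of {x. \<exists>k\<in>below X \<nu>. mass_ge X (2 / 3) k x}"

text \<open>  For \<open>t = 0\<close> the measures are the Dirac measures of \<open>F\<close>.  For \<open>t = 1\<close> the functional dominates every
  measure that has mass at least \<open>2/3\<close> at a point of \<open>F\<close>, because \<open>z\<close> is arbitrary.\<close>

definition spread :: "'a topology \<Rightarrow> real \<Rightarrow> 'a set \<Rightarrow> 'a functional" where
  "spread X t F = nu X {mix X (t / 3) (dirac X y) (dirac X z) | y z. y \<in> F \<and> z \<in> topspace X}"

lemma in_center: "\<lbrakk>k \<in> below X \<nu>; mass_ge X (2 / 3) k x\<rbrakk> \<Longrightarrow> x \<in> center X \<nu>"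
  unfolding center_def by (rule subsetD[OF closure_of_subset]) (auto simp: mass_ge_def)

lemma center_approx:
  assumes "x \<in> center X \<nu>" "openin X U" "x \<in> U"
  obtains k y where "k \<in> below X \<nu>" "mass_ge X (2 / 3) k y" "y \<in> U"
  using assms unfolding center_def in_closure_of by blast

lemma center_minimal:
  assumes "closedin X C" "\<And>k x. \<lbrakk>k \<in> below X \<nu>; mass_ge X (2 / 3) k x\<rbrakk> \<Longrightarrow> x \<in> C"
  shows "center X \<nu> \<subseteq> C"
  unfolding center_def by (rule closure_of_minimal[OF _ assms(1)]) (use assms(2) in blast)

context compact_Hausdorff
begin

lemma Urysohn_point:
  assumes "closedin X C" "y \<in> topspace X" "y \<notin> C"
  obtains \<phi> where "\<phi> \<in> cfun X" "\<And>x. x \<in> topspace X \<Longrightarrow> 0 \<le> \<phi> x \<and> \<phi> x \<le> 1"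
    "\<And>x. x \<in> C \<Longrightarrow> \<phi> x = 0" "\<phi> y = 1"
proof -
  have "C \<inter> {y} = {}" using assms(3) by blast
  from Urysohn_cfun[OF assms(1) closedin_point[OF assms(2)] this] that show thesis
    by (metis insertI1)
qed

lemma below_P_f: "below X \<nu> \<subseteq> P_f X"
  by (auto simp: below_def)

lemma below_main_atom:
  assumes "k \<in> below X \<nu>"
  obtains x where "mass_ge X (2 / 3) k x"
proof -
  have "k \<in> P_f X" using assms below_P_f by blast
  then show thesis by (rule P_f_main_atom) (rule that)
qed

lemma below_prob: "below X \<nu> \<subseteq> prob_functionals X"
  using below_P_f P_f_subset_prob by blast

lemma belowD: "\<lbrakk>k \<in> below X \<nu>; \<psi> \<in> cfun X\<rbrakk> \<Longrightarrow> k \<psi> \<le> \<nu> \<psi>"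
  by (simp add: below_def)

lemma nu_below:
  assumes "\<nu> \<in> extensional (cfun X)" "\<And>\<phi>. \<phi> \<in> cfun X \<Longrightarrow> \<exists>k\<in>below X \<nu>. \<nu> \<phi> \<le> k \<phi>"
  shows "below X \<nu> \<noteq> {}" "nu X (below X \<nu>) = \<nu>"
proof -
  show ne: "below X \<nu> \<noteq> {}" using assms(2)[OF cf_const_cfun] by blast
  show "nu X (below X \<nu>) = \<nu>"
  proof (rule functional_eqI[OF nu_extensional assms(1)])
    fix \<phi> assume \<phi>: "\<phi> \<in> cfun X"
    obtain k where k: "k \<in> below X \<nu>" "\<nu> \<phi> \<le> k \<phi>" using assms(2)[OF \<phi>] by blast
    have "nu X (below X \<nu>) \<phi> \<le> \<nu> \<phi>" by (rule nu_least[OF ne \<phi>]) (rule belowD[OF _ \<phi>])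
    moreover have "k \<phi> \<le> nu X (below X \<nu>) \<phi>" by (rule nu_upper[OF below_prob \<phi> k(1)])
    ultimately show "nu X (below X \<nu>) \<phi> = \<nu> \<phi>" using k(2) by linarith
  qed
qed

text \<open>  All measures below the supremum of \<open>K\<close> form a closed convex set with the same supremum; this set
  stands for the closed convex hull of \<open>K\<close>, and its extreme points are in \<open>P_f X\<close> by \<open>Milman\<close>.\<close>

lemma nu_in_OS_f:
  assumes K: "K \<subseteq> P_f X" "K \<noteq> {}"
  shows "nu X K \<in> OS_f X"
proof -
  let ?A = "{m \<in> prob_functionals X. \<forall>\<phi>\<in>cfun X. m \<phi> \<le> nu X K \<phi>}"
  have KP: "K \<subseteq> prob_functionals X" using K(1) P_f_subset_prob by blast
  have KA: "K \<subseteq> ?A" using KP nu_upper[OF KP] by blast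
  have Ane: "?A \<noteq> {}" using KA K(2) by blast
  have eq: "?A = {m \<in> topspace (prob_functionals_space X). \<forall>\<phi>\<in>cfun X. m \<phi> \<in> {..nu X K \<phi>}}"
    using prob_extensional[of _ X] unfolding prob_functionals_space_eq topspace_subtopology topspace_fspace
    by auto
  have "closedin (prob_functionals_space X) ?A"
    unfolding eq prob_functionals_space_eq
    by (intro closedin_Collect_ball closedin_continuous_map_preimage[of _ euclideanreal]
        continuous_map_from_subtopology continuous_map_eval) auto
  moreover have "mix X t \<mu> \<nu> \<in> ?A" if A: "\<mu> \<in> ?A" "\<nu> \<in> ?A" and t: "t \<in> {0..1}" for \<mu> \<nu> t
  proof -
    have "(1 - t) * \<mu> \<phi> + t * \<nu> \<phi> \<le> nu X K \<phi>" if "\<phi> \<in> cfun X" for \<phi>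
    proof -
      have "\<mu> \<phi> \<le> nu X K \<phi>" "\<nu> \<phi> \<le> nu X K \<phi>" using A that by auto
      then have "(1 - t) * \<mu> \<phi> + t * \<nu> \<phi> \<le> (1 - t) * nu X K \<phi> + t * nu X K \<phi>"
        using t by (intro add_mono mult_left_mono) auto
      then show ?thesis by (simp add: algebra_simps)
    qed
    then show ?thesis
      using A t by (auto intro!: mix_prob simp: mix_apply)
  qed
  ultimately have "?A \<in> cc_prob X" using Ane unfolding cc_prob_def by blast
  moreover have "ext_points X ?A \<subseteq> P_f X"
    using Milman[OF K P_f_subset_prob compactin_P_f] by blast
  moreover have "nu X ?A = nu X K"
  proof (rule functional_eqI[OF nu_extensional nu_extensional])
    fix \<phi> assume \<phi>: "\<phi> \<in> cfun X"
    have "nu X ?A \<phi> \<le> nu X K \<phi>" by (rule nu_least[OF Ane \<phi>]) (use \<phi> in blast)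
    moreover have "nu X K \<phi> \<le> nu X ?A \<phi>"
      by (rule nu_least[OF K(2) \<phi>], rule nu_upper[OF _ \<phi>]) (use KA in blast)+
    ultimately show "nu X ?A \<phi> = nu X K \<phi>" by simp
  qed
  ultimately show ?thesis unfolding OS_f_def by (metis (mono_tags, lifting) mem_Collect_eq)
qed

text \<open>  Membership in \<open>OS_f X\<close> without closed convex sets and extreme points: all values are attained by
  measures from \<open>P_f X\<close> below the functional.  All later arguments rest on this form.\<close>

lemma OS_f_iff:
  "\<nu> \<in> OS_f X \<longleftrightarrow> \<nu> \<in> extensional (cfun X) \<and> (\<forall>\<phi>\<in>cfun X. \<exists>k\<in>below X \<nu>. \<nu> \<phi> \<le> k \<phi>)"
proof
  assume "\<nu> \<in> OS_f X"
  then obtain A where A: "A \<in> cc_prob X" "ext_points X A \<subseteq> P_f X" and \<nu>: "\<nu> = nu X A"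
    by (auto simp: OS_f_def)
  have ne: "A \<noteq> {}" using A(1) by (simp add: cc_prob_def)
  have AP: "A \<subseteq> prob_functionals X" by (rule cc_prob_subset[OF A(1)])
  have "\<exists>k\<in>below X \<nu>. \<nu> \<phi> \<le> k \<phi>" if \<phi>: "\<phi> \<in> cfun X" for \<phi>
  proof -
    obtain e where e: "e \<in> ext_points X A" "\<And>\<mu>. \<mu> \<in> A \<Longrightarrow> \<mu> \<phi> \<le> e \<phi>"
      using Krein_Milman_attained[OF cc_prob_compactin[OF A(1)] ne \<phi>] by metis
    have eA: "e \<in> A" using e(1) by (simp add: ext_points_def)
    have "e \<in> below X \<nu>"
      unfolding below_def \<nu> using e(1) A(2) nu_upper[OF AP _ eA] by blast
    moreover have "\<nu> \<phi> \<le> e \<phi>" unfolding \<nu> by (rule nu_least[OF ne \<phi>]) (rule e(2))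
    ultimately show ?thesis by blast
  qed
  then show "\<nu> \<in> extensional (cfun X) \<and> (\<forall>\<phi>\<in>cfun X. \<exists>k\<in>below X \<nu>. \<nu> \<phi> \<le> k \<phi>)"
    by (simp add: \<nu> nu_extensional)
next
  assume "\<nu> \<in> extensional (cfun X) \<and> (\<forall>\<phi>\<in>cfun X. \<exists>k\<in>below X \<nu>. \<nu> \<phi> \<le> k \<phi>)"
  then have "below X \<nu> \<noteq> {}" "nu X (below X \<nu>) = \<nu>" using nu_below by blast+
  then show "\<nu> \<in> OS_f X" using nu_in_OS_f[OF below_P_f, of \<nu>] by simp
qed

lemma OS_f_attained:
  assumes "\<nu> \<in> OS_f X" "\<phi> \<in> cfun X"
  obtains k where "k \<in> below X \<nu>" "\<nu> \<phi> = k \<phi>"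
proof -
  obtain k where k: "k \<in> below X \<nu>" "\<nu> \<phi> \<le> k \<phi>" using assms OS_f_iff by blast
  then show thesis using that[of k] belowD[OF k(1) assms(2)] by simp
qed

lemma OS_f_below:
  assumes "\<nu> \<in> OS_f X"
  shows "below X \<nu> \<noteq> {}" "nu X (below X \<nu>) = \<nu>"
  using nu_below assms OS_f_iff by blast+

lemma OS_f_subset_box: "OS_f X \<subseteq> box"
  using nu_box[OF below_prob] OS_f_below by (metis subsetI)

lemma OS_f_space_eq: "OS_f_space X = subtopology (fspace X) (OS_f X)"
proof -
  have "OS_f X \<subseteq> OS X"
    using nu_OS[OF below_prob] OS_f_below by (metis subsetI)
  then show ?thesis
    by (simp add: OS_f_space_def OS_space_def subtopology_subtopology inf_absorb2)
qed

lemma topspace_OS_f_space: "topspace (OS_f_space X) = OS_f X"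
  unfolding OS_f_space_eq topspace_subtopology topspace_fspace using OS_f_iff by blast

text \<open>  In the description by \<open>OS_f_iff\<close> the existential quantifier ranges over the compact set \<open>P_f X\<close>.\<close>

theorem compactin_OS_f: "compactin (fspace X) (OS_f X)"
proof -
  let ?Z = "subtopology (fspace X) (P_f X)" and ?Y = "fspace X"
  have Z: "topspace ?Z = P_f X"
    using compactin_subset_topspace[OF compactin_P_f] by (simp del: topspace_fspace add: inf_absorb2)
  have cZ: "compact_space ?Z" by (rule compact_space_subtopology[OF compactin_P_f])
  have "OS_f X = {\<nu> \<in> topspace ?Y. \<forall>\<phi>\<in>cfun X. \<exists>k\<in>topspace ?Z.
      (\<forall>\<psi>\<in>cfun X. \<nu> \<psi> - k \<psi> \<in> {0..}) \<and> k \<phi> - \<nu> \<phi> \<in> {0..}}"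
  proof -
    have "(\<exists>k\<in>below X \<nu>. \<nu> \<phi> \<le> k \<phi>) \<longleftrightarrow>
        (\<exists>k\<in>P_f X. (\<forall>\<psi>\<in>cfun X. \<nu> \<psi> - k \<psi> \<in> {0..}) \<and> k \<phi> - \<nu> \<phi> \<in> {0..})" for \<nu> \<phi>
      by (auto simp: below_def)
    then show ?thesis
      unfolding Z topspace_fspace by (simp only: set_eq_iff OS_f_iff mem_Collect_eq) simp
  qed
  also have "closedin ?Y \<dots>"
  proof (rule closedin_Collect_ball, rule closedin_compact_projection[OF cZ])
    fix \<phi> assume \<phi>: "\<phi> \<in> cfun X"
    have f: "continuous_map (prod_topology ?Z ?Y) euclideanreal (\<lambda>p. fst p \<psi>)" if "\<psi> \<in> cfun X" for \<psi>
      using continuous_map_compose[OF continuous_map_fst[of ?Z ?Y]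
          continuous_map_from_subtopology[OF continuous_map_eval[OF that]]] by (simp only: o_def)
    have s: "continuous_map (prod_topology ?Z ?Y) euclideanreal (\<lambda>p. snd p \<psi>)" if "\<psi> \<in> cfun X" for \<psi>
      using continuous_map_compose[OF continuous_map_snd[of ?Z ?Y] continuous_map_eval[OF that]]
      by (simp only: o_def)
    have "closedin (prod_topology ?Z ?Y) {p \<in> topspace (prod_topology ?Z ?Y).
        (\<forall>\<psi>\<in>cfun X. snd p \<psi> - fst p \<psi> \<in> {0..}) \<and> fst p \<phi> - snd p \<phi> \<in> {0..}}"
      by (intro closedin_Collect_conj closedin_Collect_ball continuous_map_diff f s \<phi>
          closedin_continuous_map_preimage[of _ euclideanreal]) auto
    then show "closedin (prod_topology ?Z ?Y) {p \<in> topspace ?Z \<times> topspace ?Y.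
        (\<forall>\<psi>\<in>cfun X. snd p \<psi> - fst p \<psi> \<in> {0..}) \<and> fst p \<phi> - snd p \<phi> \<in> {0..}}"
      by (simp only: topspace_prod_topology)
  qed
  finally show ?thesis
    by (rule closed_compactin[OF compactin_box OS_f_subset_box])
qed

lemma center_in_exp_sets:
  assumes "\<nu> \<in> OS_f X"
  shows "center X \<nu> \<in> exp_sets X"
proof -
  obtain k where k: "k \<in> below X \<nu>" using OS_f_below[OF assms] by blast
  then obtain x where "mass_ge X (2 / 3) k x"
    by (rule below_main_atom) (rule that)
  then have "center X \<nu> \<noteq> {}" using in_center[OF k] by blast
  then show ?thesis by (simp add: exp_sets_def center_def)
qed

lemma continuous_OS_f_eval:
  "\<phi> \<in> cfun X \<Longrightarrow> continuous_map (OS_f_space X) euclideanreal (\<lambda>\<nu>. \<nu> \<phi>)"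
  unfolding OS_f_space_eq by (intro continuous_map_from_subtopology continuous_map_eval)

lemma openin_OS_f_greater: "\<phi> \<in> cfun X \<Longrightarrow> openin (OS_f_space X) {\<nu> \<in> OS_f X. c < \<nu> \<phi>}"
  using openin_continuous_map_preimage[OF continuous_OS_f_eval, of \<phi> "{c<..}"]
  by (simp add: topspace_OS_f_space)

lemma openin_OS_f_less: "\<phi> \<in> cfun X \<Longrightarrow> openin (OS_f_space X) {\<nu> \<in> OS_f X. \<nu> \<phi> < c}"
  using openin_continuous_map_preimage[OF continuous_OS_f_eval, of \<phi> "{..<c}"]
  by (simp add: topspace_OS_f_space)

text \<open>  Let \<open>\<phi>\<close> have values in \<open>[0,1]\<close>.  If the center of \<open>\<nu>\<close> meets the open set \<open>U\<close>, choose \<open>\<phi>\<close> zero off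
  \<open>U\<close> with \<open>\<nu> \<phi> \<ge> 2/3\<close>; every functional whose value at \<open>\<phi>\<close> exceeds \<open>1/2\<close> has a main atom in \<open>U\<close>.  If
  the center is contained in \<open>U\<close>, choose \<open>\<phi>\<close> one off \<open>U\<close> with \<open>\<nu> \<phi> \<le> 1/3\<close>; every functional whose
  value at \<open>\<phi>\<close> is below \<open>1/2\<close> has all main atoms in the closed set \<open>\<phi> \<le> 3/4\<close> inside \<open>U\<close>.\<close>

theorem continuous_center: "continuous_map (OS_f_space X) (exp_space X) (center X)"
proof -
  have hit: "openin (OS_f_space X) {\<nu> \<in> OS_f X. center X \<nu> \<inter> U \<noteq> {}}" if U: "openin X U" for U
  proof (subst openin_subopen, intro ballI)
    fix \<nu> assume \<nu>: "\<nu> \<in> {\<nu> \<in> OS_f X. center X \<nu> \<inter> U \<noteq> {}}"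
    then obtain x where "x \<in> center X \<nu>" "x \<in> U" by blast
    then obtain k y where k: "k \<in> below X \<nu>" "mass_ge X (2 / 3) k y" "y \<in> U"
      using center_approx[OF _ U] by metis
    have y: "y \<in> topspace X" using k(2) by (simp add: mass_ge_def)
    obtain \<phi> where \<phi>: "\<phi> \<in> cfun X" "\<And>x. x \<in> topspace X \<Longrightarrow> 0 \<le> \<phi> x \<and> \<phi> x \<le> 1"
      "\<And>x. x \<in> topspace X - U \<Longrightarrow> \<phi> x = 0" "\<phi> y = 1"
      by (rule Urysohn_point[of "topspace X - U" y]) (use U y k(3) in auto)
    have "2 / 3 * \<phi> y \<le> k \<phi>" by (rule mass_geD[OF k(2) \<phi>(1)]) (use \<phi>(2) in blast)
    then have "1 / 2 < \<nu> \<phi>" using belowD[OF k(1) \<phi>(1)] \<phi>(4) by simp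
    moreover have "center X \<nu>' \<inter> U \<noteq> {}" if \<nu>': "\<nu>' \<in> OS_f X" "1 / 2 < \<nu>' \<phi>" for \<nu>'
    proof -
      obtain k' where k': "k' \<in> below X \<nu>'" "\<nu>' \<phi> = k' \<phi>" by (rule OS_f_attained[OF \<nu>'(1) \<phi>(1)]) (rule that)
      obtain x' where x': "mass_ge X (2 / 3) k' x'"
        by (rule below_main_atom[OF k'(1)]) (rule that)
      have "k' \<phi> \<le> 2 / 3 * \<phi> x' + 1 / 3 * 1"
        by (rule mass_ge_upper[OF _ x' \<phi>(1)]) (use k'(1) below_prob \<phi>(2) in blast)+
      then have "\<phi> x' \<noteq> 0" using \<nu>'(2) k'(2) by auto
      then have "x' \<in> U" using \<phi>(3) x' by (auto simp: mass_ge_def)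
      then show ?thesis using in_center[OF k'(1) x'] by blast
    qed
    ultimately show "\<exists>T. openin (OS_f_space X) T \<and> \<nu> \<in> T \<and> T \<subseteq> {\<nu> \<in> OS_f X. center X \<nu> \<inter> U \<noteq> {}}"
      using openin_OS_f_greater[OF \<phi>(1), of "1 / 2"] \<nu>
      by (intro exI[of _ "{\<nu> \<in> OS_f X. 1 / 2 < \<nu> \<phi>}"]) blast
  qed
  have inside: "openin (OS_f_space X) {\<nu> \<in> OS_f X. center X \<nu> \<subseteq> U}" if U: "openin X U" for U
  proof (subst openin_subopen, intro ballI)
    fix \<nu> assume \<nu>: "\<nu> \<in> {\<nu> \<in> OS_f X. center X \<nu> \<subseteq> U}"
    have cl: "closedin X (center X \<nu>)" by (simp add: center_def)
    obtain \<phi> where \<phi>: "\<phi> \<in> cfun X" "\<And>x. x \<in> topspace X \<Longrightarrow> 0 \<le> \<phi> x \<and> \<phi> x \<le> 1"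
      "\<And>x. x \<in> center X \<nu> \<Longrightarrow> \<phi> x = 0" "\<And>x. x \<in> topspace X - U \<Longrightarrow> \<phi> x = 1"
      by (rule Urysohn_cfun[OF cl, of "topspace X - U"]) (use U \<nu> in auto)
    obtain k where k: "k \<in> below X \<nu>" "\<nu> \<phi> = k \<phi>" using OS_f_attained[OF _ \<phi>(1)] \<nu> by blast
    obtain x where x: "mass_ge X (2 / 3) k x"
      by (rule below_main_atom[OF k(1)]) (rule that)
    have "k \<phi> \<le> 2 / 3 * \<phi> x + 1 / 3 * 1"
      by (rule mass_ge_upper[OF _ x \<phi>(1)]) (use k(1) below_prob \<phi>(2) in blast)+
    then have "\<nu> \<phi> < 1 / 2" using \<phi>(3)[OF in_center[OF k(1) x]] k(2) by simp
    moreover have "center X \<nu>' \<subseteq> U" if \<nu>': "\<nu>' \<in> OS_f X" "\<nu>' \<phi> < 1 / 2" for \<nu>'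
    proof -
      have "center X \<nu>' \<subseteq> {x \<in> topspace X. \<phi> x \<in> {..3 / 4}}"
      proof (rule center_minimal)
        show "closedin X {x \<in> topspace X. \<phi> x \<in> {..3 / 4}}"
          by (rule closedin_continuous_map_preimage[OF cfun_continuous[OF \<phi>(1)]]) simp
        fix k' x' assume k': "k' \<in> below X \<nu>'" and x': "mass_ge X (2 / 3) k' x'"
        have "2 / 3 * \<phi> x' \<le> k' \<phi>" by (rule mass_geD[OF x' \<phi>(1)]) (use \<phi>(2) in blast)
        then have "\<phi> x' \<le> 3 / 4" using belowD[OF k' \<phi>(1)] \<nu>'(2) by linarith
        then show "x' \<in> {x \<in> topspace X. \<phi> x \<in> {..3 / 4}}" using x' by (simp add: mass_ge_def)
      qed
      also have "\<dots> \<subseteq> U" using \<phi>(4) by force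
      finally show ?thesis .
    qed
    ultimately show "\<exists>T. openin (OS_f_space X) T \<and> \<nu> \<in> T \<and> T \<subseteq> {\<nu> \<in> OS_f X. center X \<nu> \<subseteq> U}"
      using openin_OS_f_less[OF \<phi>(1), of "1 / 2"] \<nu>
      by (intro exI[of _ "{\<nu> \<in> OS_f X. \<nu> \<phi> < 1 / 2}"]) blast
  qed
  show ?thesis
    unfolding exp_space_def
  proof (rule continuous_on_generated_topo)
    show "center X ` topspace (OS_f_space X) \<subseteq> \<Union>
      ((\<lambda>U. {F \<in> exp_sets X. F \<subseteq> U}) ` {U. openin X U} \<union>
       (\<lambda>U. {F \<in> exp_sets X. F \<inter> U \<noteq> {}}) ` {U. openin X U})"
      using center_in_exp_sets topspace_exp_space[of X, unfolded exp_space_def topology_generated_by_topspace]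
      unfolding topspace_OS_f_space by (metis (no_types, lifting) image_subsetI)
    fix \<U> assume "\<U> \<in> (\<lambda>U. {F \<in> exp_sets X. F \<subseteq> U}) ` {U. openin X U} \<union>
       (\<lambda>U. {F \<in> exp_sets X. F \<inter> U \<noteq> {}}) ` {U. openin X U}"
    then consider U where "openin X U" "\<U> = {F \<in> exp_sets X. F \<subseteq> U}"
      | U where "openin X U" "\<U> = {F \<in> exp_sets X. F \<inter> U \<noteq> {}}" by blast
    then show "openin (OS_f_space X) (center X -` \<U> \<inter> topspace (OS_f_space X))"
    proof cases
      case 1
      have "center X -` \<U> \<inter> topspace (OS_f_space X) = {\<nu> \<in> OS_f X. center X \<nu> \<subseteq> U}"
        using center_in_exp_sets unfolding topspace_OS_f_space 1(2) by blast
      then show ?thesis using inside[OF 1(1)] by simp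
    next
      case 2
      have "center X -` \<U> \<inter> topspace (OS_f_space X) = {\<nu> \<in> OS_f X. center X \<nu> \<inter> U \<noteq> {}}"
        using center_in_exp_sets unfolding topspace_OS_f_space 2(2) by blast
      then show ?thesis using hit[OF 2(1)] by simp
    qed
  qed
qed

lemma exp_sets_attains:
  assumes "F \<in> exp_sets X" "\<phi> \<in> cfun X"
  obtains y where "y \<in> F" "\<And>x. x \<in> F \<Longrightarrow> \<phi> x \<le> \<phi> y" "Sup (\<phi> ` F) = \<phi> y"
proof -
  have "compactin X F" using assms(1) closedin_compact_space[OF compact] by (simp add: exp_sets_def)
  then have "compact (\<phi> ` F)" "\<phi> ` F \<noteq> {}"
    using image_compactin[OF _ cfun_continuous[OF assms(2)]] assms(1) by (auto simp: exp_sets_def)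
  then obtain y where y: "y \<in> F" "\<And>x. x \<in> F \<Longrightarrow> \<phi> x \<le> \<phi> y"
    using compact_attains_sup[of "\<phi> ` F"] by auto
  then have "Sup (\<phi> ` F) = \<phi> y" by (intro cSup_eq_maximum) auto
  with y show thesis by (rule that)
qed

lemma exp_sets_subset: "F \<in> exp_sets X \<Longrightarrow> F \<subseteq> topspace X"
  using closedin_subset by (auto simp: exp_sets_def)

lemma topspace_in_exp_sets: "F \<in> exp_sets X \<Longrightarrow> topspace X \<in> exp_sets X"
  using exp_sets_subset by (auto simp: exp_sets_def)

lemma continuous_Sup_exp:
  assumes \<phi>: "\<phi> \<in> cfun X"
  shows "continuous_map (exp_space X) euclideanreal (\<lambda>F. Sup (\<phi> ` F))"
  unfolding continuous_map_upper_lower_semicontinuous_lt topspace_exp_space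
proof (intro conjI allI)
  fix a
  have o: "openin X {x \<in> topspace X. \<phi> x \<in> {a<..}}" "openin X {x \<in> topspace X. \<phi> x \<in> {..<a}}"
    by (rule openin_continuous_map_preimage[OF cfun_continuous[OF \<phi>]], simp)+
  have "a < Sup (\<phi> ` F) \<longleftrightarrow> F \<inter> {x \<in> topspace X. \<phi> x \<in> {a<..}} \<noteq> {}" if F: "F \<in> exp_sets X" for F
    by (rule exp_sets_attains[OF F \<phi>]) (use exp_sets_subset[OF F] in \<open>auto intro: less_le_trans\<close>)
  then have "{F \<in> exp_sets X. a < Sup (\<phi> ` F)} = {F \<in> exp_sets X. F \<inter> {x \<in> topspace X. \<phi> x \<in> {a<..}} \<noteq> {}}"
    by blast
  then show "openin (exp_space X) {F \<in> exp_sets X. a < Sup (\<phi> ` F)}"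
    using openin_exp_hit[OF o(1)] by simp
  have "Sup (\<phi> ` F) < a \<longleftrightarrow> F \<subseteq> {x \<in> topspace X. \<phi> x \<in> {..<a}}" if F: "F \<in> exp_sets X" for F
    by (rule exp_sets_attains[OF F \<phi>]) (use exp_sets_subset[OF F] in \<open>auto intro: le_less_trans\<close>)
  then have "{F \<in> exp_sets X. Sup (\<phi> ` F) < a} = {F \<in> exp_sets X. F \<subseteq> {x \<in> topspace X. \<phi> x \<in> {..<a}}}"
    by blast
  then show "openin (exp_space X) {F \<in> exp_sets X. Sup (\<phi> ` F) < a}"
    using openin_exp_contained[OF o(2)] by simp
qed

lemma spread_gens:
  assumes F: "F \<in> exp_sets X" and t: "0 \<le> t" "t \<le> 1"
  shows "{mix X (t / 3) (dirac X y) (dirac X z) | y z. y \<in> F \<and> z \<in> topspace X} \<subseteq> P_f X" (is "?K \<subseteq> _")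
    "{mix X (t / 3) (dirac X y) (dirac X z) | y z. y \<in> F \<and> z \<in> topspace X} \<noteq> {}"
proof -
  show "?K \<subseteq> P_f X" using mix_dirac_in_P_f[of _ X _ "t / 3"] exp_sets_subset[OF F] t by auto
  show "?K \<noteq> {}" using F exp_sets_subset[OF F] by (auto simp: exp_sets_def)
qed

lemma spread_in_OS_f: "\<lbrakk>F \<in> exp_sets X; 0 \<le> t; t \<le> 1\<rbrakk> \<Longrightarrow> spread X t F \<in> OS_f X"
  unfolding spread_def by (rule nu_in_OS_f[OF spread_gens])

lemma spread_apply:
  assumes F: "F \<in> exp_sets X" and t: "0 \<le> t" "t \<le> 1" and \<phi>: "\<phi> \<in> cfun X"
  shows "spread X t F \<phi> = (1 - t / 3) * Sup (\<phi> ` F) + t / 3 * Sup (\<phi> ` topspace X)"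
proof -
  obtain y where y: "y \<in> F" "\<And>x. x \<in> F \<Longrightarrow> \<phi> x \<le> \<phi> y" "Sup (\<phi> ` F) = \<phi> y"
    by (rule exp_sets_attains[OF F \<phi>]) (rule that)
  obtain z where z: "z \<in> topspace X" "\<And>x. x \<in> topspace X \<Longrightarrow> \<phi> x \<le> \<phi> z" "Sup (\<phi> ` topspace X) = \<phi> z"
    by (rule exp_sets_attains[OF topspace_in_exp_sets[OF F] \<phi>]) (rule that)
  note K = spread_gens[OF F t]
  have "spread X t F \<phi> \<le> (1 - t / 3) * \<phi> y + t / 3 * \<phi> z"
    unfolding spread_def
  proof (rule nu_least[OF K(2) \<phi>])
    fix k assume "k \<in> {mix X (t / 3) (dirac X y) (dirac X z) | y z. y \<in> F \<and> z \<in> topspace X}"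
    then obtain y' z' where "k = mix X (t / 3) (dirac X y') (dirac X z')" "y' \<in> F" "z' \<in> topspace X"
      by blast
    then show "k \<phi> \<le> (1 - t / 3) * \<phi> y + t / 3 * \<phi> z"
      using y(2) z(2) t by (auto simp: mix_apply[OF \<phi>] dirac_apply[OF \<phi>] intro!: add_mono mult_left_mono divide_right_mono)
  qed
  moreover have "mix X (t / 3) (dirac X y) (dirac X z) \<phi> \<le> spread X t F \<phi>"
    unfolding spread_def
    by (rule nu_upper[OF order_trans[OF K(1) P_f_subset_prob] \<phi>]) (use y(1) z(1) in blast)
  ultimately show ?thesis
    unfolding y(3) z(3) by (simp add: mix_apply[OF \<phi>] dirac_apply[OF \<phi>])
qed

lemma center_spread_0:
  assumes F: "F \<in> exp_sets X"
  shows "center X (spread X 0 F) = F"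
proof
  have cl: "closedin X F" using F by (simp add: exp_sets_def)
  have t: "(0::real) \<le> 0" "(0::real) \<le> 1" by auto
  note K = spread_gens[OF F t]
  show "center X (spread X 0 F) \<subseteq> F"
  proof (rule center_minimal[OF cl])
    fix k x assume k: "k \<in> below X (spread X 0 F)" and x: "mass_ge X (2 / 3) k x"
    show "x \<in> F"
    proof (rule ccontr)
      assume "x \<notin> F"
      have "x \<in> topspace X" using x by (simp add: mass_ge_def)
      then obtain \<phi> where \<phi>: "\<phi> \<in> cfun X" "\<And>x. x \<in> topspace X \<Longrightarrow> 0 \<le> \<phi> x \<and> \<phi> x \<le> 1"
        "\<And>x. x \<in> F \<Longrightarrow> \<phi> x = 0" "\<phi> x = 1"
        by (rule Urysohn_point[OF cl _ \<open>x \<notin> F\<close>]) (rule that)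
      have "2 / 3 * \<phi> x \<le> k \<phi>" by (rule mass_geD[OF x \<phi>(1)]) (use \<phi>(2) in blast)
      also have "\<dots> \<le> spread X 0 F \<phi>" by (rule belowD[OF k \<phi>(1)])
      also have "\<dots> = Sup (\<phi> ` F)" using spread_apply[OF F t \<phi>(1)] by simp
      also have "\<dots> = 0" by (rule exp_sets_attains[OF F \<phi>(1)]) (use \<phi>(3) in simp)
      finally show False using \<phi>(4) by simp
    qed
  qed
  show "F \<subseteq> center X (spread X 0 F)"
  proof
    fix x assume x: "x \<in> F"
    then have xt: "x \<in> topspace X" using exp_sets_subset[OF F] by blast
    have "dirac X x = mix X (0 / 3) (dirac X x) (dirac X x)"
      by (auto simp: mix_def dirac_def)
    then have d: "dirac X x \<in> {mix X (0 / 3) (dirac X y) (dirac X z) | y z. y \<in> F \<and> z \<in> topspace X}"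
      using x xt by blast
    have "dirac X x \<in> below X (spread X 0 F)"
      unfolding below_def spread_def
      using dirac_in_P_f[OF xt] nu_upper[OF order_trans[OF K(1) P_f_subset_prob] _ d] by blast
    moreover have "mass_ge X (2 / 3) (dirac X x) x"
      using xt by (simp add: mass_ge_def dirac_apply)
    ultimately show "x \<in> center X (spread X 0 F)" by (rule in_center)
  qed
qed

lemma continuous_spread:
  "continuous_map (prod_topology (top_of_set {0..1}) (exp_space X)) (fspace X) (\<lambda>p. spread X (fst p) (snd p))"
  unfolding continuous_map_into_fspace
proof (intro conjI ballI)
  let ?Z = "prod_topology (top_of_set {0..1::real}) (exp_space X)"
  fix \<phi> assume \<phi>: "\<phi> \<in> cfun X"
  have 1: "continuous_map ?Z euclideanreal (\<lambda>p. Sup (\<phi> ` snd p))"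
    using continuous_map_compose[OF continuous_map_snd continuous_Sup_exp[OF \<phi>]] by (simp add: o_def)
  have 2: "continuous_map ?Z euclideanreal fst"
    using continuous_map_fst continuous_map_in_subtopology by blast
  have "continuous_map ?Z euclideanreal
      (\<lambda>p. (1 - fst p / 3) * Sup (\<phi> ` snd p) + fst p / 3 * Sup (\<phi> ` topspace X))"
    by (intro continuous_map_add continuous_map_real_mult continuous_map_diff continuous_map_real_divide
        continuous_map_canonical_const 1 2) auto
  then show "continuous_map ?Z euclideanreal (\<lambda>p. spread X (fst p) (snd p) \<phi>)"
    by (rule continuous_map_eq) (auto simp: topspace_exp_space spread_apply[OF _ _ _ \<phi>])
qed (auto simp: spread_def nu_def)

end

section \<open>Enlarging functionals at finitely many points\<close>

lemma continuous_map_Lipschitz_parameter: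
  fixes h :: "real \<Rightarrow> 'b \<Rightarrow> real"
  assumes cont: "\<And>s. s \<in> S \<Longrightarrow> continuous_map Y euclideanreal (h s)"
    and lip: "\<And>s s' y. \<lbrakk>s \<in> S; s' \<in> S; y \<in> topspace Y\<rbrakk> \<Longrightarrow> \<bar>h s y - h s' y\<bar> \<le> L * \<bar>s - s'\<bar>"
    and L: "L > 0"
  shows "continuous_map (prod_topology (top_of_set S) Y) euclideanreal (\<lambda>p. h (fst p) (snd p))"
proof -
  let ?Z = "prod_topology (top_of_set S) Y"
  have gt: "openin ?Z {p \<in> topspace ?Z. a < h (fst p) (snd p)}"
    if cont: "\<And>s. s \<in> S \<Longrightarrow> continuous_map Y euclideanreal (h s)"
      and lip: "\<And>s s' y. \<lbrakk>s \<in> S; s' \<in> S; y \<in> topspace Y\<rbrakk> \<Longrightarrow> \<bar>h s y - h s' y\<bar> \<le> L * \<bar>s - s'\<bar>"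
    for a and h :: "real \<Rightarrow> 'b \<Rightarrow> real"
    unfolding openin_prod_topology_alt
  proof (intro allI impI)
    fix s y assume "(s, y) \<in> {p \<in> topspace ?Z. a < h (fst p) (snd p)}"
    then have s: "s \<in> S" and y: "y \<in> topspace Y" and a: "a < h s y" by auto
    define d where "d = (h s y - a) / 2"
    have d: "d > 0" using a by (simp add: d_def)
    let ?U = "S \<inter> ball s (d / L)" and ?V = "{y \<in> topspace Y. h s y \<in> {a + d<..}}"
    have "a < h s' y'" if s': "s' \<in> ?U" and y': "y' \<in> ?V" for s' y'
    proof -
      have "L * \<bar>s - s'\<bar> < d" using s' L by (simp add: dist_real_def field_simps)
      moreover have "\<bar>h s y' - h s' y'\<bar> \<le> L * \<bar>s - s'\<bar>" using lip[of s s' y'] s s' y' by auto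
      moreover have "a + d < h s y'" using y' by simp
      ultimately show ?thesis by linarith
    qed
    then have "?U \<times> ?V \<subseteq> {p \<in> topspace ?Z. a < h (fst p) (snd p)}" by auto
    moreover have "openin (top_of_set S) ?U" by (simp add: openin_open_Int)
    moreover have "openin Y ?V" by (rule openin_continuous_map_preimage[OF cont[OF s]]) simp
    moreover have "s \<in> ?U" "y \<in> ?V" using s y d L a by (auto simp: d_def field_simps)
    ultimately show "\<exists>U V. openin (top_of_set S) U \<and> openin Y V \<and> s \<in> U \<and> y \<in> V \<and>
        U \<times> V \<subseteq> {p \<in> topspace ?Z. a < h (fst p) (snd p)}" by blast
  qed
  have "openin ?Z {p \<in> topspace ?Z. h (fst p) (snd p) < a}" for a
  proof -
    have "openin ?Z {p \<in> topspace ?Z. - a < - h (fst p) (snd p)}"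
    proof (rule gt)
      show "continuous_map Y euclideanreal (\<lambda>y. - h s y)" if "s \<in> S" for s
        by (intro continuous_map_minus cont that)
      show "\<bar>- h s y - - h s' y\<bar> \<le> L * \<bar>s - s'\<bar>" if "s \<in> S" "s' \<in> S" "y \<in> topspace Y" for s s' y
        using lip[OF that] by (simp add: abs_minus_commute)
    qed
    then show ?thesis by simp
  qed
  moreover have "openin ?Z {p \<in> topspace ?Z. a < h (fst p) (snd p)}" for a
    by (rule gt[OF cont lip])
  ultimately show ?thesis
    unfolding continuous_map_upper_lower_semicontinuous_lt by blast
qed

text \<open>  The threshold lies between \<open>1/3\<close>, the largest mass outside the main atom, and \<open>2/3\<close>, so that a
  positive excess over the bump \<open>\<psi>\<close> places the main atom inside the bump.\<close>

definition excess :: "'a functional \<Rightarrow> ('a \<Rightarrow> real) \<Rightarrow> real" where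
  "excess k \<psi> = max 0 (k \<psi> - 1 / 2)"

text \<open>  The weight of \<open>\<delta>\<^sub>y\<close> after normalizing the measure \<open>k + t (excess k \<psi>) \<delta>\<^sub>y\<close>.\<close>

definition share :: "real \<Rightarrow> 'a functional \<Rightarrow> ('a \<Rightarrow> real) \<Rightarrow> real" where
  "share t k \<psi> = t * excess k \<psi> / (1 + t * excess k \<psi>)"

lemma excess_nonneg: "0 \<le> excess k \<psi>"
  by (simp add: excess_def)

lemma share_bounds:
  assumes "0 \<le> t"
  shows "0 \<le> share t k \<psi> \<and> share t k \<psi> < 1"
proof -
  have "0 \<le> t * excess k \<psi>" using assms excess_nonneg[of k \<psi>] by simp
  then show ?thesis by (simp add: share_def)
qed

lemma share_mix:
  assumes "0 \<le> t"
  shows "(1 + t * excess k \<psi>) * ((1 - share t k \<psi>) * a + share t k \<psi> * b) = a + t * excess k \<psi> * b"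
proof -
  define o' where "o' = t * excess k \<psi>"
  have "1 + o' > 0" using assms excess_nonneg[of k \<psi>] by (simp add: o'_def add_pos_nonneg)
  then have "share t k \<psi> * (1 + o') = o'" by (simp add: share_def o'_def)
  moreover have "(1 + o') * ((1 - share t k \<psi>) * a + share t k \<psi> * b)
      = (1 + o') * a - (share t k \<psi> * (1 + o')) * a + (share t k \<psi> * (1 + o')) * b"
    by (simp add: algebra_simps)
  ultimately have "(1 + o') * ((1 - share t k \<psi>) * a + share t k \<psi> * b) = (1 + o') * a - o' * a + o' * b"
    by simp
  then show ?thesis unfolding o'_def by (simp add: algebra_simps)
qed

definition grow_gens :: "'a topology \<Rightarrow> 'a set \<Rightarrow> ('a \<Rightarrow> 'a \<Rightarrow> real) \<Rightarrow> real \<Rightarrow> 'a functional \<Rightarrow> 'a functional set" where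
  "grow_gens X Y \<psi> t \<nu> = below X \<nu> \<union>
     {mix X (share t k (\<psi> y)) k (dirac X y) | k y. k \<in> below X \<nu> \<and> y \<in> Y}"

definition grow :: "'a topology \<Rightarrow> 'a set \<Rightarrow> ('a \<Rightarrow> 'a \<Rightarrow> real) \<Rightarrow> real \<Rightarrow> 'a functional \<Rightarrow> 'a functional" where
  "grow X Y \<psi> t \<nu> = nu X (grow_gens X Y \<psi> t \<nu>)"

text \<open>  The bumps \<open>\<psi> y\<close> are not tied to the points \<open>y\<close> here; the closeness needed for the homotopy is added
  in \<open>fine_net\<close>.\<close>

locale net = compact_Hausdorff +
  fixes Y :: "'a set" and \<psi> :: "'a \<Rightarrow> 'a \<Rightarrow> real"
  assumes finite_net: "finite Y" and net_subset: "Y \<subseteq> topspace X"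
    and bump: "\<And>y. y \<in> Y \<Longrightarrow> \<psi> y \<in> cfun X"
    and bump_range: "\<And>x y. \<lbrakk>y \<in> Y; x \<in> topspace X\<rbrakk> \<Longrightarrow> 0 \<le> \<psi> y x \<and> \<psi> y x \<le> 1"
begin

lemma grow_gens_prob:
  assumes "0 \<le> t"
  shows "grow_gens X Y \<psi> t \<nu> \<subseteq> prob_functionals X"
  using below_prob[of \<nu>] share_bounds[OF assms] net_subset
  by (auto simp: grow_gens_def less_imp_le intro!: mix_prob dirac_prob)

lemma grow_gens_nonempty: "\<nu> \<in> OS_f X \<Longrightarrow> grow_gens X Y \<psi> t \<nu> \<noteq> {}"
  using OS_f_below(1) by (auto simp: grow_gens_def)

lemma mix_share_apply:
  assumes "\<phi> \<in> cfun X" "0 \<le> t"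
  shows "0 < 1 + t * excess k (\<psi> y)"
    "(1 + t * excess k (\<psi> y)) * mix X (share t k (\<psi> y)) k (dirac X y) \<phi>
      = k \<phi> + t * excess k (\<psi> y) * \<phi> y"
  using share_mix[OF assms(2), of k "\<psi> y" "k \<phi>" "\<phi> y"] mult_nonneg_nonneg[OF assms(2) excess_nonneg[of k "\<psi> y"]]
  by (simp_all add: mix_apply[OF assms(1)] dirac_apply[OF assms(1)])

text \<open>  The function \<open>\<phi> + a (\<psi> y - 1/2)\<close>, written by nested affine combinations so that linearity applies
  to it directly.\<close>

definition probe :: "('a \<Rightarrow> real) \<Rightarrow> 'a \<Rightarrow> real \<Rightarrow> 'a \<Rightarrow> real" where
  "probe \<phi> y a = (\<lambda>x\<in>topspace X. 1 * (\<lambda>x\<in>topspace X. 1 * \<phi> x + a * \<psi> y x) x + (- a / 2))"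

lemma probe_cfun: "\<lbrakk>\<phi> \<in> cfun X; y \<in> Y\<rbrakk> \<Longrightarrow> probe \<phi> y a \<in> cfun X"
  unfolding probe_def by (intro affine_cfun lincomb_cfun bump)

lemma prob_probe:
  assumes "k \<in> prob_functionals X" "\<phi> \<in> cfun X" "y \<in> Y"
  shows "k (probe \<phi> y a) = k \<phi> + a * (k (\<psi> y) - 1 / 2)"
  unfolding probe_def prob_affine[OF assms(1) lincomb_cfun[OF assms(2) bump[OF assms(3)]]]
    prob_lincomb[OF assms(1,2) bump[OF assms(3)]] by (simp add: algebra_simps)

lemma prob_bump_le_1: "\<lbrakk>k \<in> prob_functionals X; y \<in> Y\<rbrakk> \<Longrightarrow> k (\<psi> y) \<le> 1"
  using prob_le_const[OF _ bump] bump_range by blast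

lemma prob_bump_nonneg: "\<lbrakk>k \<in> prob_functionals X; y \<in> Y\<rbrakk> \<Longrightarrow> 0 \<le> k (\<psi> y)"
  using prob_ge_const[OF _ bump] bump_range by blast

text \<open>  With \<open>o = excess k (\<psi> y)\<close>, the normalized measure \<open>k + t o \<delta>\<^sub>y\<close> takes a value above \<open>c\<close> at \<open>\<phi>\<close> if
  and only if \<open>k \<phi> + t o (\<phi> y - c) > c\<close>.  Where it exceeds \<open>k \<phi>\<close>, the left-hand side is the value of
  \<open>k\<close> at a single probe function, since the excess is affine in \<open>k\<close> wherever it is positive.  So the
  supremum over all \<open>k\<close> is expressed by values of \<open>\<nu>\<close>.\<close>

lemma less_grow_iff:
  assumes \<nu>: "\<nu> \<in> OS_f X" and \<phi>: "\<phi> \<in> cfun X" and t: "0 \<le> t"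
  shows "c < grow X Y \<psi> t \<nu> \<phi> \<longleftrightarrow> c < \<nu> \<phi> \<or> (\<exists>y\<in>Y. c < \<nu> (probe \<phi> y (t * max 0 (\<phi> y - c))))"
proof
  assume "c < grow X Y \<psi> t \<nu> \<phi>"
  then obtain g where g: "g \<in> grow_gens X Y \<psi> t \<nu>" "c < g \<phi>"
    unfolding grow_def less_nu_iff[OF grow_gens_prob[OF t] grow_gens_nonempty[OF \<nu>] \<phi>] by blast
  from g(1) consider "g \<in> below X \<nu>"
    | k y where "k \<in> below X \<nu>" "y \<in> Y" "g = mix X (share t k (\<psi> y)) k (dirac X y)"
    unfolding grow_gens_def by blast
  then show "c < \<nu> \<phi> \<or> (\<exists>y\<in>Y. c < \<nu> (probe \<phi> y (t * max 0 (\<phi> y - c))))"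
  proof cases
    case 1
    then show ?thesis using g(2) belowD[OF 1 \<phi>] by simp
  next
    case (2 k y)
    define e where "e = excess k (\<psi> y)"
    have e: "0 \<le> e" "e = 0 \<or> e = k (\<psi> y) - 1 / 2" by (auto simp: e_def excess_def)
    have kp: "k \<in> prob_functionals X" using 2(1) below_prob by blast
    have "(1 + t * e) * c < (1 + t * e) * g \<phi>"
      unfolding e_def by (rule mult_strict_left_mono[OF g(2) mix_share_apply(1)[OF \<phi> t]])
    also have "\<dots> = k \<phi> + t * e * \<phi> y"
      unfolding 2(3) e_def by (rule mix_share_apply(2)[OF \<phi> t])
    finally have *: "c < k \<phi> + t * e * (\<phi> y - c)" by (simp add: algebra_simps)
    show ?thesis
    proof (cases "e = 0 \<or> \<phi> y \<le> c")
      case True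
      then have "t * e * (\<phi> y - c) \<le> 0" using t e(1) by (auto intro: mult_nonneg_nonpos)
      then have "c < k \<phi>" using * by linarith
      then show ?thesis using belowD[OF 2(1) \<phi>] by simp
    next
      case False
      then have "k (probe \<phi> y (t * max 0 (\<phi> y - c))) = k \<phi> + t * e * (\<phi> y - c)"
        using prob_probe[OF kp \<phi> 2(2)] e(2) by simp
      then have "c < \<nu> (probe \<phi> y (t * max 0 (\<phi> y - c)))"
        using * belowD[OF 2(1) probe_cfun[OF \<phi> 2(2)], of "t * max 0 (\<phi> y - c)"] by simp
      then show ?thesis using 2(2) by blast
    qed
  qed
next
  have K: "c < grow X Y \<psi> t \<nu> \<phi>" if "g \<in> grow_gens X Y \<psi> t \<nu>" "c < g \<phi>" for g
    unfolding grow_def using nu_upper[OF grow_gens_prob[OF t] \<phi> that(1)] that(2) by linarith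
  assume "c < \<nu> \<phi> \<or> (\<exists>y\<in>Y. c < \<nu> (probe \<phi> y (t * max 0 (\<phi> y - c))))"
  then show "c < grow X Y \<psi> t \<nu> \<phi>"
  proof
    assume c: "c < \<nu> \<phi>"
    obtain k where "k \<in> below X \<nu>" "\<nu> \<phi> = k \<phi>" by (rule OS_f_attained[OF \<nu> \<phi>])
    then show ?thesis using K[of k] c by (simp add: grow_gens_def)
  next
    assume "\<exists>y\<in>Y. c < \<nu> (probe \<phi> y (t * max 0 (\<phi> y - c)))"
    then obtain y where y: "y \<in> Y" and c: "c < \<nu> (probe \<phi> y (t * max 0 (\<phi> y - c)))" by blast
    obtain k where k: "k \<in> below X \<nu>"
      and k_eq: "\<nu> (probe \<phi> y (t * max 0 (\<phi> y - c))) = k (probe \<phi> y (t * max 0 (\<phi> y - c)))"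
      by (rule OS_f_attained[OF \<nu> probe_cfun[OF \<phi> y]])
    have kp: "k \<in> prob_functionals X" using k below_prob by blast
    define e where "e = excess k (\<psi> y)"
    have e: "0 \<le> e" "k (\<psi> y) - 1 / 2 \<le> e" by (auto simp: e_def excess_def)
    let ?a = "t * max 0 (\<phi> y - c)"
    have "?a * (k (\<psi> y) - 1 / 2) \<le> ?a * e" using t by (intro mult_left_mono e) auto
    then have *: "c < k \<phi> + ?a * e" using c unfolding k_eq prob_probe[OF kp \<phi> y] by linarith
    show ?thesis
    proof (cases "\<phi> y \<le> c")
      case True
      then have "c < k \<phi>" using * by simp
      then show ?thesis using K[of k] k by (simp add: grow_gens_def)
    next
      case False
      let ?g = "mix X (share t k (\<psi> y)) k (dirac X y)"
      have "(1 + t * e) * ?g \<phi> = k \<phi> + t * e * \<phi> y"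
        unfolding e_def by (rule mix_share_apply(2)[OF \<phi> t])
      moreover have "(1 + t * e) * c < k \<phi> + t * e * \<phi> y"
        using * False by (simp add: algebra_simps)
      moreover have "0 < 1 + t * e" unfolding e_def by (rule mix_share_apply(1)[OF \<phi> t])
      ultimately have "c < ?g \<phi>" by (metis mult_less_cancel_left_pos)
      moreover have "?g \<in> grow_gens X Y \<psi> t \<nu>" using k y unfolding grow_gens_def by blast
      ultimately show ?thesis by (rule K[rotated])
    qed
  qed
qed

text \<open>  The strict inequality on the left needs a uniform gap for all generating measures.  It comes from
  the finite net and from the bound \<open>1 + t\<close> for the normalizing factor.\<close>

lemma grow_less_iff:
  assumes \<nu>: "\<nu> \<in> OS_f X" and \<phi>: "\<phi> \<in> cfun X" and t: "0 \<le> t"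
  shows "grow X Y \<psi> t \<nu> \<phi> < c \<longleftrightarrow> \<nu> \<phi> < c \<and> (\<forall>y\<in>Y. \<nu> (probe \<phi> y (t * max 0 (\<phi> y - c))) < c)"
proof
  define G where "G = grow X Y \<psi> t \<nu> \<phi>"
  have up: "g \<phi> \<le> G" if "g \<in> grow_gens X Y \<psi> t \<nu>" for g
    unfolding G_def grow_def by (rule nu_upper[OF grow_gens_prob[OF t] \<phi> that])
  have upk: "k \<phi> \<le> G" if "k \<in> below X \<nu>" for k
    using up that by (simp add: grow_gens_def)
  assume "grow X Y \<psi> t \<nu> \<phi> < c"
  then have G: "G < c" by (simp add: G_def)
  have "\<nu> \<phi> < c"
    by (rule OS_f_attained[OF \<nu> \<phi>]) (use upk G in force)
  moreover have "\<nu> (probe \<phi> y (t * max 0 (\<phi> y - c))) < c" if y: "y \<in> Y" for y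
  proof -
    let ?a = "t * max 0 (\<phi> y - c)"
    obtain k where k: "k \<in> below X \<nu>" and k_eq: "\<nu> (probe \<phi> y ?a) = k (probe \<phi> y ?a)"
      by (rule OS_f_attained[OF \<nu> probe_cfun[OF \<phi> y]])
    have kp: "k \<in> prob_functionals X" using k below_prob by blast
    define e where "e = excess k (\<psi> y)"
    have e: "0 \<le> e" "k (\<psi> y) - 1 / 2 \<le> e" by (auto simp: e_def excess_def)
    have "?a * (k (\<psi> y) - 1 / 2) \<le> ?a * e" using t by (intro mult_left_mono e) auto
    then have *: "\<nu> (probe \<phi> y ?a) \<le> k \<phi> + ?a * e" unfolding k_eq prob_probe[OF kp \<phi> y] by linarith
    show ?thesis
    proof (cases "\<phi> y \<le> c")
      case True
      then show ?thesis using * upk[OF k] G by simp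
    next
      case False
      let ?g = "mix X (share t k (\<psi> y)) k (dirac X y)"
      have "(1 + t * e) * ?g \<phi> = k \<phi> + t * e * \<phi> y"
        unfolding e_def by (rule mix_share_apply(2)[OF \<phi> t])
      moreover have "?g \<phi> \<le> G" using up[of ?g] k y unfolding grow_gens_def by blast
      moreover have "0 < 1 + t * e" unfolding e_def by (rule mix_share_apply(1)[OF \<phi> t])
      ultimately have "k \<phi> + t * e * \<phi> y \<le> (1 + t * e) * G" by (metis mult_left_mono less_imp_le)
      moreover have "t * e * G \<le> t * e * c" using t e(1) G by (intro mult_left_mono) auto
      ultimately have "k \<phi> + t * e * (\<phi> y - c) \<le> G" by (simp add: algebra_simps)
      then show ?thesis using * False G by (simp add: algebra_simps)
    qed
  qed
  ultimately show "\<nu> \<phi> < c \<and> (\<forall>y\<in>Y. \<nu> (probe \<phi> y (t * max 0 (\<phi> y - c))) < c)" by blast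
next
  assume less: "\<nu> \<phi> < c \<and> (\<forall>y\<in>Y. \<nu> (probe \<phi> y (t * max 0 (\<phi> y - c))) < c)"
  define m where "m = Max (insert (\<nu> \<phi>) ((\<lambda>y. \<nu> (probe \<phi> y (t * max 0 (\<phi> y - c)))) ` Y))"
  have m: "\<nu> \<phi> \<le> m" "\<And>y. y \<in> Y \<Longrightarrow> \<nu> (probe \<phi> y (t * max 0 (\<phi> y - c))) \<le> m"
    unfolding m_def using finite_net by auto
  have mc: "m < c" unfolding m_def using finite_net less by auto
  \<comment> \<open>The gap \<open>c - m\<close> shrinks at most by the normalizing factor.\<close>
  have "grow X Y \<psi> t \<nu> \<phi> \<le> c - (c - m) / (1 + t)"
    unfolding grow_def
  proof (rule nu_least[OF grow_gens_nonempty[OF \<nu>] \<phi>])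
    have cm: "(c - m) / (1 + t) \<le> c - m" 
      using mc t divide_left_mono[of 1 "1 + t" "c - m"] by simp
    fix g assume "g \<in> grow_gens X Y \<psi> t \<nu>"
    then consider "g \<in> below X \<nu>"
      | k y where "k \<in> below X \<nu>" "y \<in> Y" "g = mix X (share t k (\<psi> y)) k (dirac X y)"
      unfolding grow_gens_def by blast
    then show "g \<phi> \<le> c - (c - m) / (1 + t)"
    proof cases
      case 1
      then show ?thesis using belowD[OF 1 \<phi>] m(1) cm by linarith
    next
      case (2 k y)
      define e where "e = excess k (\<psi> y)"
      have kp: "k \<in> prob_functionals X" using 2(1) below_prob by blast
      have e: "0 \<le> e" "e = 0 \<or> e = k (\<psi> y) - 1 / 2" "e \<le> 1"
        using prob_bump_le_1[OF kp 2(2)] by (auto simp: e_def excess_def)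
      let ?a = "t * max 0 (\<phi> y - c)"
      have "k \<phi> + ?a * e \<le> m"
        using e(2)
      proof
        assume "e = 0"
        then show ?thesis using belowD[OF 2(1) \<phi>] m(1) by simp
      next
        assume "e = k (\<psi> y) - 1 / 2"
        then show ?thesis
          using belowD[OF 2(1) probe_cfun[OF \<phi> 2(2)], of ?a] m(2)[OF 2(2)]
          unfolding prob_probe[OF kp \<phi> 2(2)] by simp
      qed
      moreover have "t * e * (\<phi> y - c) \<le> t * e * max 0 (\<phi> y - c)"
        using t e(1) by (intro mult_left_mono) auto
      then have "t * e * (\<phi> y - c) \<le> ?a * e" by (simp only: mult_ac)
      ultimately have 1: "k \<phi> + t * e * \<phi> y \<le> (1 + t * e) * c - (c - m)" by (simp add: algebra_simps)
      have pos: "0 < 1 + t * e" unfolding e_def by (rule mix_share_apply(1)[OF \<phi> t])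
      have "(1 + t * e) * g \<phi> = k \<phi> + t * e * \<phi> y"
        unfolding 2(3) e_def by (rule mix_share_apply(2)[OF \<phi> t])
      with 1 have "g \<phi> \<le> ((1 + t * e) * c - (c - m)) / (1 + t * e)"
        using pos by (metis le_divide_eq mult.commute)
      also have "\<dots> = c - (c - m) / (1 + t * e)" using pos by (simp add: diff_divide_distrib)
      also have "\<dots> \<le> c - (c - m) / (1 + t)"
      proof -
        have "t * e \<le> t * 1" using t e(3) by (intro mult_left_mono)
        then show ?thesis using mc pos by (auto intro!: divide_left_mono mult_pos_pos)
      qed
      finally show ?thesis .
    qed
  qed
  also have "\<dots> < c" using mc t by simp
  finally show "grow X Y \<psi> t \<nu> \<phi> < c" .
qed

lemma OS_f_probe_Lipschitz:
  assumes \<nu>: "\<nu> \<in> OS_f X" and \<phi>: "\<phi> \<in> cfun X" and y: "y \<in> Y"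
  shows "\<bar>\<nu> (probe \<phi> y a) - \<nu> (probe \<phi> y b)\<bar> \<le> \<bar>a - b\<bar>"
proof -
  have "\<nu> (probe \<phi> y a) \<le> \<nu> (probe \<phi> y b) + \<bar>a - b\<bar>" for a b
  proof -
    obtain k where k: "k \<in> below X \<nu>" "\<nu> (probe \<phi> y a) = k (probe \<phi> y a)"
      by (rule OS_f_attained[OF \<nu> probe_cfun[OF \<phi> y]])
    have kp: "k \<in> prob_functionals X" using k below_prob by blast
    have "\<bar>k (\<psi> y) - 1 / 2\<bar> \<le> 1"
      using prob_bump_le_1[OF kp y] prob_bump_nonneg[OF kp y] by (simp add: abs_le_iff)
    then have "\<bar>(a - b) * (k (\<psi> y) - 1 / 2)\<bar> \<le> \<bar>a - b\<bar>"
      unfolding abs_mult by (rule mult_left_le) simp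
    moreover have "a * (k (\<psi> y) - 1 / 2) = b * (k (\<psi> y) - 1 / 2) + (a - b) * (k (\<psi> y) - 1 / 2)"
      by (simp add: left_diff_distrib)
    ultimately have "k (probe \<phi> y a) \<le> k (probe \<phi> y b) + \<bar>a - b\<bar>"
      unfolding prob_probe[OF kp \<phi> y] by linarith
    then show ?thesis using k(2) belowD[OF k(1) probe_cfun[OF \<phi> y], of b] by linarith
  qed
  from this[of a b] this[of b a] show ?thesis by (simp add: abs_le_iff abs_minus_commute)
qed

text \<open>  By \<open>less_grow_iff\<close> and \<open>grow_less_iff\<close> the sets on which a value of the functional is above or below
  \<open>c\<close> are a finite union and a finite intersection of open conditions on values of \<open>\<nu>\<close>.\<close>

theorem continuous_grow:
  assumes T: "0 \<le> T"
  shows "continuous_map (prod_topology (top_of_set {0..1}) (OS_f_space X)) (fspace X)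
    (\<lambda>p. grow X Y \<psi> (T * fst p) (snd p))"
  unfolding continuous_map_into_fspace
proof (intro conjI ballI)
  let ?Z = "prod_topology (top_of_set {0..1::real}) (OS_f_space X)"
  have Z: "topspace ?Z = {0..1} \<times> OS_f X" by (simp add: topspace_OS_f_space)
  fix \<phi> assume \<phi>: "\<phi> \<in> cfun X"
  have p1: "continuous_map ?Z euclideanreal (\<lambda>p. snd p \<phi>)"
    using continuous_map_compose[OF continuous_map_snd continuous_OS_f_eval[OF \<phi>]] by (simp add: o_def)
  have p2: "continuous_map ?Z euclideanreal (\<lambda>p. snd p (probe \<phi> y (T * fst p * b)))"
    if y: "y \<in> Y" and b: "0 \<le> b" for y b
  proof (rule continuous_map_Lipschitz_parameter[where L = "T * b + 1"])
    show "continuous_map (OS_f_space X) euclideanreal (\<lambda>\<nu>. \<nu> (probe \<phi> y (T * s * b)))" for s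
      by (rule continuous_OS_f_eval[OF probe_cfun[OF \<phi> y]])
    show "0 < T * b + 1" using T b by (simp add: add_nonneg_pos)
    fix s s' :: real and \<nu> assume "\<nu> \<in> topspace (OS_f_space X)"
    then have "\<bar>\<nu> (probe \<phi> y (T * s * b)) - \<nu> (probe \<phi> y (T * s' * b))\<bar> \<le> \<bar>T * s * b - T * s' * b\<bar>"
      unfolding topspace_OS_f_space by (rule OS_f_probe_Lipschitz[OF _ \<phi> y])
    also have "T * s * b - T * s' * b = T * b * (s - s')" by (simp add: algebra_simps)
    also have "\<bar>T * b * (s - s')\<bar> = T * b * \<bar>s - s'\<bar>" using T b by (simp add: abs_mult)
    also have "\<dots> \<le> (T * b + 1) * \<bar>s - s'\<bar>" by (intro mult_right_mono) auto
    finally show "\<bar>\<nu> (probe \<phi> y (T * s * b)) - \<nu> (probe \<phi> y (T * s' * b))\<bar> \<le> (T * b + 1) * \<bar>s - s'\<bar>" .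
  qed
  have tpos: "0 \<le> T * fst p" if "p \<in> topspace ?Z" for p
    using that T unfolding Z by auto
  show "continuous_map ?Z euclideanreal (\<lambda>p. grow X Y \<psi> (T * fst p) (snd p) \<phi>)"
    unfolding continuous_map_upper_lower_semicontinuous_lt
  proof (intro conjI allI)
    fix c
    let ?q = "\<lambda>y p. snd p (probe \<phi> y (T * fst p * max 0 (\<phi> y - c)))"
    have q: "continuous_map ?Z euclideanreal (?q y)" if "y \<in> Y" for y
      by (rule p2[OF that]) simp
    have gt: "openin ?Z {p \<in> topspace ?Z. f p \<in> {c<..}}" and lt: "openin ?Z {p \<in> topspace ?Z. f p \<in> {..<c}}"
      if "continuous_map ?Z euclideanreal f" for f
      by (rule openin_continuous_map_preimage[OF that], simp)+
    have "{p \<in> topspace ?Z. c < grow X Y \<psi> (T * fst p) (snd p) \<phi>}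
        = {p \<in> topspace ?Z. snd p \<phi> \<in> {c<..}} \<union> (\<Union>y\<in>Y. {p \<in> topspace ?Z. ?q y p \<in> {c<..}})"
    proof -
      have "c < grow X Y \<psi> (T * fst p) (snd p) \<phi> \<longleftrightarrow> c < snd p \<phi> \<or> (\<exists>y\<in>Y. c < ?q y p)"
        if "p \<in> topspace ?Z" for p
        by (rule less_grow_iff[OF _ \<phi> tpos[OF that]]) (use that[unfolded Z] in auto)
      then show ?thesis by auto
    qed
    also have "openin ?Z \<dots>"
      by (intro openin_Un openin_Union) (use gt[OF p1] gt[OF q] in blast)+
    finally show "openin ?Z {p \<in> topspace ?Z. c < grow X Y \<psi> (T * fst p) (snd p) \<phi>}" .
    have "{p \<in> topspace ?Z. grow X Y \<psi> (T * fst p) (snd p) \<phi> < c}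
        = \<Inter>(insert {p \<in> topspace ?Z. snd p \<phi> \<in> {..<c}} ((\<lambda>y. {p \<in> topspace ?Z. ?q y p \<in> {..<c}}) ` Y))"
    proof -
      have "grow X Y \<psi> (T * fst p) (snd p) \<phi> < c \<longleftrightarrow> snd p \<phi> < c \<and> (\<forall>y\<in>Y. ?q y p < c)"
        if "p \<in> topspace ?Z" for p
        by (rule grow_less_iff[OF _ \<phi> tpos[OF that]]) (use that[unfolded Z] in auto)
      then show ?thesis by auto
    qed
    also have "openin ?Z \<dots>"
      by (rule openin_Inter) (use finite_net lt[OF p1] lt[OF q] in auto)
    finally show "openin ?Z {p \<in> topspace ?Z. grow X Y \<psi> (T * fst p) (snd p) \<phi> < c}" .
  qed
qed (auto simp: grow_def nu_def)

lemma grow_0: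
  assumes \<nu>: "\<nu> \<in> OS_f X"
  shows "grow X Y \<psi> 0 \<nu> = \<nu>"
proof -
  have "mix X (share 0 k (\<psi> y)) k (dirac X y) = k" if "k \<in> below X \<nu>" for k y
    using that below_prob[of \<nu>] prob_extensional[of k X]
    by (intro functional_eqI[where X = X]) (auto simp: mix_def share_def)
  then have "grow_gens X Y \<psi> 0 \<nu> = below X \<nu>" unfolding grow_gens_def by auto
  then show ?thesis using OS_f_below(2)[OF \<nu>] by (simp add: grow_def)
qed

end

section \<open>Joins, mixtures and neighbourhoods of functionals\<close>

text \<open>  On suprema of sets of measures this corresponds to the union of the sets.\<close>

definition join :: "'a topology \<Rightarrow> 'a functional \<Rightarrow> 'a functional \<Rightarrow> 'a functional" where
  "join X \<mu> \<nu> = (\<lambda>\<phi>\<in>cfun X. max (\<mu> \<phi>) (\<nu> \<phi>))"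

lemma join_apply: "\<phi> \<in> cfun X \<Longrightarrow> join X \<mu> \<nu> \<phi> = max (\<mu> \<phi>) (\<nu> \<phi>)"
  by (simp add: join_def)

lemma continuous_map_join:
  assumes "continuous_map Z (fspace X) p" "continuous_map Z (fspace X) q"
  shows "continuous_map Z (fspace X) (\<lambda>z. join X (p z) (q z))"
  using assms unfolding continuous_map_into_fspace
  by (auto simp: join_def intro!: continuous_map_real_max)

lemma continuous_map_mix:
  assumes "continuous_map Z euclideanreal s" "continuous_map Z (fspace X) p" "continuous_map Z (fspace X) q"
  shows "continuous_map Z (fspace X) (\<lambda>z. mix X (s z) (p z) (q z))"
  using assms unfolding continuous_map_into_fspace
  by (auto simp: mix_def intro!: continuous_map_add continuous_map_real_mult continuous_map_diff)

lemma mix_0: "\<mu> \<in> extensional (cfun X) \<Longrightarrow> mix X 0 \<mu> \<nu> = \<mu>"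
  by (rule functional_eqI[where X = X]) (auto simp: mix_def)

lemma mix_1: "\<nu> \<in> extensional (cfun X) \<Longrightarrow> mix X 1 \<mu> \<nu> = \<nu>"
  by (rule functional_eqI[where X = X]) (auto simp: mix_def)

lemma mix_between:
  fixes a b c d :: real
  assumes "0 \<le> s" "s \<le> 1" "\<bar>a - c\<bar> \<le> d" "\<bar>b - c\<bar> \<le> d"
  shows "\<bar>((1 - s) * a + s * b) - c\<bar> \<le> d"
proof -
  have "((1 - s) * a + s * b) - c = (1 - s) * (a - c) + s * (b - c)" by (simp add: algebra_simps)
  also have "\<bar>\<dots>\<bar> \<le> \<bar>(1 - s) * (a - c)\<bar> + \<bar>s * (b - c)\<bar>" by (rule abs_triangle_ineq)
  also have "\<dots> \<le> (1 - s) * d + s * d"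
    using assms by (auto simp: abs_mult intro!: add_mono mult_left_mono)
  finally show ?thesis by (simp add: algebra_simps)
qed

context compact_Hausdorff
begin

lemma box_extensional: "\<mu> \<in> box \<Longrightarrow> \<mu> \<in> extensional (cfun X)"
  by (simp add: box_def PiE_iff)

lemma box_abs_le: "\<lbrakk>\<mu> \<in> box; \<phi> \<in> cfun X\<rbrakk> \<Longrightarrow> \<bar>\<mu> \<phi>\<bar> \<le> sup_norm \<phi>"
  using PiE_mem[of \<mu> "cfun X" "\<lambda>\<phi>. {- sup_norm \<phi>..sup_norm \<phi>}" \<phi>]
  unfolding box_def atLeastAtMost_iff by linarith

lemma join_box: "\<lbrakk>\<mu> \<in> box; \<nu> \<in> box\<rbrakk> \<Longrightarrow> join X \<mu> \<nu> \<in> box"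
  by (rule box_I) (auto simp: join_def max_def box_abs_le)

lemma mix_box:
  assumes "\<mu> \<in> box" "\<nu> \<in> box" "0 \<le> s" "s \<le> 1"
  shows "mix X s \<mu> \<nu> \<in> box"
proof (rule box_I)
  show "\<bar>mix X s \<mu> \<nu> \<phi>\<bar> \<le> sup_norm \<phi>" if \<phi>: "\<phi> \<in> cfun X" for \<phi>
    using mix_between[OF assms(3,4), of "\<mu> \<phi>" 0 "sup_norm \<phi>" "\<nu> \<phi>"]
      box_abs_le[OF assms(1) \<phi>] box_abs_le[OF assms(2) \<phi>] by (simp add: mix_apply[OF \<phi>])
qed (simp add: mix_def)

lemma nu_Un:
  assumes "K \<subseteq> prob_functionals X" "K \<noteq> {}" "L \<subseteq> prob_functionals X" "L \<noteq> {}"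
  shows "nu X (K \<union> L) = join X (nu X K) (nu X L)"
proof (rule functional_eqI[OF nu_extensional])
  fix \<phi> assume \<phi>: "\<phi> \<in> cfun X"
  have KL: "K \<union> L \<subseteq> prob_functionals X" "K \<union> L \<noteq> {}" using assms by auto
  have "nu X (K \<union> L) \<phi> \<le> max (nu X K \<phi>) (nu X L \<phi>)"
    by (rule nu_least[OF KL(2) \<phi>])
      (use nu_upper[OF assms(1) \<phi>] nu_upper[OF assms(3) \<phi>] in \<open>fastforce simp: le_max_iff_disj\<close>)
  moreover have "nu X K \<phi> \<le> nu X (K \<union> L) \<phi>" "nu X L \<phi> \<le> nu X (K \<union> L) \<phi>"
    by (rule nu_least[OF assms(2) \<phi>], rule nu_upper[OF KL(1) \<phi>], simp)
      (rule nu_least[OF assms(4) \<phi>], rule nu_upper[OF KL(1) \<phi>], simp)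
  ultimately show "nu X (K \<union> L) \<phi> = join X (nu X K) (nu X L) \<phi>" by (simp add: join_apply[OF \<phi>])
qed (simp add: join_def)

lemma nu_le_nu:
  assumes K: "K \<noteq> {}" and L: "L \<subseteq> prob_functionals X" and \<phi>: "\<phi> \<in> cfun X"
    and le: "\<And>k. k \<in> K \<Longrightarrow> \<exists>l\<in>L. k \<phi> \<le> l \<phi> + e"
  shows "nu X K \<phi> \<le> nu X L \<phi> + e"
proof (rule nu_least[OF K \<phi>])
  fix k assume "k \<in> K"
  then obtain l where "l \<in> L" "k \<phi> \<le> l \<phi> + e" using le by blast
  then show "k \<phi> \<le> nu X L \<phi> + e" using nu_upper[OF L \<phi>, of l] by linarith
qed

text \<open>  The bump at \<open>y\<close> depends on the pseudometric \<open>d\<close> given by the test functions: it is 1 up to distance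
  \<open>e/2\<close> and vanishes from distance \<open>e\<close> on.\<close>

lemma net_exists:
  assumes \<Phi>: "finite \<Phi>" "\<Phi> \<subseteq> cfun X" and e: "e > 0"
  obtains Y \<psi> where "net X Y \<psi>"
    "\<And>x y \<phi>. \<lbrakk>y \<in> Y; x \<in> topspace X; 0 < \<psi> y x; \<phi> \<in> \<Phi>\<rbrakk> \<Longrightarrow> \<bar>\<phi> x - \<phi> y\<bar> < e"
    "\<And>x. x \<in> topspace X \<Longrightarrow> \<exists>y\<in>Y. \<psi> y x = 1"
proof -
  define d where "d = (\<lambda>y x. \<Sum>\<phi>\<in>\<Phi>. \<bar>\<phi> x - \<phi> y\<bar>)"
  have d: "continuous_map X euclideanreal (d y)" for y
    unfolding d_def
  proof (rule continuous_map_sum[OF \<Phi>(1)])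
    fix \<phi> assume "\<phi> \<in> \<Phi>"
    then have c: "continuous_map X euclideanreal \<phi>" using \<Phi>(2) cfun_continuous by blast
    show "continuous_map X euclideanreal (\<lambda>x. \<bar>\<phi> x - \<phi> y\<bar>)"
      by (intro continuous_map_real_abs continuous_map_diff c) simp
  qed
  define \<psi> where "\<psi> = (\<lambda>y. \<lambda>x\<in>topspace X. min 1 (max 0 (2 - 2 / e * d y x)))"
  have \<psi>: "\<psi> y \<in> cfun X" for y
    unfolding \<psi>_def
    by (intro cfunI continuous_map_real_min continuous_map_real_max continuous_map_diff
        continuous_map_real_mult d continuous_map_canonical_const)
  have close: "\<bar>\<phi> x - \<phi> y\<bar> < e" if "x \<in> topspace X" "0 < \<psi> y x" "\<phi> \<in> \<Phi>" for x y \<phi>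
  proof -
    have "\<bar>\<phi> x - \<phi> y\<bar> \<le> d y x"
      unfolding d_def by (rule member_le_sum[OF that(3) _ \<Phi>(1)]) simp
    moreover have "2 / e * d y x < 2" using that by (simp add: \<psi>_def split: if_splits)
    ultimately show ?thesis using e by (simp add: field_simps)
  qed
  define U where "U = (\<lambda>y. {x \<in> topspace X. d y x \<in> {..<e / 2}})"
  have "openin X (U y)" for y
    unfolding U_def by (rule openin_continuous_map_preimage[OF d]) simp
  moreover have "topspace X \<subseteq> \<Union>(U ` topspace X)"
    using e by (auto simp: U_def d_def)
  ultimately obtain \<F> where "finite \<F>" "\<F> \<subseteq> U ` topspace X" "topspace X \<subseteq> \<Union>\<F>"
    using compact unfolding compact_space_alt by (metis (no_types, lifting) imageE)
  then obtain Y where Y: "finite Y" "Y \<subseteq> topspace X" "topspace X \<subseteq> \<Union>(U ` Y)"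
    by (metis finite_subset_image)
  have "\<exists>y\<in>Y. \<psi> y x = 1" if x: "x \<in> topspace X" for x
  proof -
    obtain y where y: "y \<in> Y" "d y x < e / 2" using Y(3) x by (auto simp: U_def)
    then have "2 / e * d y x \<le> 1" using e by (simp add: field_simps)
    then have "\<psi> y x = 1" using x unfolding \<psi>_def by (simp del: times_divide_eq_left)
    then show ?thesis using y(1) by blast
  qed
  moreover have "net X Y \<psi>"
    by unfold_locales (use Y \<psi> in \<open>auto simp: \<psi>_def\<close>)
  ultimately show thesis using close by (intro that) blast+
qed

text \<open>  A Lebesgue number argument: finitely many test functions and one tolerance serve for all points of
  a compact set.\<close>

lemma uniform_neighbourhood:
  assumes C: "compactin (fspace X) C" and W: "openin (fspace X) W" "C \<subseteq> W"
  obtains \<Phi> \<epsilon> where "finite \<Phi>" "\<Phi> \<subseteq> cfun X" "\<epsilon> > 0"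
    "\<And>\<mu> \<nu>. \<lbrakk>\<mu> \<in> C; \<nu> \<in> extensional (cfun X); \<And>\<phi>. \<phi> \<in> \<Phi> \<Longrightarrow> \<bar>\<nu> \<phi> - \<mu> \<phi>\<bar> < \<epsilon>\<rbrakk> \<Longrightarrow> \<nu> \<in> W"
proof -
  have "\<exists>\<Phi> d. finite \<Phi> \<and> \<Phi> \<subseteq> cfun X \<and> d > 0 \<and>
      (\<forall>\<nu>\<in>extensional (cfun X). (\<forall>\<phi>\<in>\<Phi>. \<bar>\<nu> \<phi> - \<mu> \<phi>\<bar> < d) \<longrightarrow> \<nu> \<in> W)" if \<mu>: "\<mu> \<in> C" for \<mu>
  proof -
    obtain U where U: "finite {\<phi> \<in> cfun X. U \<phi> \<noteq> UNIV}" "\<And>\<phi>. \<phi> \<in> cfun X \<Longrightarrow> open (U \<phi>)"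
      "\<mu> \<in> Pi\<^sub>E (cfun X) U" "Pi\<^sub>E (cfun X) U \<subseteq> W"
      using W \<mu> unfolding openin_product_topology_alt by (auto dest: bspec)
    define \<Phi> where "\<Phi> = {\<phi> \<in> cfun X. U \<phi> \<noteq> UNIV}"
    have "\<exists>d>0. \<forall>r. \<bar>r - \<mu> \<phi>\<bar> < d \<longrightarrow> r \<in> U \<phi>" if "\<phi> \<in> \<Phi>" for \<phi>
    proof -
      have "open (U \<phi>)" "\<mu> \<phi> \<in> U \<phi>" using U(2,3) that by (auto simp: \<Phi>_def PiE_iff)
      then show ?thesis unfolding open_dist dist_real_def by blast
    qed
    then obtain d where d: "\<And>\<phi>. \<phi> \<in> \<Phi> \<Longrightarrow> d \<phi> > 0" "\<And>\<phi> r. \<lbrakk>\<phi> \<in> \<Phi>; \<bar>r - \<mu> \<phi>\<bar> < d \<phi>\<rbrakk> \<Longrightarrow> r \<in> U \<phi>"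
      by metis
    define \<delta> where "\<delta> = Min (insert 1 (d ` \<Phi>))"
    have fin: "finite \<Phi>" using U(1) by (simp add: \<Phi>_def)
    have "\<nu> \<in> W" if \<nu>: "\<nu> \<in> extensional (cfun X)" "\<forall>\<phi>\<in>\<Phi>. \<bar>\<nu> \<phi> - \<mu> \<phi>\<bar> < \<delta>" for \<nu>
    proof -
      have "\<nu> \<phi> \<in> U \<phi>" if "\<phi> \<in> cfun X" for \<phi>
      proof (cases "\<phi> \<in> \<Phi>")
        case True
        then have "\<delta> \<le> d \<phi>" unfolding \<delta>_def using fin by simp
        moreover have "\<bar>\<nu> \<phi> - \<mu> \<phi>\<bar> < \<delta>" using \<nu>(2) True by blast
        ultimately have "\<bar>\<nu> \<phi> - \<mu> \<phi>\<bar> < d \<phi>" by linarith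
        then show ?thesis by (rule d(2)[OF True])
      next
        case False
        then show ?thesis using that by (simp add: \<Phi>_def)
      qed
      then have "\<nu> \<in> Pi\<^sub>E (cfun X) U" using \<nu>(1) by (simp add: PiE_iff)
      then show ?thesis using U(4) by blast
    qed
    moreover have "\<delta> > 0" unfolding \<delta>_def using fin d(1) by simp
    ultimately show ?thesis using fin unfolding \<Phi>_def
      by (intro exI[of _ "{\<phi> \<in> cfun X. U \<phi> \<noteq> UNIV}"] exI[of _ \<delta>]) (simp add: \<Phi>_def)
  qed
  then obtain F d where F: "\<And>\<mu>. \<mu> \<in> C \<Longrightarrow> finite (F \<mu>)" "\<And>\<mu>. \<mu> \<in> C \<Longrightarrow> F \<mu> \<subseteq> cfun X"
    and d: "\<And>\<mu>. \<mu> \<in> C \<Longrightarrow> d \<mu> > 0"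
    and in_W: "\<And>\<mu> \<nu>. \<lbrakk>\<mu> \<in> C; \<nu> \<in> extensional (cfun X); \<forall>\<phi>\<in>F \<mu>. \<bar>\<nu> \<phi> - \<mu> \<phi>\<bar> < d \<mu>\<rbrakk> \<Longrightarrow> \<nu> \<in> W"
    by metis
  \<comment> \<open>Half of the radius is kept for the distance between \<open>\<mu>\<close> and the center of the chosen neighbourhood.
    The whole space is inserted because the set of test functions may be empty.\<close>
  define N where "N = (\<lambda>\<mu>. \<Inter>(insert (topspace (fspace X))
      ((\<lambda>\<phi>. {\<nu> \<in> topspace (fspace X). \<nu> \<phi> \<in> ball (\<mu> \<phi>) (d \<mu> / 2)}) ` F \<mu>)))"
  have "openin (fspace X) (N \<mu>)" if "\<mu> \<in> C" for \<mu>
    unfolding N_def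
  proof (rule openin_Inter)
    fix S assume "S \<in> insert (topspace (fspace X))
      ((\<lambda>\<phi>. {\<nu> \<in> topspace (fspace X). \<nu> \<phi> \<in> ball (\<mu> \<phi>) (d \<mu> / 2)}) ` F \<mu>)"
    then consider "S = topspace (fspace X)"
      | \<phi> where "\<phi> \<in> F \<mu>" "S = {\<nu> \<in> topspace (fspace X). \<nu> \<phi> \<in> ball (\<mu> \<phi>) (d \<mu> / 2)}" by blast
    then show "openin (fspace X) S"
    proof cases
      case 1 then show ?thesis by (simp only: openin_topspace)
    next
      case 2
      show ?thesis unfolding 2(2)
        by (rule openin_continuous_map_preimage[OF continuous_map_eval]) (use 2(1) F(2)[OF that] in auto)
    qed
  qed (use F(1)[OF that] in auto)
  moreover have "\<mu> \<in> N \<mu>" if "\<mu> \<in> C" for \<mu>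
    unfolding N_def using d[OF that] subsetD[OF compactin_subset_topspace[OF C] that] by auto
  ultimately obtain \<F> where "finite \<F>" "\<F> \<subseteq> N ` C" "C \<subseteq> \<Union>\<F>"
    using compactinD[OF C, of "N ` C"] by blast
  then obtain D where D: "finite D" "D \<subseteq> C" "C \<subseteq> \<Union>(N ` D)"
    by (metis finite_subset_image)
  define \<Phi> where "\<Phi> = \<Union>(F ` D)"
  define \<epsilon> where "\<epsilon> = Min (insert 1 ((\<lambda>\<mu>. d \<mu> / 2) ` D))"
  have "\<nu> \<in> W" if \<mu>: "\<mu> \<in> C" and \<nu>: "\<nu> \<in> extensional (cfun X)" and close: "\<And>\<phi>. \<phi> \<in> \<Phi> \<Longrightarrow> \<bar>\<nu> \<phi> - \<mu> \<phi>\<bar> < \<epsilon>" for \<mu> \<nu>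
  proof -
    obtain \<mu>0 where \<mu>0: "\<mu>0 \<in> D" "\<mu> \<in> N \<mu>0" using D(3) \<mu> by blast
    have "\<bar>\<nu> \<phi> - \<mu>0 \<phi>\<bar> < d \<mu>0" if \<phi>: "\<phi> \<in> F \<mu>0" for \<phi>
    proof -
      have "\<bar>\<nu> \<phi> - \<mu> \<phi>\<bar> < \<epsilon>" using close \<phi> \<mu>0(1) by (auto simp: \<Phi>_def)
      moreover have "\<epsilon> \<le> d \<mu>0 / 2" unfolding \<epsilon>_def by (rule Min_le) (use D(1) \<mu>0(1) in auto)
      moreover have "\<mu> \<phi> \<in> ball (\<mu>0 \<phi>) (d \<mu>0 / 2)" using \<mu>0(2) \<phi> unfolding N_def by blast
      then have "\<bar>\<mu>0 \<phi> - \<mu> \<phi>\<bar> < d \<mu>0 / 2" by (simp add: dist_real_def)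
      ultimately show ?thesis by linarith
    qed
    then show ?thesis using in_W[of \<mu>0 \<nu>] \<mu>0(1) D(2) \<nu> by blast
  qed
  moreover have "finite \<Phi>" "\<Phi> \<subseteq> cfun X" using D F unfolding \<Phi>_def by blast+
  moreover have "\<epsilon> > 0" unfolding \<epsilon>_def using D d by auto
  ultimately show thesis using that[of \<Phi> \<epsilon>] by blast
qed

end

text \<open>  \<open>\<Phi>\<close> contains the test functions by which closeness of functionals is measured, up to \<open>e\<close>.\<close>

locale fine_net = net +
  fixes \<Phi> :: "('a \<Rightarrow> real) set" and e :: real
  assumes finite_tests: "finite \<Phi>" and tests_cfun: "\<Phi> \<subseteq> cfun X" and e_pos: "e > 0"
    and bump_close: "\<And>x y \<phi>. \<lbrakk>y \<in> Y; x \<in> topspace X; 0 < \<psi> y x; \<phi> \<in> \<Phi>\<rbrakk> \<Longrightarrow> \<bar>\<phi> x - \<phi> y\<bar> < e"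
    and bump_cover: "\<And>x. x \<in> topspace X \<Longrightarrow> \<exists>y\<in>Y. \<psi> y x = 1"
begin

definition main_atom :: "'a functional \<Rightarrow> 'a" where
  "main_atom k = (SOME x. mass_ge X (2 / 3) k x \<and> (\<forall>s. 0 \<le> s \<and> s \<le> 1 \<longrightarrow> mix X s k (dirac X x) \<in> P_f X))"

lemma main_atom:
  assumes "k \<in> P_f X"
  shows "mass_ge X (2 / 3) k (main_atom k)" "\<lbrakk>0 \<le> s; s \<le> 1\<rbrakk> \<Longrightarrow> mix X s k (dirac X (main_atom k)) \<in> P_f X"
proof -
  have "\<exists>x. mass_ge X (2 / 3) k x \<and> (\<forall>s. 0 \<le> s \<and> s \<le> 1 \<longrightarrow> mix X s k (dirac X x) \<in> P_f X)"
    by (rule P_f_main_atom[OF assms]) blast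
  from someI_ex[OF this] show "mass_ge X (2 / 3) k (main_atom k)"
    "\<lbrakk>0 \<le> s; s \<le> 1\<rbrakk> \<Longrightarrow> mix X s k (dirac X (main_atom k)) \<in> P_f X"
    unfolding main_atom_def by blast+
qed

text \<open>  The measures of \<open>grow_gens\<close> with \<open>y\<close> replaced by the main atom of \<open>k\<close>.  They belong to \<open>P_f X\<close>, and on
  the test functions the difference is at most \<open>e\<close>.\<close>

definition approx_gens :: "real \<Rightarrow> 'a functional \<Rightarrow> 'a functional set" where
  "approx_gens t \<nu> = below X \<nu> \<union>
     {mix X (share t k (\<psi> y)) k (dirac X (main_atom k)) | k y. k \<in> below X \<nu> \<and> y \<in> Y}"

lemma approx_gens_P_f:
  assumes "0 \<le> t"
  shows "approx_gens t \<nu> \<subseteq> P_f X"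
proof -
  have "mix X (share t k (\<psi> y)) k (dirac X (main_atom k)) \<in> P_f X" if "k \<in> below X \<nu>" for k y
    using share_bounds[OF assms, of k "\<psi> y"] that below_P_f by (intro main_atom(2)) auto
  then show ?thesis using below_P_f unfolding approx_gens_def by blast
qed

lemma approx_gens_nonempty: "\<nu> \<in> OS_f X \<Longrightarrow> approx_gens t \<nu> \<noteq> {}"
  using OS_f_below(1) by (auto simp: approx_gens_def)

lemma approx_in_OS_f: "\<lbrakk>\<nu> \<in> OS_f X; 0 \<le> t\<rbrakk> \<Longrightarrow> nu X (approx_gens t \<nu>) \<in> OS_f X"
  by (rule nu_in_OS_f[OF approx_gens_P_f approx_gens_nonempty])

text \<open>  If any mass is moved to \<open>y\<close> at all, then the main atom of \<open>k\<close> lies in the bump at \<open>y\<close>.\<close>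

lemma mix_main_atom_close:
  assumes k: "k \<in> P_f X" and y: "y \<in> Y" and \<phi>: "\<phi> \<in> \<Phi>" and t: "0 \<le> t"
  shows "\<bar>mix X (share t k (\<psi> y)) k (dirac X y) \<phi> - mix X (share t k (\<psi> y)) k (dirac X (main_atom k)) \<phi>\<bar> \<le> e"
proof -
  have \<phi>c: "\<phi> \<in> cfun X" using \<phi> tests_cfun by blast
  have kp: "k \<in> prob_functionals X" using k P_f_subset_prob by blast
  let ?s = "share t k (\<psi> y)" and ?x = "main_atom k"
  have x: "?x \<in> topspace X" using main_atom(1)[OF k] by (simp add: mass_ge_def)
  have s: "0 \<le> ?s" "?s < 1" using share_bounds[OF t] by auto
  have "mix X ?s k (dirac X y) \<phi> - mix X ?s k (dirac X ?x) \<phi> = ?s * (\<phi> y - \<phi> ?x)"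
    unfolding mix_apply[OF \<phi>c] dirac_apply[OF \<phi>c] by (simp add: algebra_simps)
  also have "\<bar>\<dots>\<bar> = ?s * \<bar>\<phi> ?x - \<phi> y\<bar>" using s by (simp add: abs_mult abs_minus_commute)
  also have "\<dots> \<le> e"
  proof (cases "?s = 0")
    case True then show ?thesis using e_pos by simp
  next
    case False
    then have "k (\<psi> y) > 1 / 2" by (auto simp: share_def excess_def max_def split: if_splits)
    moreover have "k (\<psi> y) \<le> 2 / 3 * \<psi> y ?x + 1 / 3 * 1"
      by (rule mass_ge_upper[OF kp main_atom(1)[OF k] bump[OF y]]) (use bump_range[OF y] in blast)
    ultimately have "0 < \<psi> y ?x" by simp
    then have "\<bar>\<phi> ?x - \<phi> y\<bar> < e" by (rule bump_close[OF y x _ \<phi>])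
    then have "?s * \<bar>\<phi> ?x - \<phi> y\<bar> \<le> 1 * e" using s by (intro mult_mono) auto
    then show ?thesis by simp
  qed
  finally show ?thesis .
qed

lemma grow_approx:
  assumes \<nu>: "\<nu> \<in> OS_f X" and t: "0 \<le> t" and \<phi>: "\<phi> \<in> \<Phi>"
  shows "\<bar>grow X Y \<psi> t \<nu> \<phi> - nu X (approx_gens t \<nu>) \<phi>\<bar> \<le> e"
proof -
  have \<phi>c: "\<phi> \<in> cfun X" using \<phi> tests_cfun by blast
  have A: "approx_gens t \<nu> \<subseteq> prob_functionals X" using approx_gens_P_f[OF t] P_f_subset_prob by blast
  have close: "\<bar>mix X (share t k (\<psi> y)) k (dirac X y) \<phi> - mix X (share t k (\<psi> y)) k (dirac X (main_atom k)) \<phi>\<bar> \<le> e"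
    if "k \<in> below X \<nu>" "y \<in> Y" for k y
    using mix_main_atom_close[OF _ that(2) \<phi> t] that(1) below_P_f by blast
  have "grow X Y \<psi> t \<nu> \<phi> \<le> nu X (approx_gens t \<nu>) \<phi> + e"
    unfolding grow_def
  proof (rule nu_le_nu[OF grow_gens_nonempty[OF \<nu>] A \<phi>c])
    fix g assume "g \<in> grow_gens X Y \<psi> t \<nu>"
    then consider "g \<in> below X \<nu>"
      | k y where "k \<in> below X \<nu>" "y \<in> Y" "g = mix X (share t k (\<psi> y)) k (dirac X y)"
      unfolding grow_gens_def by blast
    then show "\<exists>l\<in>approx_gens t \<nu>. g \<phi> \<le> l \<phi> + e"
    proof cases
      case 1 then show ?thesis using e_pos unfolding approx_gens_def by (intro bexI[of _ g]) auto
    next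
      case (2 k y)
      show ?thesis
        by (rule bexI[of _ "mix X (share t k (\<psi> y)) k (dirac X (main_atom k))"])
          (use close[OF 2(1,2)] 2 in \<open>auto simp: approx_gens_def\<close>)
    qed
  qed
  moreover have "nu X (approx_gens t \<nu>) \<phi> \<le> grow X Y \<psi> t \<nu> \<phi> + e"
    unfolding grow_def
  proof (rule nu_le_nu[OF approx_gens_nonempty[OF \<nu>] grow_gens_prob[OF t] \<phi>c])
    fix g assume "g \<in> approx_gens t \<nu>"
    then consider "g \<in> below X \<nu>"
      | k y where "k \<in> below X \<nu>" "y \<in> Y" "g = mix X (share t k (\<psi> y)) k (dirac X (main_atom k))"
      unfolding approx_gens_def by blast
    then show "\<exists>l\<in>grow_gens X Y \<psi> t \<nu>. g \<phi> \<le> l \<phi> + e"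
    proof cases
      case 1 then show ?thesis using e_pos unfolding grow_gens_def by (intro bexI[of _ g]) auto
    next
      case (2 k y)
      show ?thesis
        by (rule bexI[of _ "mix X (share t k (\<psi> y)) k (dirac X y)"])
          (use close[OF 2(1,2)] 2 in \<open>auto simp: grow_gens_def\<close>)
    qed
  qed
  ultimately show ?thesis by linarith
qed

text \<open>  Near \<open>x\<close> some \<open>k\<close> below \<open>\<nu>\<close> has its main atom, and for a net point \<open>y\<close> whose bump is 1 there the excess
  is at least \<open>2/3 - 1/2 = 1/6\<close>.  For \<open>T \<ge> 12 M / e\<close> all but a fraction \<open>e / (2 M)\<close> of the mass has moved
  to \<open>y\<close>.  The three errors \<open>e\<close> come from this rest, from the distance of \<open>y\<close> to the atom, and from the
  distance of the atom to \<open>x\<close>.\<close>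

lemma center_le_grow:
  assumes \<nu>: "\<nu> \<in> OS_f X" and \<phi>: "\<phi> \<in> \<Phi>" and x: "x \<in> center X \<nu>"
    and M: "M > 0" "sup_norm \<phi> \<le> M" and T: "12 * M / e \<le> T"
  shows "\<phi> x \<le> grow X Y \<psi> T \<nu> \<phi> + 3 * e"
proof -
  have \<phi>c: "\<phi> \<in> cfun X" using \<phi> tests_cfun by blast
  have xt: "x \<in> topspace X" using exp_sets_subset[OF center_in_exp_sets[OF \<nu>]] x by blast
  have "0 < 12 * M / e" using M(1) e_pos by simp
  then have T0: "0 \<le> T" using T by linarith
  let ?U = "{x' \<in> topspace X. \<phi> x' \<in> {\<phi> x - e<..}}"
  have "openin X ?U" by (rule openin_continuous_map_preimage[OF cfun_continuous[OF \<phi>c]]) simp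
  moreover have "x \<in> ?U" using xt e_pos by simp
  ultimately obtain k x' where k: "k \<in> below X \<nu>" and x': "mass_ge X (2 / 3) k x'" "x' \<in> ?U"
    by (rule center_approx[OF x]) (rule that)
  have kp: "k \<in> prob_functionals X" using k below_prob by blast
  have x't: "x' \<in> topspace X" using x'(2) by simp
  obtain y where y: "y \<in> Y" "\<psi> y x' = 1" using bump_cover[OF x't] by blast
  have "2 / 3 * \<psi> y x' \<le> k (\<psi> y)"
    by (rule mass_geD[OF x'(1) bump[OF y(1)]]) (use bump_range[OF y(1)] in blast)
  then have o: "1 / 6 \<le> excess k (\<psi> y)" using y(2) by (simp add: excess_def)
  let ?s = "share T k (\<psi> y)" and ?o = "excess k (\<psi> y)"
  have s: "0 \<le> ?s" "?s < 1" using share_bounds[OF T0] by auto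
  have opos: "0 < 1 + T * ?o" using T0 o by (simp add: add_pos_nonneg)
  have s_eq: "1 - ?s = 1 / (1 + T * ?o)" unfolding share_def using opos by (simp add: field_simps)
  have "2 * M \<le> e * (1 + T * ?o)"
  proof -
    have "2 * M = e * (12 * M / e * (1 / 6))" using e_pos by simp
    also have "\<dots> \<le> e * (T * ?o)"
      using T T0 o M(1) e_pos by (intro mult_left_mono mult_mono) auto
    also have "\<dots> \<le> e * (1 + T * ?o)" using e_pos by simp
    finally show ?thesis .
  qed
  then have small: "(1 - ?s) * (2 * M) \<le> e"
    unfolding s_eq using opos by (simp add: pos_divide_le_eq)
  let ?g = "mix X ?s k (dirac X y)"
  have "\<bar>\<phi> y\<bar> \<le> M" using sup_norm(2)[OF \<phi>c, of y] M(2) y(1) net_subset by fastforce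
  moreover have "\<bar>k \<phi>\<bar> \<le> M" using prob_abs_le[OF kp \<phi>c] M(2) by linarith
  ultimately have "\<phi> y - k \<phi> \<le> 2 * M" by linarith
  then have "(1 - ?s) * (\<phi> y - k \<phi>) \<le> e"
    using s small by (intro order_trans[OF mult_left_mono small]) auto
  then have "\<phi> y \<le> ?g \<phi> + e"
    unfolding mix_apply[OF \<phi>c] dirac_apply[OF \<phi>c] by (simp add: algebra_simps)
  moreover have "?g \<phi> \<le> grow X Y \<psi> T \<nu> \<phi>"
    unfolding grow_def
    by (rule nu_upper[OF grow_gens_prob[OF T0] \<phi>c]) (use k y(1) in \<open>auto simp: grow_gens_def\<close>)
  moreover have "\<bar>\<phi> x' - \<phi> y\<bar> < e" by (rule bump_close[OF y(1) x't _ \<phi>]) (simp add: y(2))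
  moreover have "\<phi> x - e < \<phi> x'" using x'(2) by simp
  ultimately show ?thesis by linarith
qed

text \<open>  Every measure below \<open>\<nu>\<close> has mass \<open>2/3\<close> at a point of the center, and \<open>spread X 1\<close> has the maximal
  value of \<open>\<phi>\<close> at its disposal for the remaining \<open>1/3\<close>.\<close>

lemma approx_le_spread:
  assumes \<nu>: "\<nu> \<in> OS_f X" and t: "0 \<le> t" and \<phi>: "\<phi> \<in> cfun X"
  shows "nu X (approx_gens t \<nu>) \<phi> \<le> spread X 1 (center X \<nu>) \<phi>"
proof (rule nu_least[OF approx_gens_nonempty[OF \<nu>] \<phi>])
  note cen = center_in_exp_sets[OF \<nu>]
  have sp: "spread X 1 (center X \<nu>) \<phi> = 2 / 3 * Sup (\<phi> ` center X \<nu>) + 1 / 3 * Sup (\<phi> ` topspace X)"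
    using spread_apply[OF cen _ _ \<phi>, of 1] by simp
  have main: "2 / 3 * \<phi> x + 1 / 3 * Sup (\<phi> ` topspace X) \<le> spread X 1 (center X \<nu>) \<phi>"
    if "x \<in> center X \<nu>" for x
  proof -
    have "\<phi> x \<le> Sup (\<phi> ` center X \<nu>)" by (rule exp_sets_attains[OF cen \<phi>]) (use that in auto)
    then show ?thesis unfolding sp by simp
  qed
  have top: "\<phi> z \<le> Sup (\<phi> ` topspace X)" if "z \<in> topspace X" for z
    by (rule exp_sets_attains[OF topspace_in_exp_sets[OF cen] \<phi>]) (use that in auto)
  have atom: "k \<phi> \<le> 2 / 3 * \<phi> (main_atom k) + 1 / 3 * Sup (\<phi> ` topspace X)"
    "main_atom k \<in> center X \<nu>" if "k \<in> below X \<nu>" for k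
  proof -
    have "k \<in> P_f X" using that below_P_f by blast
    note at = main_atom(1)[OF this]
    show "k \<phi> \<le> 2 / 3 * \<phi> (main_atom k) + 1 / 3 * Sup (\<phi> ` topspace X)"
      by (rule mass_ge_upper[OF _ at \<phi> top]) (use that below_prob in blast)+
    show "main_atom k \<in> center X \<nu>" by (rule in_center[OF that at])
  qed
  fix g assume "g \<in> approx_gens t \<nu>"
  then consider "g \<in> below X \<nu>"
    | k y where "k \<in> below X \<nu>" "y \<in> Y" "g = mix X (share t k (\<psi> y)) k (dirac X (main_atom k))"
    unfolding approx_gens_def by blast
  then show "g \<phi> \<le> spread X 1 (center X \<nu>) \<phi>"
  proof cases
    case 1 then show ?thesis using atom[OF 1] main[of "main_atom g"] by linarith
  next
    case (2 k y)
    let ?s = "share t k (\<psi> y)" and ?x = "main_atom k"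
    have s: "0 \<le> ?s" "?s < 1" using share_bounds[OF t] by auto
    have "?x \<in> topspace X" using exp_sets_subset[OF cen] atom(2)[OF 2(1)] by blast
    then have "\<phi> ?x \<le> 2 / 3 * \<phi> ?x + 1 / 3 * Sup (\<phi> ` topspace X)" using top[of ?x] by simp
    then have "\<phi> ?x \<le> spread X 1 (center X \<nu>) \<phi>" "k \<phi> \<le> spread X 1 (center X \<nu>) \<phi>"
      using main[OF atom(2)[OF 2(1)]] atom(1)[OF 2(1)] by linarith+
    then have "(1 - ?s) * k \<phi> + ?s * \<phi> ?x
        \<le> (1 - ?s) * spread X 1 (center X \<nu>) \<phi> + ?s * spread X 1 (center X \<nu>) \<phi>"
      using s by (intro add_mono mult_left_mono) auto
    then show ?thesis
      unfolding 2(3) mix_apply[OF \<phi>] dirac_apply[OF \<phi>] by (simp add: algebra_simps)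
  qed
qed

end

section \<open>The homotopy between the identity and the retraction\<close>

lemma homotopic_through:
  assumes H: "continuous_map (prod_topology (top_of_set {0..1::real}) Z) V (\<lambda>p. H (fst p) (snd p))"
    and V: "\<And>s z. \<lbrakk>0 \<le> s; s \<le> 1; z \<in> topspace Z\<rbrakk> \<Longrightarrow> H s z \<in> N"
    and f: "continuous_map (subtopology V N) P f"
  shows "homotopic_with (\<lambda>_. True) Z P (\<lambda>z. f (H 0 z)) (\<lambda>z. f (H 1 z))"
proof -
  have "continuous_map (prod_topology (top_of_set {0..1}) Z) (subtopology V N) (\<lambda>p. H (fst p) (snd p))"
    by (rule continuous_map_into_subtopology[OF H]) (use V in auto)
  from continuous_map_compose[OF this f]
  have "continuous_map (prod_topology (top_of_set {0..1}) Z) P (\<lambda>p. f (H (fst p) (snd p)))"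
    by (simp add: o_def)
  then show ?thesis
    unfolding homotopic_with_def by (rule_tac x = "\<lambda>p. f (H (fst p) (snd p))" in exI) simp
qed

context fine_net
begin

text \<open>  The chain of homotopies, each inside the neighbourhood \<open>N\<close>: with \<open>G = grow X Y \<psi> T\<close> for a large
  \<open>T\<close> and \<open>S t\<close> the spread of the center,
  \<open>\<nu> \<leadsto> G \<nu> \<leadsto> join (G \<nu>) (S 0 \<nu>) \<leadsto> join (G \<nu>) (S 1 \<nu>) \<leadsto> S 1 \<nu> \<leadsto> S 0 \<nu>\<close>.
  The second and the fourth are segments between functionals that are close to each other.  The
  tolerance \<open>4 e\<close> is needed for the second: \<open>3 e\<close> from \<open>center_le_grow\<close> and \<open>e\<close> from
  \<open>grow_approx\<close>.\<close>

lemma homotopic_to_spread_center: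
  assumes M: "M > 0" "\<And>\<phi>. \<phi> \<in> \<Phi> \<Longrightarrow> sup_norm \<phi> \<le> M"
    and N: "\<And>\<mu> \<nu>. \<lbrakk>\<mu> \<in> OS_f X; \<nu> \<in> box; \<And>\<phi>. \<phi> \<in> \<Phi> \<Longrightarrow> \<bar>\<nu> \<phi> - \<mu> \<phi>\<bar> \<le> 4 * e\<rbrakk> \<Longrightarrow> \<nu> \<in> N"
    and f: "continuous_map (subtopology (fspace X) N) P f"
  shows "homotopic_with (\<lambda>_. True) (OS_f_space X) P f (\<lambda>\<nu>. f (spread X 0 (center X \<nu>)))"
proof -
  let ?O = "OS_f_space X"
  let ?Z = "prod_topology (top_of_set {0..1::real}) ?O"
  define T where "T = 12 * M / e"
  have T: "0 \<le> T" using M(1) e_pos by (simp add: T_def)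
  define G where "G = grow X Y \<psi> T"
  define S where "S = (\<lambda>t \<nu>. spread X t (center X \<nu>))"
  define A where "A = (\<lambda>t \<nu>. nu X (approx_gens t \<nu>))"
  have S_OS: "S t \<nu> \<in> OS_f X" if "\<nu> \<in> OS_f X" "0 \<le> t" "t \<le> 1" for t \<nu>
    unfolding S_def by (rule spread_in_OS_f[OF center_in_exp_sets[OF that(1)] that(2,3)])
  have A_OS: "A t \<nu> \<in> OS_f X" if "\<nu> \<in> OS_f X" "0 \<le> t" for t \<nu>
    unfolding A_def by (rule approx_in_OS_f[OF that])
  have grow_A: "\<bar>grow X Y \<psi> t \<nu> \<phi> - A t \<nu> \<phi>\<bar> \<le> e" if "\<nu> \<in> OS_f X" "0 \<le> t" "\<phi> \<in> \<Phi>" for t \<nu> \<phi>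
    unfolding A_def by (rule grow_approx[OF that])
  have grow_box: "grow X Y \<psi> t \<nu> \<in> box" if "\<nu> \<in> OS_f X" "0 \<le> t" for t \<nu>
    unfolding grow_def by (rule nu_box[OF grow_gens_prob[OF that(2)] grow_gens_nonempty[OF that(1)]])
  have S_box: "S t \<nu> \<in> box" if "\<nu> \<in> OS_f X" "0 \<le> t" "t \<le> 1" for t \<nu>
    using S_OS[OF that] OS_f_subset_box by blast
  have tests: "\<phi> \<in> cfun X" if "\<phi> \<in> \<Phi>" for \<phi> using that tests_cfun by blast
  have fst: "continuous_map ?Z euclideanreal fst"
    using continuous_map_fst continuous_map_in_subtopology by blast
  have cG1: "continuous_map ?Z (fspace X) (\<lambda>p. grow X Y \<psi> (T * fst p) (snd p))"
    by (rule continuous_grow[OF T])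
  have cS: "continuous_map ?Z (fspace X) (\<lambda>p. S (fst p) (snd p))"
  proof -
    have "continuous_map ?Z (prod_topology (top_of_set {0..1}) (exp_space X)) (\<lambda>p. (fst p, center X (snd p)))"
      using continuous_map_compose[OF continuous_map_snd continuous_center]
      by (intro continuous_map_pairedI continuous_map_fst) (simp add: o_def)
    from continuous_map_compose[OF this continuous_spread] show ?thesis by (simp add: o_def S_def)
  qed
  have const: "continuous_map ?Z (fspace X) (\<lambda>p. h c (snd p))"
    if h: "continuous_map ?Z (fspace X) (\<lambda>p. h (fst p) (snd p))" and c: "0 \<le> c" "c \<le> 1"
    for h :: "real \<Rightarrow> 'a functional \<Rightarrow> 'a functional" and c
  proof -
    have "continuous_map ?Z ?Z (\<lambda>p. (c, snd p))"
      using c by (intro continuous_map_pairedI continuous_map_snd) (auto simp: continuous_map_in_subtopology)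
    from continuous_map_compose[OF this h] show ?thesis by (simp add: o_def)
  qed
  have cG: "continuous_map ?Z (fspace X) (\<lambda>p. G (snd p))"
    using const[of "\<lambda>t. grow X Y \<psi> (T * t)", OF cG1, of 1] by (simp add: G_def)
  have cS0: "continuous_map ?Z (fspace X) (\<lambda>p. S 0 (snd p))"
    and cS1: "continuous_map ?Z (fspace X) (\<lambda>p. S 1 (snd p))"
    by (rule const[of S, OF cS], simp, simp)+
  note cJ = continuous_map_join[OF cG cS]
  have in1: "grow X Y \<psi> (T * s) \<nu> \<in> N" if "0 \<le> s" "s \<le> 1" "\<nu> \<in> topspace ?O" for s \<nu>
  proof -
    have \<nu>: "\<nu> \<in> OS_f X" using that(3) by (simp only: topspace_OS_f_space)
    have t: "0 \<le> T * s" using T that(1) by simp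
    show ?thesis
      by (rule N[OF A_OS[OF \<nu> t] grow_box[OF \<nu> t]]) (use grow_A[OF \<nu> t] e_pos in fastforce)
  qed
  have in2: "mix X s (G \<nu>) (join X (G \<nu>) (S 0 \<nu>)) \<in> N" if s: "0 \<le> s" "s \<le> 1" and "\<nu> \<in> topspace ?O" for s \<nu>
  proof -
    have \<nu>: "\<nu> \<in> OS_f X" using that(3) by (simp only: topspace_OS_f_space)
    have Gb: "G \<nu> \<in> box" unfolding G_def by (rule grow_box[OF \<nu> T])
    show ?thesis
    proof (rule N[OF A_OS[OF \<nu> T]])
      show "mix X s (G \<nu>) (join X (G \<nu>) (S 0 \<nu>)) \<in> box"
        by (intro mix_box join_box Gb S_box \<nu> s) auto
      fix \<phi> assume \<phi>: "\<phi> \<in> \<Phi>"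
      have "Sup (\<phi> ` center X \<nu>) \<le> G \<nu> \<phi> + 3 * e"
      proof (rule exp_sets_attains[OF center_in_exp_sets[OF \<nu>] tests[OF \<phi>]])
        fix y assume "y \<in> center X \<nu>" "Sup (\<phi> ` center X \<nu>) = \<phi> y"
        then show ?thesis
          using center_le_grow[OF \<nu> \<phi> _ M(1) M(2)[OF \<phi>], of y T] by (simp add: T_def G_def)
      qed
      then have "S 0 \<nu> \<phi> \<le> G \<nu> \<phi> + 3 * e"
        using spread_apply[OF center_in_exp_sets[OF \<nu>] _ _ tests[OF \<phi>], of 0] by (simp add: S_def)
      then have "\<bar>join X (G \<nu>) (S 0 \<nu>) \<phi> - A T \<nu> \<phi>\<bar> \<le> 4 * e" "\<bar>G \<nu> \<phi> - A T \<nu> \<phi>\<bar> \<le> 4 * e"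
        using grow_A[OF \<nu> T \<phi>] e_pos by (auto simp: join_apply[OF tests[OF \<phi>]] G_def)
      then show "\<bar>mix X s (G \<nu>) (join X (G \<nu>) (S 0 \<nu>)) \<phi> - A T \<nu> \<phi>\<bar> \<le> 4 * e"
        unfolding mix_apply[OF tests[OF \<phi>]] by (intro mix_between s)
    qed
  qed
  have in3: "join X (G \<nu>) (S s \<nu>) \<in> N" if s: "0 \<le> s" "s \<le> 1" and "\<nu> \<in> topspace ?O" for s \<nu>
  proof -
    have \<nu>: "\<nu> \<in> OS_f X" using that(3) by (simp only: topspace_OS_f_space)
    note sg = spread_gens[OF center_in_exp_sets[OF \<nu>] s]
    note ag = approx_gens_P_f[OF T, of \<nu>] approx_gens_nonempty[OF \<nu>, of T]
    have "join X (A T \<nu>) (S s \<nu>) \<in> OS_f X"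
      unfolding A_def S_def spread_def
      by (subst nu_Un[symmetric]) (use ag sg P_f_subset_prob in \<open>blast intro: nu_in_OS_f\<close>)+
    then show ?thesis
    proof (rule N)
      show "join X (G \<nu>) (S s \<nu>) \<in> box"
        unfolding G_def by (intro join_box grow_box S_box \<nu> s T)
      fix \<phi> assume \<phi>: "\<phi> \<in> \<Phi>"
      show "\<bar>join X (G \<nu>) (S s \<nu>) \<phi> - join X (A T \<nu>) (S s \<nu>) \<phi>\<bar> \<le> 4 * e"
        using grow_A[OF \<nu> T \<phi>] e_pos by (auto simp: join_apply[OF tests[OF \<phi>]] G_def)
    qed
  qed
  have in4: "mix X s (join X (G \<nu>) (S 1 \<nu>)) (S 1 \<nu>) \<in> N" if s: "0 \<le> s" "s \<le> 1" and "\<nu> \<in> topspace ?O" for s \<nu>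
  proof -
    have \<nu>: "\<nu> \<in> OS_f X" using that(3) by (simp only: topspace_OS_f_space)
    have one: "0 \<le> (1::real)" "(1::real) \<le> 1" by auto
    show ?thesis
    proof (rule N[OF S_OS[OF \<nu> one]])
      show "mix X s (join X (G \<nu>) (S 1 \<nu>)) (S 1 \<nu>) \<in> box"
        unfolding G_def by (intro mix_box join_box grow_box S_box \<nu> s T one)
      fix \<phi> assume \<phi>: "\<phi> \<in> \<Phi>"
      have "A T \<nu> \<phi> \<le> S 1 \<nu> \<phi>" unfolding A_def S_def by (rule approx_le_spread[OF \<nu> T tests[OF \<phi>]])
      then have "\<bar>join X (G \<nu>) (S 1 \<nu>) \<phi> - S 1 \<nu> \<phi>\<bar> \<le> 4 * e" "\<bar>S 1 \<nu> \<phi> - S 1 \<nu> \<phi>\<bar> \<le> 4 * e"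
        using grow_A[OF \<nu> T \<phi>] e_pos by (auto simp: join_apply[OF tests[OF \<phi>]] G_def)
      then show "\<bar>mix X s (join X (G \<nu>) (S 1 \<nu>)) (S 1 \<nu>) \<phi> - S 1 \<nu> \<phi>\<bar> \<le> 4 * e"
        unfolding mix_apply[OF tests[OF \<phi>]] by (intro mix_between s)
    qed
  qed
  have in5: "S s \<nu> \<in> N" if s: "0 \<le> s" "s \<le> 1" and "\<nu> \<in> topspace ?O" for s \<nu>
  proof -
    have \<nu>: "\<nu> \<in> OS_f X" using that(3) by (simp only: topspace_OS_f_space)
    show ?thesis by (rule N[OF S_OS[OF \<nu> s] S_box[OF \<nu> s]]) (use e_pos in simp)
  qed
  have ext: "G \<nu> \<in> extensional (cfun X)" "join X (G \<nu>) \<mu> \<in> extensional (cfun X)"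
    "S t \<nu> \<in> extensional (cfun X)" for \<nu> \<mu> t
    by (simp_all add: G_def grow_def nu_def S_def spread_def join_def)
  let ?hom = "homotopic_with (\<lambda>_. True) ?O P"
  have "?hom (\<lambda>\<nu>. f (grow X Y \<psi> (T * 0) \<nu>)) (\<lambda>\<nu>. f (grow X Y \<psi> (T * 1) \<nu>))"
    by (rule homotopic_through[of ?O "fspace X" "\<lambda>s. grow X Y \<psi> (T * s)", OF cG1 in1 f])
  then have h1: "?hom (\<lambda>\<nu>. f (grow X Y \<psi> 0 \<nu>)) (\<lambda>\<nu>. f (G \<nu>))" by (simp add: G_def)
  have h2: "?hom (\<lambda>\<nu>. f (G \<nu>)) (\<lambda>\<nu>. f (join X (G \<nu>) (S 0 \<nu>)))"
    using homotopic_through[of ?O "fspace X" "\<lambda>s \<nu>. mix X s (G \<nu>) (join X (G \<nu>) (S 0 \<nu>))",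
        OF continuous_map_mix[OF fst cG continuous_map_join[OF cG cS0]] in2 f]
    by (simp add: mix_0 mix_1 ext)
  have h3: "?hom (\<lambda>\<nu>. f (join X (G \<nu>) (S 0 \<nu>))) (\<lambda>\<nu>. f (join X (G \<nu>) (S 1 \<nu>)))"
    by (rule homotopic_through[of ?O "fspace X" "\<lambda>s \<nu>. join X (G \<nu>) (S s \<nu>)", OF cJ in3 f])
  have h4: "?hom (\<lambda>\<nu>. f (join X (G \<nu>) (S 1 \<nu>))) (\<lambda>\<nu>. f (S 1 \<nu>))"
    using homotopic_through[of ?O "fspace X" "\<lambda>s \<nu>. mix X s (join X (G \<nu>) (S 1 \<nu>)) (S 1 \<nu>)",
        OF continuous_map_mix[OF fst continuous_map_join[OF cG cS1] cS1] in4 f]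
    by (simp add: mix_0 mix_1 ext)
  have h5: "?hom (\<lambda>\<nu>. f (S 0 \<nu>)) (\<lambda>\<nu>. f (S 1 \<nu>))"
    by (rule homotopic_through[of ?O "fspace X" S, OF cS in5 f])
  have h: "?hom (\<lambda>\<nu>. f (grow X Y \<psi> 0 \<nu>)) (\<lambda>\<nu>. f (S 0 \<nu>))"
    by (rule homotopic_with_trans[OF homotopic_with_trans[OF homotopic_with_trans[OF
            homotopic_with_trans[OF h1 h2] h3] h4] homotopic_with_symD[OF h5]])
  have "?hom f (\<lambda>\<nu>. f (grow X Y \<psi> 0 \<nu>))"
  proof (rule homotopic_with_symD, rule homotopic_with_equal)
    show "continuous_map ?O P (\<lambda>\<nu>. f (grow X Y \<psi> 0 \<nu>))"
      using homotopic_with_imp_continuous_maps[OF h] by blast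
    show "f (grow X Y \<psi> 0 \<nu>) = f \<nu>" if "\<nu> \<in> topspace ?O" for \<nu>
      using that grow_0 by (simp only: topspace_OS_f_space)
  qed auto
  from homotopic_with_trans[OF this h] show ?thesis by (simp add: S_def)
qed

end

context compact_Hausdorff
begin

text \<open>  The map is extended to a neighbourhood of \<open>OS_f X\<close> in \<open>box\<close>; the test functions, the tolerance and
  the net are then chosen for this neighbourhood.\<close>

lemma homotopic_into_ANR:
  assumes P: "P \<in> compact_ANRs" and g: "continuous_map (OS_f_space X) (top_of_set P) g"
  shows "homotopic_with (\<lambda>_. True) (OS_f_space X) (top_of_set P)
    (g \<circ> spread X 0 \<circ> center X) g"
proof -
  let ?B = "subtopology (fspace X) box"
  have "compact_space ?B" by (rule compact_space_subtopology[OF compactin_box])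
  moreover have "Hausdorff_space ?B" by (rule Hausdorff_space_subtopology[OF Hausdorff_fspace])
  ultimately have normB: "normal_space ?B" by (simp add: compact_Hausdorff_or_regular_imp_normal_space)
  have cl: "closedin ?B (OS_f X)"
    by (rule compactin_imp_closedin[OF \<open>Hausdorff_space ?B\<close>])
      (simp add: compactin_subtopology compactin_OS_f OS_f_subset_box)
  have "subtopology ?B (OS_f X) = OS_f_space X"
    unfolding OS_f_space_eq subtopology_subtopology using OS_f_subset_box by (simp add: inf_absorb2)
  with g have "continuous_map (subtopology ?B (OS_f X)) (top_of_set P) g" by simp
  then obtain W f where W: "openin ?B W" "OS_f X \<subseteq> W"
    and f: "continuous_map (subtopology ?B W) (top_of_set P) f" and fg: "\<And>\<nu>. \<nu> \<in> OS_f X \<Longrightarrow> f \<nu> = g \<nu>"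
    by (rule compact_ANR_neighbourhood_extension[OF normB cl P]) (rule that)
  obtain W' where W': "openin (fspace X) W'" "W = W' \<inter> box"
    using W(1) unfolding openin_subtopology by blast
  obtain \<Phi> \<epsilon> where \<Phi>: "finite \<Phi>" "\<Phi> \<subseteq> cfun X" "\<epsilon> > 0"
    and near: "\<And>\<mu> \<nu>. \<lbrakk>\<mu> \<in> OS_f X; \<nu> \<in> extensional (cfun X); \<And>\<phi>. \<phi> \<in> \<Phi> \<Longrightarrow> \<bar>\<nu> \<phi> - \<mu> \<phi>\<bar> < \<epsilon>\<rbrakk> \<Longrightarrow> \<nu> \<in> W'"
    by (rule uniform_neighbourhood[OF compactin_OS_f W'(1)]) (use W(2) W'(2) that in auto)
  \<comment> \<open>The neighbourhood must contain everything at distance at most \<open>4 e\<close>.\<close>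
  define e where "e = \<epsilon> / 5"
  have e: "e > 0" using \<Phi>(3) by (simp add: e_def)
  obtain Y \<psi> where net: "net X Y \<psi>"
    and close: "\<And>x y \<phi>. \<lbrakk>y \<in> Y; x \<in> topspace X; 0 < \<psi> y x; \<phi> \<in> \<Phi>\<rbrakk> \<Longrightarrow> \<bar>\<phi> x - \<phi> y\<bar> < e"
    and cover: "\<And>x. x \<in> topspace X \<Longrightarrow> \<exists>y\<in>Y. \<psi> y x = 1"
    by (rule net_exists[OF \<Phi>(1,2) e]) (rule that)
  have fine: "fine_net X Y \<psi> \<Phi> e"
    by (rule fine_net.intro[OF net], rule fine_net_axioms.intro) (use \<Phi> e close cover in auto)
  define M where "M = (\<Sum>\<phi>\<in>\<Phi>. sup_norm \<phi>) + 1"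
  have norm_pos: "0 \<le> sup_norm \<phi>" if "\<phi> \<in> \<Phi>" for \<phi>
    using sup_norm(1) that \<Phi>(2) by (meson less_imp_le subsetD)
  have M: "M > 0" "\<And>\<phi>. \<phi> \<in> \<Phi> \<Longrightarrow> sup_norm \<phi> \<le> M"
  proof -
    show "M > 0" unfolding M_def using sum_nonneg[of \<Phi> sup_norm] norm_pos by (simp add: add_nonneg_pos)
    show "sup_norm \<phi> \<le> M" if "\<phi> \<in> \<Phi>" for \<phi>
      using member_le_sum[OF that _ \<Phi>(1), of sup_norm] norm_pos unfolding M_def by auto
  qed
  have N: "\<nu> \<in> box \<inter> W"
    if "\<mu> \<in> OS_f X" "\<nu> \<in> box" "\<And>\<phi>. \<phi> \<in> \<Phi> \<Longrightarrow> \<bar>\<nu> \<phi> - \<mu> \<phi>\<bar> \<le> 4 * e" for \<mu> \<nu>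
  proof -
    have "\<nu> \<in> W'"
      by (rule near[OF that(1) box_extensional[OF that(2)]]) (use that(3) \<Phi>(3) in \<open>force simp: e_def\<close>)
    then show ?thesis using that(2) W'(2) by blast
  qed
  have "homotopic_with (\<lambda>_. True) (OS_f_space X) (top_of_set P) f (\<lambda>\<nu>. f (spread X 0 (center X \<nu>)))"
    by (rule fine_net.homotopic_to_spread_center[OF fine M N]) (use f in \<open>simp_all add: subtopology_subtopology\<close>)
  then have "homotopic_with (\<lambda>_. True) (OS_f_space X) (top_of_set P) (\<lambda>\<nu>. f (spread X 0 (center X \<nu>))) f"
    by (rule homotopic_with_symD)
  moreover have "(g \<circ> spread X 0 \<circ> center X) \<nu> = f (spread X 0 (center X \<nu>))" "g \<nu> = f \<nu>"
    if "\<nu> \<in> topspace (OS_f_space X)" for \<nu>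
    using that fg spread_in_OS_f[OF center_in_exp_sets, of \<nu> 0] unfolding topspace_OS_f_space by auto
  ultimately show ?thesis by (rule homotopic_with_eq) auto
qed

lemma continuous_diracs: "continuous_map (exp_space X) (OS_f_space X) (spread X 0)"
proof -
  have "continuous_map (exp_space X) (prod_topology (top_of_set {0..1::real}) (exp_space X)) (\<lambda>F. (0, F))"
    by (intro continuous_map_pairedI) (auto simp: continuous_map_in_subtopology)
  from continuous_map_compose[OF this continuous_spread]
  have "continuous_map (exp_space X) (fspace X) (spread X 0)" by (simp add: o_def)
  then show ?thesis
    unfolding OS_f_space_eq
    by (rule continuous_map_into_subtopology) (auto simp: topspace_exp_space intro: spread_in_OS_f)
qed

end

theorem corollary3p1:
  fixes X :: "'a topology"
  assumes "compact_space X" and "Hausdorff_space X"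
  shows "same_shape (exp_space X) (OS_f_space X)"
proof -
  interpret compact_Hausdorff X using assms by unfold_locales
  show ?thesis
  proof (rule same_shape_if_ANR_homotopic[OF continuous_diracs continuous_center])
    fix P and g :: "'a set \<Rightarrow> nat \<Rightarrow> real"
    assume g: "continuous_map (exp_space X) (top_of_set P) g"
    show "homotopic_with (\<lambda>_. True) (exp_space X) (top_of_set P) (g \<circ> center X \<circ> spread X 0) g"
    proof (rule homotopic_with_symD, rule homotopic_with_equal[OF _ _ g])
      show "g F = (g \<circ> center X \<circ> spread X 0) F" if "F \<in> topspace (exp_space X)" for F
        using that center_spread_0 by (simp add: topspace_exp_space)
    qed auto
  qed (rule homotopic_into_ANR)
qed

end
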